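(* Let $I$ be a monomial ideal of $R=\mathbb{K}[x_1,\dots,x_n]$, let $\mathcal{P}(I)\subseteq S$ be its polarization, and let $k$ be a positive integer. Then the following conditions are equivalent: (i) $I_{\ge k}$ has a linear resolution; (ii) $\mathcal{P}(I)_{\ge k}$ has a linear resolution; (iii) $\mathcal{P}(I)_k$ has a linear resolution.
   Context: $\mathbb{K}$ is a field and polynomial rings have the standard grading. For a graded ideal $L$ in a polynomial ring with graded maximal ideal $M$, $L_{\ge k}=L\cap M^k$. For a squarefree monomial ideal $L$, $L_k$ (the squarefree truncation past $k$) is $L\cap M_k$, where $M_k$ is the ideal generated by the squarefree monomials in $M^k$; equivalently $L_k$ is generated by all squarefree monomials of degree $\ge k$ in $L$. A graded ideal $L$ of a polynomial ring $A$ over $\mathbb{K}$ (equivalently $A/L$) has a $q$-linear resolution if $\operatorname{Tor}^A_i(A/L,\mathbb{K})_j=0$ for all $i>0$ and $j\ne q+i-1$, and has a linear resolution if it has a $q$-linear resolution for some $q$. Polarization: let $I$ have minimal monomial generators $u_1,\dots,u_t$ with $u_j=\prod_{i=1}^n x_i^{a_{i,j}}$, and let $a_i=\max\{a_{i,j}: 1\le j\le t\}$. Then $\mathcal{P}(I)$ is the squarefree monomial ideal of $S=\mathbb{K}[x_{i,l}: 1\le i\le n,\ 1\le l\le a_i]$ generated by $\mathcal{P}(u_j)=\prod_{i=1}^n\prod_{l=1}^{a_{i,j}}x_{i,l}$, $1\le j\le t$. *)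

theory Defs
  imports "HOL-Algebra.Elementary_Groups" "HOL-Algebra.Ideal_Product" "HOL-Library.Poly_Mapping"
begin

section \<open>Polynomial rings, monomials and grading\<close>

text \<open>
  A monomial is given by its exponent function, and a polynomial over \<open>'k\<close> by its finitely
  supported coefficient function on exponents.  The polynomial ring on a set \<open>V\<close> of variables
  consists of the polynomials that involve only variables in \<open>V\<close>.
\<close>

type_synonym ('x, 'k) mpoly = "('x \<Rightarrow>\<^sub>0 nat) \<Rightarrow>\<^sub>0 'k"

definition poly_ring :: "'x set \<Rightarrow> ('x, 'k::field) mpoly ring"
  where "poly_ring V =
    \<lparr>carrier = {p. \<forall>m \<in> Poly_Mapping.keys p. Poly_Mapping.keys m \<subseteq> V},
     mult = (*), one = 1, zero = 0, add = (+)\<rparr>"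

lemma cring_poly_ring: "cring (poly_ring V :: ('x, 'k::field) mpoly ring)"
proof (rule cringI)
  let ?A = "poly_ring V :: ('x, 'k) mpoly ring"
  have add: "p + q \<in> carrier ?A" if "p \<in> carrier ?A" "q \<in> carrier ?A" for p q
    using that Poly_Mapping.keys_add[of p q] by (auto simp: poly_ring_def)
  have uminus: "- p \<in> carrier ?A" if "p \<in> carrier ?A" for p
    using that by (auto simp: poly_ring_def)
  have mult: "p * q \<in> carrier ?A" if "p \<in> carrier ?A" "q \<in> carrier ?A" for p q
  proof -
    have "Poly_Mapping.keys m \<subseteq> V" if "m \<in> Poly_Mapping.keys (p * q)" for m
    proof -
      obtain a b where "m = a + b" "a \<in> Poly_Mapping.keys p" "b \<in> Poly_Mapping.keys q"
        using \<open>m \<in> Poly_Mapping.keys (p * q)\<close> keys_mult[of p q] by blast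
      then show ?thesis
        using \<open>p \<in> carrier ?A\<close> \<open>q \<in> carrier ?A\<close> Poly_Mapping.keys_add[of a b]
        by (fastforce simp: poly_ring_def)
    qed
    then show ?thesis by (auto simp: poly_ring_def)
  qed
  show "abelian_group ?A"
  proof (rule abelian_groupI)
    fix p assume "p \<in> carrier ?A"
    then have "- p \<in> carrier ?A" "- p \<oplus>\<^bsub>?A\<^esub> p = \<zero>\<^bsub>?A\<^esub>"
      using uminus by (auto simp: poly_ring_def)
    then show "\<exists>q \<in> carrier ?A. q \<oplus>\<^bsub>?A\<^esub> p = \<zero>\<^bsub>?A\<^esub>" by blast
  next
    fix p q assume "p \<in> carrier ?A" "q \<in> carrier ?A"
    then show "p \<oplus>\<^bsub>?A\<^esub> q \<in> carrier ?A" using add[of p q] by (simp add: poly_ring_def)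
  qed (simp_all add: poly_ring_def ac_simps)
  show "comm_monoid ?A"
  proof (rule comm_monoidI)
    fix p q assume "p \<in> carrier ?A" "q \<in> carrier ?A"
    then show "p \<otimes>\<^bsub>?A\<^esub> q \<in> carrier ?A" using mult[of p q] by (simp add: poly_ring_def)
  qed (simp_all add: poly_ring_def ac_simps)
qed (simp_all add: poly_ring_def distrib_right)

definition monomial :: "('x \<Rightarrow>\<^sub>0 nat) \<Rightarrow> ('x, 'k::field) mpoly"
  where "monomial m = Poly_Mapping.single m 1"

definition var :: "'x \<Rightarrow> ('x, 'k::field) mpoly"
  where "var x = monomial (Poly_Mapping.single x 1)"

definition mdeg :: "('x \<Rightarrow>\<^sub>0 nat) \<Rightarrow> nat"
  where "mdeg m = (\<Sum>x \<in> Poly_Mapping.keys m. Poly_Mapping.lookup m x)"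

definition graded_max_ideal :: "'x set \<Rightarrow> ('x, 'k::field) mpoly set"
  where "graded_max_ideal V = Idl\<^bsub>poly_ring V\<^esub> (var ` V)"

definition max_ideal_power :: "'x set \<Rightarrow> nat \<Rightarrow> ('x, 'k::field) mpoly set"
  where "max_ideal_power V k = graded_max_ideal V [^]\<^bsub>ideals_set (poly_ring V)\<^esub> k"

definition truncation :: "'x set \<Rightarrow> ('x, 'k::field) mpoly set \<Rightarrow> nat \<Rightarrow> ('x, 'k) mpoly set"
  where "truncation V L k = L \<inter> max_ideal_power V k"

definition squarefree_max_ideal :: "'x set \<Rightarrow> nat \<Rightarrow> ('x, 'k::field) mpoly set"
  where "squarefree_max_ideal V k =
    Idl\<^bsub>poly_ring V\<^esub> {monomial m | m.
      (\<forall>x. Poly_Mapping.lookup m x \<le> 1) \<and> monomial m \<in> (max_ideal_power V k :: ('x, 'k) mpoly set)}"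

definition squarefree_truncation ::
    "'x set \<Rightarrow> ('x, 'k::field) mpoly set \<Rightarrow> nat \<Rightarrow> ('x, 'k) mpoly set"
  where "squarefree_truncation V L k = L \<inter> squarefree_max_ideal V k"


section \<open>Monomial ideals and polarization\<close>

definition monomial_ideal :: "'x set \<Rightarrow> ('x, 'k::field) mpoly set \<Rightarrow> bool"
  where "monomial_ideal V I \<longleftrightarrow>
    (\<exists>U \<subseteq> {m. Poly_Mapping.keys m \<subseteq> V}. I = Idl\<^bsub>poly_ring V\<^esub> (monomial ` U))"

definition minimal_monomial_generators ::
    "'x set \<Rightarrow> ('x, 'k::field) mpoly set \<Rightarrow> ('x \<Rightarrow>\<^sub>0 nat) set"
  where "minimal_monomial_generators V I =
    (THE U. U \<subseteq> {m. Poly_Mapping.keys m \<subseteq> V} \<and> Idl\<^bsub>poly_ring V\<^esub> (monomial ` U) = I \<and>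
      (\<forall>W. W \<subset> U \<longrightarrow> Idl\<^bsub>poly_ring V\<^esub> (monomial ` W) \<noteq> I))"

text \<open>
  The inserted \<open>0\<close> only matters for the zero ideal, which has no generators; all other
  elements of the set are natural numbers anyway.
\<close>

definition max_exponent :: "'x set \<Rightarrow> ('x, 'k::field) mpoly set \<Rightarrow> 'x \<Rightarrow> nat"
  where "max_exponent V I x =
    Max (insert 0 ((\<lambda>u. Poly_Mapping.lookup u x) ` minimal_monomial_generators V I))"

definition polarization_vars :: "'x set \<Rightarrow> ('x, 'k::field) mpoly set \<Rightarrow> ('x \<times> nat) set"
  where "polarization_vars V I = (SIGMA x : V. {1..max_exponent V I x})"

definition polarize_monomial :: "'x set \<Rightarrow> ('x \<Rightarrow>\<^sub>0 nat) \<Rightarrow> ('x \<times> nat, 'k::field) mpoly"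
  where "polarize_monomial V u = (\<Prod>x\<in>V. \<Prod>l = 1..Poly_Mapping.lookup u x. var (x, l))"

definition polarization ::
    "'x set \<Rightarrow> ('x, 'k::field) mpoly set \<Rightarrow> ('x \<times> nat, 'k) mpoly set"
  where "polarization V I =
    Idl\<^bsub>poly_ring (polarization_vars V I)\<^esub>
      (polarize_monomial V ` minimal_monomial_generators V I)"


section \<open>Graded free resolutions and Tor\<close>

text \<open>
  Elements of a free module with basis \<open>B \<subseteq> \<nat>\<close> are finitely supported coordinate functions on
  \<open>B\<close>.  A homomorphism out of it is given by the images of the basis elements, that is, by the
  columns of its matrix, and \<open>lin_ext\<close> is its linear extension.
\<close>

definition lin_ext :: "(nat \<Rightarrow> (nat \<Rightarrow>\<^sub>0 'c::comm_ring_1)) \<Rightarrow> (nat \<Rightarrow>\<^sub>0 'c) \<Rightarrow> (nat \<Rightarrow>\<^sub>0 'c)"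
  where "lin_ext D v =
    (\<Sum>b \<in> Poly_Mapping.keys v. Poly_Mapping.map ((*) (Poly_Mapping.lookup v b)) (D b))"

definition free_module :: "'x set \<Rightarrow> nat set \<Rightarrow> (nat \<Rightarrow>\<^sub>0 ('x, 'k::field) mpoly) set"
  where "free_module V B =
    {v. Poly_Mapping.keys v \<subseteq> B \<and> (\<forall>b. Poly_Mapping.lookup v b \<in> carrier (poly_ring V))}"

text \<open>The degree \<open>j\<close> component, when the basis element \<open>b\<close> is given the degree \<open>dg b\<close>.\<close>

definition free_module_component ::
    "'x set \<Rightarrow> nat set \<Rightarrow> (nat \<Rightarrow> nat) \<Rightarrow> nat \<Rightarrow> (nat \<Rightarrow>\<^sub>0 ('x, 'k::field) mpoly) set"
  where "free_module_component V B dg j =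
    {v \<in> free_module V B.
      \<forall>b. \<forall>m \<in> Poly_Mapping.keys (Poly_Mapping.lookup v b). mdeg m + dg b = j}"

text \<open>
  Data of a resolution of \<open>A/L\<close>, where \<open>A = poly_ring V\<close>: the module \<open>F\<^sub>i\<close> is free on
  \<open>res_basis F i\<close>, and \<open>res_degree F i\<close> gives the degrees of the basis
  elements.  For \<open>i > 0\<close>, \<open>res_diff F i b\<close> is the image in \<open>F\<^bsub>i - 1\<^esub>\<close> of the basis element \<open>b\<close>
  of \<open>F\<^sub>i\<close>; \<open>res_diff F 0\<close> is not used.  The augmentation \<open>F\<^sub>0 \<rightarrow> A/L\<close> sends the basis
  element \<open>b\<close> to the residue class of \<open>res_aug F b\<close>.  Bases are arbitrary subsets of \<open>\<nat>\<close>: over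
  finitely many variables, every \<open>A/L\<close> even has a resolution by free modules of finite rank.
\<close>

record (overloaded) ('x, 'k) resolution =
  res_basis :: "nat \<Rightarrow> nat set"
  res_degree :: "nat \<Rightarrow> nat \<Rightarrow> nat"
  res_diff :: "nat \<Rightarrow> nat \<Rightarrow> (nat \<Rightarrow>\<^sub>0 (('x \<Rightarrow>\<^sub>0 nat) \<Rightarrow>\<^sub>0 'k::field))"
  res_aug :: "nat \<Rightarrow> (('x \<Rightarrow>\<^sub>0 nat) \<Rightarrow>\<^sub>0 'k::field)"

definition augmentation ::
    "('x, 'k::field) resolution \<Rightarrow> (nat \<Rightarrow>\<^sub>0 ('x, 'k) mpoly) \<Rightarrow> ('x, 'k) mpoly"
  where "augmentation F v =
    (\<Sum>b \<in> Poly_Mapping.keys v. Poly_Mapping.lookup v b * res_aug F b)"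

definition graded_free_resolution ::
    "'x set \<Rightarrow> ('x, 'k::field) mpoly set \<Rightarrow> ('x, 'k) resolution \<Rightarrow> bool"
  where "graded_free_resolution V L F \<longleftrightarrow>
    \<comment> \<open>the maps are homogeneous of degree 0\<close>
    (\<forall>b \<in> res_basis F 0. res_aug F b \<in> carrier (poly_ring V) \<and>
      (\<forall>m \<in> Poly_Mapping.keys (res_aug F b). mdeg m = res_degree F 0 b)) \<and>
    (\<forall>i. \<forall>b \<in> res_basis F (Suc i). res_diff F (Suc i) b \<in>
      free_module_component V (res_basis F i) (res_degree F i) (res_degree F (Suc i) b)) \<and>
    \<comment> \<open>exactness at \<open>A/L\<close>, at \<open>F\<^sub>0\<close> and at \<open>F\<^sub>i\<close> for \<open>i > 0\<close>\<close>
    (\<forall>p \<in> carrier (poly_ring V). \<exists>v \<in> free_module V (res_basis F 0). p - augmentation F v \<in> L) \<and>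
    {v \<in> free_module V (res_basis F 0). augmentation F v \<in> L} =
      lin_ext (res_diff F 1) ` free_module V (res_basis F 1) \<and>
    (\<forall>i > 0. {v \<in> free_module V (res_basis F i). lin_ext (res_diff F i) v = 0} =
      lin_ext (res_diff F (Suc i)) ` free_module V (res_basis F (Suc i)))"

text \<open>
  Here \<open>\<K>\<close> is \<open>A\<close> modulo its graded maximal ideal, and the residue class of a polynomial is its
  constant coefficient.  So \<open>F\<^sub>i \<otimes> \<K>\<close> is the vector space with basis \<open>res_basis F i\<close>, and the
  matrix of its differential consists of the constant coefficients of the entries of the matrix
  of \<open>F\<close>.  Its degree \<open>j\<close> component is spanned by the basis elements of degree \<open>j\<close>.
\<close>

definition residue :: "('x, 'k::field) mpoly \<Rightarrow> 'k"
  where "residue p = Poly_Mapping.lookup p 0"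

definition tensor_component ::
    "('x, 'k::field) resolution \<Rightarrow> nat \<Rightarrow> nat \<Rightarrow> (nat \<Rightarrow>\<^sub>0 'k) set"
  where "tensor_component F i j =
    {c. Poly_Mapping.keys c \<subseteq> {b \<in> res_basis F i. res_degree F i b = j}}"

definition tensor_diff ::
    "('x, 'k::field) resolution \<Rightarrow> nat \<Rightarrow> (nat \<Rightarrow>\<^sub>0 'k) \<Rightarrow> (nat \<Rightarrow>\<^sub>0 'k)"
  where "tensor_diff F i =
    (if i = 0 then (\<lambda>c. 0) else lin_ext (\<lambda>b. Poly_Mapping.map residue (res_diff F i b)))"

definition tensor_cycles ::
    "('x, 'k::field) resolution \<Rightarrow> nat \<Rightarrow> nat \<Rightarrow> (nat \<Rightarrow>\<^sub>0 'k) monoid"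
  where "tensor_cycles F i j =
    \<lparr>carrier = {c \<in> tensor_component F i j. tensor_diff F i c = 0}, mult = (+), one = 0\<rparr>"

definition tensor_boundaries ::
    "('x, 'k::field) resolution \<Rightarrow> nat \<Rightarrow> nat \<Rightarrow> (nat \<Rightarrow>\<^sub>0 'k) set"
  where "tensor_boundaries F i j = tensor_diff F (Suc i) ` tensor_component F (Suc i) j"

text \<open>
  \<open>Tor V L i j\<close> is the additive group of the degree \<open>j\<close> component of the \<open>i\<close>-th Tor of \<open>A/L\<close> and
  \<open>\<K>\<close>, where \<open>A = poly_ring V\<close>.  Up to isomorphism it does not depend on the chosen resolution.
\<close>

definition Tor ::
    "'x set \<Rightarrow> ('x, 'k::field) mpoly set \<Rightarrow> nat \<Rightarrow> nat \<Rightarrow> (nat \<Rightarrow>\<^sub>0 'k) set monoid"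
  where "Tor V L i j =
    (let F = (SOME F. graded_free_resolution V L F)
     in tensor_cycles F i j Mod tensor_boundaries F i j)"

definition has_q_linear_resolution :: "'x set \<Rightarrow> ('x, 'k::field) mpoly set \<Rightarrow> nat \<Rightarrow> bool"
  where "has_q_linear_resolution V L q \<longleftrightarrow>
    (\<forall>i > 0. \<forall>j. j \<noteq> q + i - 1 \<longrightarrow> trivial_group (Tor V L i j))"

definition has_linear_resolution :: "'x set \<Rightarrow> ('x, 'k::field) mpoly set \<Rightarrow> bool"
  where "has_linear_resolution V L \<longleftrightarrow> (\<exists>q. has_q_linear_resolution V L q)"

end

theory Submission
  imports Defs "HOL-Library.Function_Algebras" "HOL-Library.Nat_Bijection"
begin

text \<open>
  For a monomial ideal \<open>L\<close>, the multidegree \<open>a\<close> part of \<open>Tor\<^sub>i(A/L, K)\<close> is, for \<open>i > 0\<close> and \<open>a \<noteq> 0\<close>, the homology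
  of the simplicial complex \<open>\<Delta>\<^sub>a(L)\<close> of all sets \<open>\<sigma>\<close> of variables with \<open>x\<^sup>a / x\<^sup>\<sigma> \<in> L\<close>, taken at the faces of cardinality \<open>i - 1\<close>
  (balance an arbitrary free resolution against the Koszul complex).  Replacing \<open>L\<close> by \<open>L\<^bsub>\<ge>k\<^esub>\<close> replaces
  \<open>\<Delta>\<^sub>a(L)\<close> by its subcomplex of faces of cardinality at most \<open>|a| - k\<close>.  If \<open>L\<close> is squarefree, the squarefree truncation
  does the same in squarefree degrees, and in the other degrees the complexes are cones.  So as soon as \<open>L\<close>
  has an element of degree below \<open>k\<close>, a linear resolution of either truncation means that \<open>Tor\<^sub>i(A/L, K)\<close> vanishes in
  all degrees above \<open>k + i - 1\<close>; otherwise truncating changes nothing.  Finally, Tor can also be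
  computed from the Taylor resolution, and after tensoring with \<open>K\<close> the Taylor complex of \<open>L\<close> only depends on the degrees of
  the least common multiples of the generators, which polarization preserves.
\<close>

section \<open>The simplicial boundary and Taylor complexes\<close>

text \<open>\<open>Tor\<close> is read off from an unspecified resolution, which need be neither
  minimal nor of finite rank. So nothing may rest on Betti numbers: all statements are about
  vanishing in one total degree, and balancing compares exactness properties instead of constructing
  isomorphisms. The Taylor resolution also guarantees that the choice in \<open>Tor\<close> yields a
  resolution at all. The Koszul complex is the Taylor complex of the variables, hence one
  differential \<open>tdiff\<close>, one contraction \<open>thom\<close> and one decomposition
  \<open>strand\<close> into multidegrees serve both. Two boundary cases shape the statements. In
  total degree 0 the passage from A/L to L fails when L is the whole ring, hence the disjuncts
  \<open>j = 0\<close>. And a truncation of a nonzero ideal can vanish for lack of variables: the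
  squarefree one when k exceeds their number, the ordinary one when there are none, as for the
  polarization of the unit ideal.\<close>

type_synonym 'x expo = "'x \<Rightarrow>\<^sub>0 nat"

abbreviation "lookup \<equiv> Poly_Mapping.lookup"
abbreviation "keys \<equiv> Poly_Mapping.keys"
abbreviation "single \<equiv> Poly_Mapping.single"

definition ksign :: "nat \<Rightarrow> nat set \<Rightarrow> 'a::comm_ring_1"
  where "ksign s \<tau> = (-1) ^ card {t \<in> \<tau>. t < s}"

text \<open>A chain is its coefficient function on faces, so the value at \<tau> collects the faces
  obtained by adding one vertex. The empty face takes part, which makes this the reduced complex of
  the simplex on r vertices.\<close>

definition bd :: "nat \<Rightarrow> (nat set \<Rightarrow> 'a::comm_ring_1) \<Rightarrow> nat set \<Rightarrow> 'a"
  where "bd r g \<tau> = (\<Sum>s\<in>{..<r} - \<tau>. ksign s \<tau> * g (insert s \<tau>))"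

text \<open>Exterior multiplication by the vertex s, the contracting homotopy of the full
  simplex.\<close>

definition cone :: "nat \<Rightarrow> (nat set \<Rightarrow> 'a::comm_ring_1) \<Rightarrow> nat set \<Rightarrow> 'a"
  where "cone s g \<sigma> = (if s \<in> \<sigma> then ksign s (\<sigma> - {s}) * g (\<sigma> - {s}) else 0)"

lemma ksign_mult_self [simp]: "ksign s \<tau> * ksign s \<tau> = 1"
  by (simp add: ksign_def flip: power_mult_distrib)

lemma ksign_mult_self_left [simp]: "ksign s \<tau> * (ksign s \<tau> * c) = c"
  by (simp flip: mult.assoc)

lemma ksign_insert:
  assumes "t \<notin> \<tau>"
  shows "ksign s (insert t \<tau>) = (if t < s then - ksign s \<tau> else ksign s \<tau>)"
proof (cases "t < s")
  case True
  then have "{u \<in> insert t \<tau>. u < s} = insert t {u \<in> \<tau>. u < s}" by auto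
  then show ?thesis using True assms by (simp add: ksign_def)
next
  case False
  then have "{u \<in> insert t \<tau>. u < s} = {u \<in> \<tau>. u < s}" by auto
  then show ?thesis using False by (simp add: ksign_def)
qed

text \<open>The terms for (s, t) and (t, s) cancel in pairs. Splitting the sum at s < t avoids
  division by 2, so characteristic 2 is covered.\<close>

lemma sum_antisymmetric:
  fixes A :: "nat \<Rightarrow> nat \<Rightarrow> 'a::comm_ring_1"
  assumes "finite S" and "\<And>s t. s \<in> S \<Longrightarrow> t \<in> S \<Longrightarrow> s \<noteq> t \<Longrightarrow> A s t = - A t s"
  shows "(\<Sum>s\<in>S. \<Sum>t\<in>S - {s}. A s t) = 0"
proof -
  let ?L = "{(s, t). s \<in> S \<and> t \<in> S \<and> s < t}" and ?G = "{(s, t). s \<in> S \<and> t \<in> S \<and> t < s}"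
  have fin: "finite ?L" "finite ?G"
    by (rule finite_subset[of _ "S \<times> S"]; use assms(1) in auto)+
  have "(\<Sum>s\<in>S. \<Sum>t\<in>S - {s}. A s t) = (\<Sum>(s, t)\<in>(SIGMA s : S. S - {s}). A s t)"
    using assms(1) by (simp add: sum.Sigma)
  also have "(SIGMA s : S. S - {s}) = ?L \<union> ?G" by auto
  also have "(\<Sum>(s, t)\<in>?L \<union> ?G. A s t) = (\<Sum>(s, t)\<in>?L. A s t) + (\<Sum>(s, t)\<in>?G. A s t)"
    using fin by (intro sum.union_disjoint) auto
  also have "(\<Sum>(s, t)\<in>?G. A s t) = (\<Sum>(s, t)\<in>?L. A t s)"
    by (rule sum.reindex_bij_witness[of _ prod.swap prod.swap]) auto
  also have "(\<Sum>(s, t)\<in>?L. A t s) = (\<Sum>(s, t)\<in>?L. - A s t)"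
    by (rule sum.cong) (use assms(2) in auto)
  finally show ?thesis by (simp add: case_prod_unfold sum_negf)
qed

lemma bd_bd: "bd r (bd r g) = 0"
proof
  fix \<tau>
  let ?S = "{..<r} - \<tau>"
  let ?A = "\<lambda>s t. ksign s \<tau> * (ksign t (insert s \<tau>) * g (insert t (insert s \<tau>)))"
  have "bd r (bd r g) \<tau> = (\<Sum>s\<in>?S. \<Sum>t\<in>?S - {s}. ?A s t)"
    unfolding bd_def sum_distrib_left by (intro sum.cong) auto
  also have "\<dots> = 0"
  proof (rule sum_antisymmetric)
    fix s t assume "s \<in> ?S" "t \<in> ?S" "s \<noteq> t"
    then show "?A s t = - ?A t s"
      by (cases "s < t") (auto simp: ksign_insert insert_commute[of s t])
  qed simp
  finally show "bd r (bd r g) \<tau> = 0 \<tau>" by simp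
qed

lemma bd_cone:
  assumes "s0 < r"
  shows "bd r (cone s0 g) + cone s0 (bd r g) = g"
proof
  fix \<tau>
  show "(bd r (cone s0 g) + cone s0 (bd r g)) \<tau> = g \<tau>"
  proof (cases "s0 \<in> \<tau>")
    case False
    have "bd r (cone s0 g) \<tau> = (\<Sum>s\<in>{s0}. ksign s \<tau> * cone s0 g (insert s \<tau>))"
      unfolding bd_def using False assms by (intro sum.mono_neutral_right) (auto simp: cone_def)
    also have "\<dots> = g \<tau>" using False by (simp add: cone_def)
    finally show ?thesis using False by (simp add: cone_def)
  next
    case True
    \<comment> \<open>With s0 removed, the s0-term of the boundary gives back g \<tau>; every other
      term meets its negative in the other summand, since adding s0 and s in the two orders differs
      by a sign.\<close>
    define \<rho> where "\<rho> = \<tau> - {s0}"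
    have \<tau>: "\<tau> = insert s0 \<rho>" "s0 \<notin> \<rho>" using True by (auto simp: \<rho>_def)
    have S: "{..<r} - \<rho> = insert s0 ({..<r} - \<tau>)" "s0 \<notin> {..<r} - \<tau>"
      using assms \<tau> by auto
    have "cone s0 (bd r g) \<tau> = ksign s0 \<rho> * bd r g \<rho>"
      using \<tau> by (simp add: cone_def)
    also have "\<dots> = g \<tau> + (\<Sum>s\<in>{..<r} - \<tau>. ksign s0 \<rho> * (ksign s \<rho> * g (insert s \<rho>)))"
      unfolding bd_def S(1) using S(2) \<tau> by (simp add: distrib_left sum_distrib_left)
    finally have 1: "cone s0 (bd r g) \<tau> = \<dots>" .
    have "bd r (cone s0 g) \<tau> = (\<Sum>s\<in>{..<r} - \<tau>. - (ksign s0 \<rho> * (ksign s \<rho> * g (insert s \<rho>))))"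
      unfolding bd_def
    proof (rule sum.cong)
      fix s assume s: "s \<in> {..<r} - \<tau>"
      then have "insert s \<tau> - {s0} = insert s \<rho>" "s \<noteq> s0" "s \<notin> \<rho>" using \<tau> by auto
      moreover have "s < s0 \<or> s0 < s" using \<open>s \<noteq> s0\<close> by auto
      ultimately show "ksign s \<tau> * cone s0 g (insert s \<tau>) =
          - (ksign s0 \<rho> * (ksign s \<rho> * g (insert s \<rho>)))"
        using \<tau> by (auto simp: cone_def ksign_insert algebra_simps)
    qed simp
    then show ?thesis using 1 by (simp add: sum_negf)
  qed
qed

lemma bd_zero [simp]: "bd r 0 = 0"
  by (simp add: bd_def fun_eq_iff)

lemma cone_zero [simp]: "cone r 0 = 0"
  by (simp add: cone_def fun_eq_iff)

section \<open>Divisibility and least common multiples of exponents\<close>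

definition edvd :: "'x expo \<Rightarrow> 'x expo \<Rightarrow> bool"
  where "edvd m m' \<longleftrightarrow> (\<forall>x. lookup m x \<le> lookup m' x)"

lemma edvd_refl [simp]: "edvd m m"
  by (simp add: edvd_def)

lemma edvd_zero [simp]: "edvd 0 m"
  by (simp add: edvd_def)

lemma edvd_trans [trans]: "edvd a b \<Longrightarrow> edvd b c \<Longrightarrow> edvd a c"
  unfolding edvd_def using le_trans by blast

lemma edvd_add [simp]: "edvd a (a + b)" "edvd a (b + a)"
  by (simp_all add: edvd_def lookup_add)

lemma edvd_add_minus: "edvd a b \<Longrightarrow> a + (b - a) = b"
  by (rule poly_mapping_eqI) (simp add: edvd_def lookup_add lookup_minus)

lemma edvd_minus_add: "edvd a b \<Longrightarrow> b - a + a = b"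
  by (rule poly_mapping_eqI) (simp add: edvd_def lookup_add lookup_minus)

lemma edvd_minus_minus: "edvd a b \<Longrightarrow> edvd b c \<Longrightarrow> c - a - (b - a) = c - b"
  by (rule poly_mapping_eqI) (simp add: edvd_def lookup_minus)

lemma edvd_keys: "edvd a b \<Longrightarrow> keys a \<subseteq> keys b"
  unfolding edvd_def in_keys_iff subset_iff by (metis le_0_eq)

lemma keys_add_exp:
  fixes a b :: "'x expo"
  shows "keys (a + b) = keys a \<union> keys b"
  by (auto simp: in_keys_iff lookup_add)

lemma mdeg_superset:
  assumes "finite A" "keys m \<subseteq> A"
  shows "mdeg m = (\<Sum>x\<in>A. lookup m x)"
  unfolding mdeg_def using assms by (intro sum.mono_neutral_left) (auto simp: in_keys_iff)

lemma mdeg_add [simp]: "mdeg (a + b) = mdeg a + mdeg b"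
proof -
  have "mdeg a = (\<Sum>x\<in>keys (a + b). lookup a x)"
       "mdeg b = (\<Sum>x\<in>keys (a + b). lookup b x)"
    by (rule mdeg_superset; simp add: keys_add_exp)+
  then show ?thesis unfolding mdeg_def[of "a + b"] by (simp add: lookup_add sum.distrib)
qed

lemma mdeg_zero [simp]: "mdeg 0 = 0"
  by (simp add: mdeg_def)

lemma mdeg_eq_0_iff [simp]: "mdeg m = 0 \<longleftrightarrow> m = 0"
  by (auto simp: mdeg_def in_keys_iff poly_mapping_eq_iff fun_eq_iff)

lemma mdeg_single [simp]: "mdeg (single x c) = c"
  by (simp add: mdeg_def)

lemma mdeg_minus: "edvd a b \<Longrightarrow> mdeg (b - a) = mdeg b - mdeg a"
  by (metis edvd_minus_add mdeg_add add_diff_cancel_right')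

lemma edvd_mdeg: "edvd a b \<Longrightarrow> mdeg a \<le> mdeg b"
  by (metis edvd_minus_add mdeg_add le_add2)

lemma edvd_mdeg_eq: "edvd a b \<Longrightarrow> mdeg a = mdeg b \<Longrightarrow> a = b"
  by (metis edvd_minus_add mdeg_add add_cancel_left_left mdeg_eq_0_iff)

text \<open>Only the indices below \<open>r\<close> count, so \<open>\<sigma>\<close> need not be finite.\<close>

definition elcm :: "(nat \<Rightarrow> 'x expo) \<Rightarrow> nat \<Rightarrow> nat set \<Rightarrow> 'x expo"
  where "elcm u r \<sigma> = Abs_poly_mapping
    (\<lambda>x. Max (insert 0 ((\<lambda>s. lookup (u s) x) ` (\<sigma> \<inter> {..<r}))))"

lemma lookup_elcm:
  "lookup (elcm u r \<sigma>) x = Max (insert 0 ((\<lambda>s. lookup (u s) x) ` (\<sigma> \<inter> {..<r})))"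
proof -
  have "{x. Max (insert 0 ((\<lambda>s. lookup (u s) x) ` (\<sigma> \<inter> {..<r}))) \<noteq> 0}
      \<subseteq> (\<Union>s<r. keys (u s))"
  proof
    fix x assume "x \<in> {x. Max (insert 0 ((\<lambda>s. lookup (u s) x) ` (\<sigma> \<inter> {..<r}))) \<noteq> 0}"
    then have "0 < Max (insert 0 ((\<lambda>s. lookup (u s) x) ` (\<sigma> \<inter> {..<r})))" by simp
    then obtain s where "s < r" "0 < lookup (u s) x"
      by (subst (asm) Max_gr_iff) auto
    then show "x \<in> (\<Union>s<r. keys (u s))" by (auto simp: in_keys_iff)
  qed
  then show ?thesis
    unfolding elcm_def by (subst lookup_Abs_poly_mapping) (auto intro: finite_subset)
qed

lemma edvd_elcm_iff: "edvd (elcm u r \<sigma>) a \<longleftrightarrow> (\<forall>s\<in>\<sigma>. s < r \<longrightarrow> edvd (u s) a)"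
  unfolding edvd_def lookup_elcm by (auto simp: Max_le_iff)

lemma elcm_empty [simp]: "elcm u r {} = 0"
  by (rule poly_mapping_eqI) (simp add: lookup_elcm)

lemma edvd_elcm_mono: "\<sigma> \<subseteq> \<sigma>' \<Longrightarrow> edvd (elcm u r \<sigma>) (elcm u r \<sigma>')"
  unfolding edvd_elcm_iff using edvd_elcm_iff[of u r \<sigma>' "elcm u r \<sigma>'"] by auto

lemma edvd_elcm: "s \<in> \<sigma> \<Longrightarrow> s < r \<Longrightarrow> edvd (u s) (elcm u r \<sigma>)"
  using edvd_elcm_iff[of u r \<sigma> "elcm u r \<sigma>"] by auto

lemma keys_elcm: "keys (elcm u r \<sigma>) \<subseteq> (\<Union>s<r. keys (u s))"
proof
  fix x assume "x \<in> keys (elcm u r \<sigma>)"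
  then have "0 < Max (insert 0 ((\<lambda>s. lookup (u s) x) ` (\<sigma> \<inter> {..<r})))"
    by (simp add: in_keys_iff lookup_elcm)
  then obtain s where "s < r" "0 < lookup (u s) x"
    by (subst (asm) Max_gr_iff) auto
  then show "x \<in> (\<Union>s<r. keys (u s))" by (auto simp: in_keys_iff)
qed

section \<open>Taylor chains and their multidegrees\<close>

lemma lookup_single_mult:
  fixes p :: "('x, 'k::comm_ring_1) mpoly"
  shows "lookup (single c k * p) m =
    (if edvd c m then k * lookup p (m - c) else 0)"
proof -
  have "lookup (single c k * p) m =
     k * (\<Sum>q. lookup p q when m = c + q)"
    unfolding lookup_mult lookup_single when_mult by (simp add: Sum_any_when_equal)
  also have "(\<lambda>q. lookup p q when m = c + q) =
      (\<lambda>q. (lookup p q when edvd c m) when q = m - c)"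
    by (auto simp: fun_eq_iff when_def edvd_add_minus)
  finally show ?thesis by simp
qed

text \<open>Same convention as \<open>bd\<close>, with polynomial coefficients and the monomials
  that make the Taylor differential homogeneous.\<close>

definition tdiff :: "(nat \<Rightarrow> 'x expo) \<Rightarrow> nat \<Rightarrow> (nat set \<Rightarrow> ('x, 'k::field) mpoly) \<Rightarrow> nat set \<Rightarrow> ('x, 'k) mpoly"
  where "tdiff u r f \<tau> = (\<Sum>s\<in>{..<r} - \<tau>.
    single (elcm u r (insert s \<tau>) - elcm u r \<tau>) (ksign s \<tau>) * f (insert s \<tau>))"

text \<open>The basis element \<open>\<sigma>\<close> of the Taylor complex has multidegree \<open>elcm u r \<sigma>\<close>, so this is the part of multidegree \<open>a\<close>
  of the chain \<open>f\<close>.\<close>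

definition strand :: "(nat \<Rightarrow> 'x expo) \<Rightarrow> nat \<Rightarrow> (nat set \<Rightarrow> ('x, 'k::field) mpoly) \<Rightarrow> 'x expo \<Rightarrow> nat set \<Rightarrow> 'k"
  where "strand u r f a \<sigma> =
    (if edvd (elcm u r \<sigma>) a then lookup (f \<sigma>) (a - elcm u r \<sigma>) else 0)"

lemma tdiff_diff: "tdiff u r (f - g) = tdiff u r f - tdiff u r g"
  by (simp add: tdiff_def fun_eq_iff right_diff_distrib sum_subtractf)

lemma tdiff_zero [simp]: "tdiff u r 0 = 0"
  by (simp add: tdiff_def fun_eq_iff)

lemma lookup_eq_strand: "lookup (f \<sigma>) m = strand u r f (m + elcm u r \<sigma>) \<sigma>"
  by (simp add: strand_def)

lemma strand_inject:
  assumes "\<And>a. strand u r f a = strand u r g a"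
  shows "f = g"
proof
  fix \<sigma>
  show "f \<sigma> = g \<sigma>"
    by (rule poly_mapping_eqI) (simp add: lookup_eq_strand[of _ _ _ u r] assms)
qed

lemma strand_zero [simp]: "strand u r 0 a = 0"
  by (simp add: strand_def fun_eq_iff)

text \<open>In a fixed multidegree each entry is a scalar times a forced monomial, and the quotients
  of least common multiples turn one forced monomial into the next; the simplicial boundary is what
  remains. If \<open>elcm u r \<tau>\<close> does not divide a, neither does the lcm of a larger
  set.\<close>

lemma strand_tdiff: "strand u r (tdiff u r f) a = bd r (strand u r f a)"
proof
  fix \<tau>
  have *: "edvd (elcm u r \<tau>) (elcm u r (insert s \<tau>))" for s
    by (rule edvd_elcm_mono) auto
  show "strand u r (tdiff u r f) a \<tau> = bd r (strand u r f a) \<tau>"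
  proof (cases "edvd (elcm u r \<tau>) a")
    case True
    have eq: "edvd (elcm u r (insert s \<tau>) - elcm u r \<tau>) (a - elcm u r \<tau>) \<longleftrightarrow> edvd (elcm u r (insert s \<tau>)) a" for s
      using * True unfolding edvd_def lookup_minus
      by (metis (no_types) diff_le_mono le_diff_iff)
    have "a - elcm u r \<tau> - (elcm u r (insert s \<tau>) - elcm u r \<tau>) = a - elcm u r (insert s \<tau>)"
      if "edvd (elcm u r (insert s \<tau>)) a" for s
      using edvd_minus_minus[OF *[of s] that] .
    with True show ?thesis
      by (auto simp: strand_def tdiff_def bd_def lookup_sum lookup_single_mult eq intro!: sum.cong)
  next
    case False
    then have "\<not> edvd (elcm u r (insert s \<tau>)) a" for s
      using * edvd_trans by blast
    with False show ?thesis by (simp add: strand_def bd_def)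
  qed
qed

lemma tdiff_tdiff: "tdiff u r (tdiff u r f) = 0"
  by (rule strand_inject[of u r]) (simp add: strand_tdiff bd_bd)

text \<open>The cone point has to be the same for all faces in one multidegree, so it is chosen from
  the multidegree alone.\<close>

definition first_divisor :: "(nat \<Rightarrow> 'x expo) \<Rightarrow> nat \<Rightarrow> 'x expo \<Rightarrow> nat"
  where "first_divisor u r a = (LEAST s. s < r \<and> edvd (u s) a)"

lemma first_divisor:
  assumes "\<exists>s<r. edvd (u s) a"
  shows "first_divisor u r a < r" "edvd (u (first_divisor u r a)) a"
  using LeastI_ex[of "\<lambda>s. s < r \<and> edvd (u s) a"] assms by (auto simp: first_divisor_def)

text \<open>In multidegree \<open>a\<close> the Taylor complex is the chain complex of the full simplex on the generators dividing
  \<open>a\<close>; it is contracted by coning with the first of them.\<close>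

definition thom :: "(nat \<Rightarrow> 'x expo) \<Rightarrow> nat \<Rightarrow> (nat set \<Rightarrow> ('x, 'k::field) mpoly) \<Rightarrow> nat set \<Rightarrow> ('x, 'k) mpoly"
  where "thom u r f \<sigma> = Abs_poly_mapping (\<lambda>m.
    let a = m + elcm u r \<sigma>; s = first_divisor u r a
    in if (\<exists>s<r. edvd (u s) a) \<and> s \<in> \<sigma>
       then ksign s (\<sigma> - {s}) * lookup (f (\<sigma> - {s})) (a - elcm u r (\<sigma> - {s})) else 0)"

text \<open>Finiteness of the support is the point: for each of the finitely many possible cone
  points s, translation by a fixed exponent is injective, so the support of
  \<open>f (\<sigma> - {s})\<close> has a finite preimage.\<close>

lemma lookup_thom:
  "lookup (thom u r f \<sigma>) m =
    (let a = m + elcm u r \<sigma>; s = first_divisor u r a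
    in if (\<exists>s<r. edvd (u s) a) \<and> s \<in> \<sigma>
       then ksign s (\<sigma> - {s}) * lookup (f (\<sigma> - {s})) (a - elcm u r (\<sigma> - {s})) else 0)"
  (is "_ = ?F m")
proof -
  let ?g = "\<lambda>s m. m + (elcm u r \<sigma> - elcm u r (\<sigma> - {s}))"
  have "{m. ?F m \<noteq> 0} \<subseteq> (\<Union>s<r. ?g s -` keys (f (\<sigma> - {s})))"
  proof
    fix m assume m: "m \<in> {m. ?F m \<noteq> 0}"
    define s where "s = first_divisor u r (m + elcm u r \<sigma>)"
    have "m + elcm u r \<sigma> - elcm u r (\<sigma> - {s}) = ?g s m"
      using edvd_elcm_mono[of "\<sigma> - {s}" \<sigma> u r]
      by (intro poly_mapping_eqI) (simp add: lookup_add lookup_minus edvd_def)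
    with m have "?g s m \<in> keys (f (\<sigma> - {s}))" "\<exists>s<r. edvd (u s) (m + elcm u r \<sigma>)"
      by (auto simp: Let_def s_def in_keys_iff split: if_splits)
    moreover from this(2) have "s < r" unfolding s_def by (rule first_divisor)
    ultimately show "m \<in> (\<Union>s<r. ?g s -` keys (f (\<sigma> - {s})))" by auto
  qed
  moreover have "finite (\<Union>s<r. ?g s -` keys (f (\<sigma> - {s})))"
    by (intro finite_UN_I finite_vimageI) (auto simp: inj_on_def)
  ultimately have "finite {m. ?F m \<noteq> 0}" by (rule finite_subset)
  then show ?thesis unfolding thom_def by (simp add: lookup_Abs_poly_mapping)
qed

lemma strand_thom:
  "strand u r (thom u r f) a =
    (if \<exists>s<r. edvd (u s) a then cone (first_divisor u r a) (strand u r f a) else 0)"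
proof
  fix \<sigma>
  define s where "s = first_divisor u r a"
  show "strand u r (thom u r f) a \<sigma> =
    (if \<exists>s<r. edvd (u s) a then cone (first_divisor u r a) (strand u r f a) else 0) \<sigma>"
  proof (cases "edvd (elcm u r \<sigma>) a")
    case True
    have "edvd (elcm u r (\<sigma> - {s})) a"
      using True edvd_elcm_mono[of "\<sigma> - {s}" \<sigma>] edvd_trans by blast
    with True show ?thesis
      by (auto simp: strand_def lookup_thom edvd_minus_add cone_def Let_def simp flip: s_def)
  next
    case False
    \<comment> \<open>The cone point divides a, so removing it from \<sigma> cannot make the lcm
      divide a.\<close>
    have "\<not> edvd (elcm u r (\<sigma> - {s})) a" if "\<exists>s<r. edvd (u s) a"
      using first_divisor[OF that] False by (auto simp: edvd_elcm_iff s_def)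
    with False show ?thesis
      by (auto simp: strand_def cone_def simp flip: s_def)
  qed
qed

text \<open>Where no generator divides a, the only face is the empty one and there is nothing to
  cone with; the second premise excludes chains living there. Elsewhere this is
  \<open>bd_cone\<close> applied to a cycle.\<close>

lemma tdiff_thom:
  assumes "tdiff u r f = 0" and "\<And>a. \<not> (\<exists>s<r. edvd (u s) a) \<Longrightarrow> strand u r f a = 0"
  shows "tdiff u r (thom u r f) = f"
proof (rule strand_inject[of u r])
  fix a
  show "strand u r (tdiff u r (thom u r f)) a = strand u r f a"
  proof (cases "\<exists>s<r. edvd (u s) a")
    case True
    have "bd r (strand u r f a) = 0"
      using strand_tdiff[of u r f a] assms(1) by simp
    then show ?thesis
      using bd_cone[OF first_divisor(1)[OF True], of "strand u r f a"] True
      by (simp add: strand_tdiff strand_thom)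
  next
    case False
    then show ?thesis unfolding strand_tdiff strand_thom assms(2)[OF False] by simp
  qed
qed

section \<open>Balancing a double complex\<close>

text \<open>Rows and columns are exact except at index 0, and the squares commute rather than
  anticommute. The maps are additive on a whole type, which lets \<open>C\<close> be cut out by
  support and degree conditions.\<close>

locale double_complex =
  fixes C :: "nat \<Rightarrow> nat \<Rightarrow> 'a::ab_group_add set" and dh dv :: "nat \<Rightarrow> 'a \<Rightarrow> 'a"
  assumes diff_closed: "x \<in> C i p \<Longrightarrow> y \<in> C i p \<Longrightarrow> x - y \<in> C i p"
    and dh_diff: "dh i (x - y) = dh i x - dh i y"
    and dv_diff: "dv p (x - y) = dv p x - dv p y"
    and dh_closed: "x \<in> C (Suc i) p \<Longrightarrow> dh i x \<in> C i p"
    and dv_closed: "x \<in> C i (Suc p) \<Longrightarrow> dv p x \<in> C i p"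
    and commute: "x \<in> C (Suc i) (Suc p) \<Longrightarrow> dh i (dv p x) = dv p (dh i x)"
    and dh_dh: "x \<in> C (Suc (Suc i)) p \<Longrightarrow> dh i (dh (Suc i) x) = 0"
    and dv_dv: "x \<in> C i (Suc (Suc p)) \<Longrightarrow> dv p (dv (Suc p) x) = 0"
    and dh_exact: "x \<in> C (Suc i) p \<Longrightarrow> dh i x = 0 \<Longrightarrow> \<exists>y \<in> C (Suc (Suc i)) p. dh (Suc i) y = x"
    and dv_exact: "x \<in> C i (Suc p) \<Longrightarrow> dv p x = 0 \<Longrightarrow> \<exists>y \<in> C i (Suc (Suc p)). dv (Suc p) y = x"
begin

text \<open>Exactness at \<open>Suc p\<close> of the vertical complex formed by the cokernels of
  \<open>dh i\<close>. The case i = 0 is the edge of interest; i > 0 serves as a stepping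
  stone.\<close>

definition v_exact_mod_h :: "nat \<Rightarrow> nat \<Rightarrow> bool"
  where "v_exact_mod_h i p \<longleftrightarrow> (\<forall>x \<in> C i (Suc p). dv p x \<in> dh i ` C (Suc i) p \<longrightarrow>
    (\<exists>y \<in> C (Suc i) (Suc p). \<exists>z \<in> C i (Suc (Suc p)). x = dh i y + dv (Suc p) z))"

definition h_exact_mod_v :: "nat \<Rightarrow> nat \<Rightarrow> bool"
  where "h_exact_mod_v i p \<longleftrightarrow> (\<forall>x \<in> C (Suc i) p. dh i x \<in> dv p ` C i (Suc p) \<longrightarrow>
    (\<exists>y \<in> C (Suc (Suc i)) p. \<exists>z \<in> C (Suc i) (Suc p). x = dh (Suc i) y + dv p z))"

text \<open>The two properties alternate along an antidiagonal, from one edge of the double complex to the other.\<close>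

lemma h_imp_v:
  assumes "h_exact_mod_v i p"
  shows "v_exact_mod_h i p"
  unfolding v_exact_mod_h_def
proof (intro ballI impI)
  fix x assume x: "x \<in> C i (Suc p)" and "dv p x \<in> dh i ` C (Suc i) p"
  then obtain z where z: "z \<in> C (Suc i) p" "dv p x = dh i z" by blast
  then have "dh i z \<in> dv p ` C i (Suc p)" using x by (metis imageI)
  then obtain w y where w: "w \<in> C (Suc (Suc i)) p" and y: "y \<in> C (Suc i) (Suc p)"
    and zwy: "z = dh (Suc i) w + dv p y"
    using assms z(1) unfolding h_exact_mod_v_def by blast
  have "dh i (z - dv p y) = 0" using dh_dh[OF w] zwy by simp
  then have "dv p x = dh i (dv p y)" using z(2) by (simp add: dh_diff)
  then have "dv p (x - dh i y) = 0" using commute[OF y] by (simp add: dv_diff)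
  then obtain z' where "z' \<in> C i (Suc (Suc p))" "dv (Suc p) z' = x - dh i y"
    using dv_exact[OF diff_closed[OF x dh_closed[OF y]]] by blast
  then show "\<exists>y \<in> C (Suc i) (Suc p). \<exists>z \<in> C i (Suc (Suc p)). x = dh i y + dv (Suc p) z"
    using y by (intro bexI[of _ y] bexI[of _ z']) auto
qed

text \<open>If \<open>dh i x\<close> is a vertical boundary, then \<open>dv p x\<close> is a
  horizontal cycle by commutation, and exactness of the row makes it a horizontal boundary.\<close>

lemma v_imp_h:
  assumes "v_exact_mod_h (Suc i) p"
  shows "h_exact_mod_v i (Suc p)"
  unfolding h_exact_mod_v_def
proof (intro ballI impI)
  fix x assume x: "x \<in> C (Suc i) (Suc p)" and "dh i x \<in> dv (Suc p) ` C i (Suc (Suc p))"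
  then obtain z where z: "z \<in> C i (Suc (Suc p))" "dh i x = dv (Suc p) z" by blast
  have "dh i (dv p x) = 0" using commute[OF x] z dv_dv[OF z(1)] by simp
  then have "dv p x \<in> dh (Suc i) ` C (Suc (Suc i)) p"
    using dh_exact[OF dv_closed[OF x]] by (metis imageI)
  then show "\<exists>y \<in> C (Suc (Suc i)) (Suc p). \<exists>z \<in> C (Suc i) (Suc (Suc p)).
      x = dh (Suc i) y + dv (Suc p) z"
    using assms x unfolding v_exact_mod_h_def by blast
qed

lemma h_imp_v_corner: "h_exact_mod_v i p \<Longrightarrow> v_exact_mod_h 0 (p + i)"
proof (induction i arbitrary: p)
  case 0
  then show ?case by (simp add: h_imp_v)
next
  case (Suc i)
  then have "h_exact_mod_v i (Suc p)" by (intro v_imp_h h_imp_v)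
  then show ?case using Suc.IH by fastforce
qed

end

lemma double_complex_swap:
  assumes "double_complex C dh dv"
  shows "double_complex (\<lambda>i p. C p i) dv dh"
proof -
  interpret double_complex C dh dv by fact
  show ?thesis
    by (rule double_complex.intro)
      (erule (1) diff_closed | rule dh_diff dv_diff | erule dh_closed dv_closed commute[symmetric] dh_dh dv_dv
        | erule (1) dh_exact dv_exact)+
qed

text \<open>The axioms are symmetric in the two directions, so the walk along the antidiagonal is
  carried out once and transposed. Only vanishing is compared, which is all that linearity asks
  for.\<close>

lemma (in double_complex) balance: "v_exact_mod_h 0 n \<longleftrightarrow> h_exact_mod_v n 0"
proof
  interpret swap: double_complex "\<lambda>i p. C p i" dv dh
    using double_complex_axioms by (rule double_complex_swap)
  have eq: "swap.h_exact_mod_v i p = v_exact_mod_h p i" "swap.v_exact_mod_h i p = h_exact_mod_v p i" for i p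
    unfolding swap.h_exact_mod_v_def v_exact_mod_h_def swap.v_exact_mod_h_def h_exact_mod_v_def
    by (simp_all add: add.commute) blast+
  show "v_exact_mod_h 0 n \<Longrightarrow> h_exact_mod_v n 0"
    using swap.h_imp_v_corner[of n 0] by (simp add: eq)
  show "h_exact_mod_v n 0 \<Longrightarrow> v_exact_mod_h 0 n"
    using h_imp_v_corner[of n 0] by simp
qed

section \<open>Linear extensions and supports in free modules\<close>

lemma lookup_scale [simp]:
  "lookup (Poly_Mapping.map ((*) (p::'c::comm_ring_1)) v) b = p * lookup v b"
  by (simp add: Poly_Mapping.map.rep_eq when_def)

lemma lookup_lin_ext:
  assumes "finite A" "keys v \<subseteq> A"
  shows "lookup (lin_ext D v) c = (\<Sum>b\<in>A. lookup v b * lookup (D b) c)"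
  unfolding lin_ext_def lookup_sum lookup_scale
  using assms by (intro sum.mono_neutral_left) (auto simp: in_keys_iff)

lemma lin_ext_add: "lin_ext D (v + w) = lin_ext D v + lin_ext D w"
proof (rule poly_mapping_eqI)
  fix c
  let ?A = "keys v \<union> keys w"
  have "keys (v + w) \<subseteq> ?A" by (rule Poly_Mapping.keys_add)
  then show "lookup (lin_ext D (v + w)) c = lookup (lin_ext D v + lin_ext D w) c"
    by (simp add: lookup_lin_ext[where A = ?A] lookup_add distrib_right sum.distrib)
qed

lemma lin_ext_zero [simp]: "lin_ext D 0 = 0"
  by (simp add: lin_ext_def)

lemma lin_ext_diff: "lin_ext D (v - w) = lin_ext D v - lin_ext D w"
  using lin_ext_add[of D "v - w" w] by (simp add: eq_diff_eq)

lemma lin_ext_scale: "lin_ext D (Poly_Mapping.map ((*) p) v) = Poly_Mapping.map ((*) p) (lin_ext D v)"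
proof (rule poly_mapping_eqI)
  fix c
  have "keys (Poly_Mapping.map ((*) p) v) \<subseteq> keys v"
    by (auto simp: in_keys_iff)
  then show "lookup (lin_ext D (Poly_Mapping.map ((*) p) v)) c =
      lookup (Poly_Mapping.map ((*) p) (lin_ext D v)) c"
    by (simp add: lookup_lin_ext[where A = "keys v"] sum_distrib_left mult.assoc)
qed

lemma lin_ext_sum: "lin_ext D (sum g S) = (\<Sum>s\<in>S. lin_ext D (g s))"
  by (induction S rule: infinite_finite_induct) (simp_all add: lin_ext_add)

text \<open>Conditions on single terms (basis element and monomial) describe free modules, their
  graded components and the complements of these at once, so homogeneous decomposition becomes
  splitting a predicate.\<close>

definition fsup :: "('b \<Rightarrow> 'x expo \<Rightarrow> bool) \<Rightarrow> ('b \<Rightarrow>\<^sub>0 ('x, 'k::field) mpoly) set"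
  where "fsup P = {v. \<forall>b m. lookup (lookup v b) m \<noteq> 0 \<longrightarrow> P b m}"

lemma poly_mapping_neq_0_iff: "p \<noteq> 0 \<longleftrightarrow> (\<exists>m. lookup p m \<noteq> 0)"
  by (simp add: poly_mapping_eq_iff fun_eq_iff)

lemma fsup_disjoint:
  assumes "v \<in> fsup P" "v \<in> fsup Q" "\<And>b m. P b m \<Longrightarrow> \<not> Q b m"
  shows "v = 0"
proof (intro poly_mapping_eqI)
  fix b m
  show "lookup (lookup v b) m = lookup (lookup 0 b) m"
    using assms(1,2) assms(3)[of b m] by (auto simp: fsup_def)
qed

lemma fsup_zero [simp]: "0 \<in> fsup P"
  by (simp add: fsup_def)

lemma fsup_diff:
  assumes "v \<in> fsup P" "w \<in> fsup P"
  shows "v - w \<in> fsup P"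
  unfolding fsup_def
proof (intro CollectI allI impI)
  fix b m assume "lookup (lookup (v - w) b) m \<noteq> 0"
  then have "lookup (lookup v b) m \<noteq> 0 \<or>
      lookup (lookup w b) m \<noteq> 0"
    by (auto simp: lookup_minus)
  then show "P b m" using assms by (auto simp: fsup_def)
qed

lemma fsup_mono: "v \<in> fsup P \<Longrightarrow> (\<And>b m. P b m \<Longrightarrow> Q b m) \<Longrightarrow> v \<in> fsup Q"
  by (auto simp: fsup_def)

lemma fsup_split:
  fixes v :: "'b \<Rightarrow>\<^sub>0 ('x, 'k::field) mpoly"
  assumes "v \<in> fsup P"
  obtains v1 v2 where "v = v1 + v2" "v1 \<in> fsup (\<lambda>b m. P b m \<and> Q b m)" "v2 \<in> fsup (\<lambda>b m. P b m \<and> \<not> Q b m)"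
proof -
  define g where "g = (\<lambda>b. Abs_poly_mapping (\<lambda>m. lookup (lookup v b) m when Q b m))"
  have g: "lookup (g b) m = (lookup (lookup v b) m when Q b m)" for b m
    unfolding g_def
    by (subst lookup_Abs_poly_mapping)
      (auto intro: finite_subset[of _ "keys (lookup v b)"] simp: in_keys_iff when_def)
  define v1 where "v1 = Abs_poly_mapping g"
  have "{b. g b \<noteq> 0} \<subseteq> keys v"
    by (auto simp: in_keys_iff poly_mapping_neq_0_iff g)
  then have v1: "lookup v1 b = g b" for b
    unfolding v1_def by (subst lookup_Abs_poly_mapping) (auto intro: finite_subset)
  have "v1 \<in> fsup (\<lambda>b m. P b m \<and> Q b m)" "v - v1 \<in> fsup (\<lambda>b m. P b m \<and> \<not> Q b m)"
    using assms by (auto simp: fsup_def v1 g lookup_minus when_def split: if_splits)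
  then show ?thesis using that[of v1 "v - v1"] by simp
qed

lemma fsup_lin_ext:
  assumes "v \<in> fsup P"
    and "\<And>b m c m'. P b m \<Longrightarrow> lookup (lookup (D b) c) m' \<noteq> 0 \<Longrightarrow> R c (m + m')"
  shows "lin_ext D v \<in> fsup R"
  unfolding fsup_def
proof (intro CollectI allI impI)
  fix c m assume "lookup (lookup (lin_ext D v) c) m \<noteq> 0"
  then have "(\<Sum>b\<in>keys v.
      lookup (lookup v b * lookup (D b) c) m) \<noteq> 0"
    by (simp add: lookup_lin_ext[OF finite_keys order_refl] lookup_sum)
  then obtain b where "lookup (lookup v b * lookup (D b) c) m \<noteq> 0"
    by (rule sum.not_neutral_contains_not_neutral)
  then have "m \<in> keys (lookup v b * lookup (D b) c)"
    by (simp add: in_keys_iff)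
  then obtain m1 m2 where "m = m1 + m2" "m1 \<in> keys (lookup v b)"
    "m2 \<in> keys (lookup (D b) c)"
    using keys_mult by blast
  moreover from this have "P b m1" using assms(1) by (simp add: fsup_def in_keys_iff)
  ultimately show "R c m" using assms(2)[of b m1 c m2] by (simp add: in_keys_iff)
qed

lemma free_module_fsup: "free_module V B = fsup (\<lambda>b m. b \<in> B \<and> keys m \<subseteq> V)"
proof -
  have "(keys v \<subseteq> B \<and> (\<forall>b. lookup v b \<in> carrier (poly_ring V))) \<longleftrightarrow>
     (\<forall>b m. lookup (lookup v b) m \<noteq> 0 \<longrightarrow> b \<in> B \<and> keys m \<subseteq> V)"
    for v :: "nat \<Rightarrow>\<^sub>0 ('a, 'b) mpoly"
  proof -
    have "keys v \<subseteq> B \<longleftrightarrow> (\<forall>b m. lookup (lookup v b) m \<noteq> 0 \<longrightarrow> b \<in> B)"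
      unfolding subset_iff in_keys_iff poly_mapping_neq_0_iff[of "lookup v _"] by fast
    then show ?thesis by (simp add: poly_ring_def Ball_def in_keys_iff[of _ "lookup v _"]) metis
  qed
  then show ?thesis unfolding free_module_def fsup_def by simp
qed

lemma free_module_component_fsup:
  "free_module_component V B dg j = fsup (\<lambda>b m. b \<in> B \<and> keys m \<subseteq> V \<and> mdeg m + dg b = j)"
  unfolding free_module_component_def free_module_fsup
  by (rule Set.set_eqI) (simp add: fsup_def Ball_def in_keys_iff[of _ "lookup _ _"], metis)

section \<open>Monomial ideals as sets of exponents\<close>

definition upset :: "'x set \<Rightarrow> 'x expo set \<Rightarrow> bool"
  where "upset V M \<longleftrightarrow> (\<forall>m\<in>M. keys m \<subseteq> V) \<and>
    (\<forall>m\<in>M. \<forall>c. keys c \<subseteq> V \<longrightarrow> m + c \<in> M)"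

definition mideal :: "'x expo set \<Rightarrow> ('x, 'k::field) mpoly set"
  where "mideal M = {p. keys p \<subseteq> M}"

lemma mideal_add: "p \<in> mideal M \<Longrightarrow> q \<in> mideal M \<Longrightarrow> p + q \<in> mideal M"
  unfolding mideal_def using Poly_Mapping.keys_add[of p q] by blast

lemma mideal_diff: "p \<in> mideal M \<Longrightarrow> q \<in> mideal M \<Longrightarrow> p - q \<in> mideal M"
  unfolding mideal_def using keys_diff[of p q] by blast

lemma mideal_zero [simp]: "0 \<in> mideal M"
  by (simp add: mideal_def)

lemma mideal_sum: "(\<And>s. s \<in> S \<Longrightarrow> g s \<in> mideal M) \<Longrightarrow> sum g S \<in> mideal M"
  by (induction S rule: infinite_finite_induct) (simp_all add: mideal_add)

lemma mideal_mult:
  assumes "upset V M" "p \<in> mideal M" "\<And>m. m \<in> keys q \<Longrightarrow> keys m \<subseteq> V"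
  shows "q * p \<in> mideal M"
  unfolding mideal_def
proof (intro CollectI subsetI)
  fix m assume "m \<in> keys (q * p)"
  then obtain a b where "m = a + b" "a \<in> keys q" "b \<in> keys p"
    using keys_mult[of q p] by blast
  moreover from this have "b \<in> M" "keys a \<subseteq> V" using assms(2,3) by (auto simp: mideal_def)
  ultimately show "m \<in> M" using assms(1) unfolding upset_def by (metis add.commute)
qed

text \<open>As a linear extension into a free module of rank one with basis element 0, the
  augmentation inherits additivity and scaling from \<open>lin_ext\<close>.\<close>

lemma augmentation_lin_ext:
  "augmentation F v = lookup (lin_ext (\<lambda>b. single 0 (res_aug F b)) v) 0"
  by (simp add: augmentation_def lookup_lin_ext[OF finite_keys order_refl])

lemma augmentation_add: "augmentation F (v + w) = augmentation F v + augmentation F w"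
  by (simp add: augmentation_lin_ext lin_ext_add lookup_add)

lemma augmentation_diff: "augmentation F (v - w) = augmentation F v - augmentation F w"
  by (simp add: augmentation_lin_ext lin_ext_diff lookup_minus)

lemma augmentation_zero [simp]: "augmentation F 0 = 0"
  by (simp add: augmentation_lin_ext)

lemma augmentation_scale: "augmentation F (Poly_Mapping.map ((*) p) v) = p * augmentation F v"
  by (simp add: augmentation_lin_ext lin_ext_scale)

lemma augmentation_sum: "augmentation F (sum g S) = (\<Sum>s\<in>S. augmentation F (g s))"
  by (simp add: augmentation_lin_ext lin_ext_sum lookup_sum)

section \<open>Graded components of an arbitrary resolution\<close>

locale monomial_resolution =
  fixes V :: "'x set" and M :: "'x expo set" and F :: "('x, 'k::field) resolution"
  assumes finite_V: "finite V"
    and upset: "upset V M"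
    and resolution: "graded_free_resolution V (mideal M) F"
begin

abbreviation "gcomp i j \<equiv> free_module_component V (res_basis F i) (res_degree F i) j"

lemma res_diff_coeff:
  assumes "b \<in> res_basis F (Suc i)" "lookup (lookup (res_diff F (Suc i) b) c) m \<noteq> 0"
  shows "c \<in> res_basis F i" "keys m \<subseteq> V" "mdeg m + res_degree F i c = res_degree F (Suc i) b"
proof -
  have "res_diff F (Suc i) b \<in> gcomp i (res_degree F (Suc i) b)"
    using resolution[unfolded graded_free_resolution_def, THEN conjunct2, THEN conjunct1] assms(1) by simp
  then have "c \<in> res_basis F i \<and> keys m \<subseteq> V \<and> mdeg m + res_degree F i c = res_degree F (Suc i) b"
    using assms(2) unfolding free_module_component_fsup fsup_def by simp
  then show "c \<in> res_basis F i" "keys m \<subseteq> V" "mdeg m + res_degree F i c = res_degree F (Suc i) b"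
    by simp_all
qed

lemma res_aug_coeff:
  assumes "b \<in> res_basis F 0" "lookup (res_aug F b) m \<noteq> 0"
  shows "keys m \<subseteq> V" "mdeg m = res_degree F 0 b"
proof -
  have "res_aug F b \<in> carrier (poly_ring V) \<and>
      (\<forall>m \<in> keys (res_aug F b). mdeg m = res_degree F 0 b)"
    using resolution[unfolded graded_free_resolution_def, THEN conjunct1] assms(1) by simp
  then show "keys m \<subseteq> V" "mdeg m = res_degree F 0 b"
    using assms(2) unfolding poly_ring_def by (simp_all add: in_keys_iff[of m])
qed

text \<open>The degree condition is an arbitrary predicate because it is needed for degree j as well
  as for all degrees other than j.\<close>

lemma lin_ext_res_diff:
  assumes "v \<in> fsup (\<lambda>b m. b \<in> res_basis F (Suc i) \<and> keys m \<subseteq> V \<and> P (mdeg m + res_degree F (Suc i) b))"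
  shows "lin_ext (res_diff F (Suc i)) v \<in>
    fsup (\<lambda>b m. b \<in> res_basis F i \<and> keys m \<subseteq> V \<and> P (mdeg m + res_degree F i b))"
proof (rule fsup_lin_ext[OF assms])
  fix b m c m'
  assume "b \<in> res_basis F (Suc i) \<and> keys m \<subseteq> V \<and> P (mdeg m + res_degree F (Suc i) b)"
    and "lookup (lookup (res_diff F (Suc i) b) c) m' \<noteq> 0"
  then show "c \<in> res_basis F i \<and> keys (m + m') \<subseteq> V \<and> P (mdeg (m + m') + res_degree F i c)"
    using res_diff_coeff[of b i c m'] by (simp add: keys_add_exp add.assoc)
qed

lemma lin_ext_res_diff_comp: "v \<in> gcomp (Suc i) j \<Longrightarrow> lin_ext (res_diff F (Suc i)) v \<in> gcomp i j"
  unfolding free_module_component_fsup by (rule lin_ext_res_diff)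

lemma augmentation_coeff:
  assumes "v \<in> fsup (\<lambda>b m. b \<in> res_basis F 0 \<and> keys m \<subseteq> V \<and> P (mdeg m + res_degree F 0 b))"
    and "lookup (augmentation F v) m \<noteq> 0"
  shows "keys m \<subseteq> V \<and> P (mdeg m)"
proof -
  have "lin_ext (\<lambda>b. single 0 (res_aug F b)) v \<in>
      fsup (\<lambda>(b::nat) m. keys m \<subseteq> V \<and> P (mdeg m))"
  proof (rule fsup_lin_ext[OF assms(1)])
    fix b m and c :: nat and m'
    assume "b \<in> res_basis F 0 \<and> keys m \<subseteq> V \<and> P (mdeg m + res_degree F 0 b)"
      and "lookup (lookup (single 0 (res_aug F b)) c) m' \<noteq> 0"
    then show "keys (m + m') \<subseteq> V \<and> P (mdeg (m + m'))"
      using res_aug_coeff[of b m'] by (simp add: keys_add_exp lookup_single when_def split: if_splits)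
  qed
  then show ?thesis using assms(2) unfolding fsup_def augmentation_lin_ext by blast
qed

text \<open>Exactness is given for the ungraded modules only. Of a preimage keep the terms of degree
  j: the image of the others has no term of degree j, yet it is a difference of vectors of degree j,
  so it vanishes.\<close>

lemma component_preimage:
  assumes "v \<in> gcomp i j" "v \<in> lin_ext (res_diff F (Suc i)) ` free_module V (res_basis F (Suc i))"
  shows "\<exists>w \<in> gcomp (Suc i) j. lin_ext (res_diff F (Suc i)) w = v"
proof -
  let ?D = "lin_ext (res_diff F (Suc i))"
  obtain w where w: "w \<in> free_module V (res_basis F (Suc i))" "?D w = v" using assms(2) by blast
  obtain w1 w2 where s: "w = w1 + w2"
      "w1 \<in> fsup (\<lambda>b m. (b \<in> res_basis F (Suc i) \<and> keys m \<subseteq> V) \<and> mdeg m + res_degree F (Suc i) b = j)"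
      "w2 \<in> fsup (\<lambda>b m. (b \<in> res_basis F (Suc i) \<and> keys m \<subseteq> V) \<and> \<not> (mdeg m + res_degree F (Suc i) b = j))"
    using fsup_split[OF w(1)[unfolded free_module_fsup]] .
  have w1: "w1 \<in> gcomp (Suc i) j"
    using s(2) unfolding free_module_component_fsup by (rule fsup_mono) auto
  have "?D w2 \<in> fsup (\<lambda>b m. b \<in> res_basis F i \<and> keys m \<subseteq> V \<and> mdeg m + res_degree F i b \<noteq> j)"
    using lin_ext_res_diff[of w2 i "\<lambda>d. d \<noteq> j"] s(3) by (simp add: conj_assoc)
  moreover have "?D w2 \<in> gcomp i j"
  proof -
    have "?D w2 = v - ?D w1" unfolding w(2)[symmetric] s(1) by (simp add: lin_ext_add)
    then show ?thesis
      using assms(1) lin_ext_res_diff_comp[OF w1] by (simp add: free_module_component_fsup fsup_diff)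
  qed
  ultimately have "?D w2 = 0"
    unfolding free_module_component_fsup by (rule fsup_disjoint) auto
  then show ?thesis using w1 w(2) s(1) by (auto simp: lin_ext_add)
qed

lemma comp_subset: "gcomp i j \<subseteq> free_module V (res_basis F i)"
  by (simp add: free_module_component_def)

lemma exact_component:
  assumes "v \<in> gcomp (Suc i) j" "lin_ext (res_diff F (Suc i)) v = 0"
  shows "\<exists>w \<in> gcomp (Suc (Suc i)) j. lin_ext (res_diff F (Suc (Suc i))) w = v"
proof (rule component_preimage[OF assms(1)])
  have "{v \<in> free_module V (res_basis F (Suc i)). lin_ext (res_diff F (Suc i)) v = 0} =
      lin_ext (res_diff F (Suc (Suc i))) ` free_module V (res_basis F (Suc (Suc i)))"
    using resolution[unfolded graded_free_resolution_def, THEN conjunct2, THEN conjunct2, THEN conjunct2, THEN conjunct2,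
        THEN spec, of "Suc i"] by blast
  then show "v \<in> lin_ext (res_diff F (Suc (Suc i))) ` free_module V (res_basis F (Suc (Suc i)))"
    using assms comp_subset by blast
qed

lemma res_diff_res_diff:
  assumes "v \<in> gcomp (Suc (Suc i)) j"
  shows "lin_ext (res_diff F (Suc i)) (lin_ext (res_diff F (Suc (Suc i))) v) = 0"
proof -
  have "{v \<in> free_module V (res_basis F (Suc i)). lin_ext (res_diff F (Suc i)) v = 0} =
      lin_ext (res_diff F (Suc (Suc i))) ` free_module V (res_basis F (Suc (Suc i)))"
    using resolution[unfolded graded_free_resolution_def, THEN conjunct2, THEN conjunct2, THEN conjunct2, THEN conjunct2,
        THEN spec, of "Suc i"] by blast
  then show ?thesis using assms comp_subset by blast
qed

lemma augmentation_kernel: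
  "{v \<in> free_module V (res_basis F 0). augmentation F v \<in> mideal M} =
      lin_ext (res_diff F 1) ` free_module V (res_basis F 1)"
  using resolution[unfolded graded_free_resolution_def, THEN conjunct2, THEN conjunct2, THEN conjunct2, THEN conjunct1] .

lemma exact_augmentation:
  assumes "v \<in> gcomp 0 j" "augmentation F v \<in> mideal M"
  shows "\<exists>w \<in> gcomp 1 j. lin_ext (res_diff F 1) w = v"
proof -
  have "v \<in> lin_ext (res_diff F 1) ` free_module V (res_basis F 1)"
    using augmentation_kernel assms comp_subset by blast
  then show ?thesis using component_preimage[OF assms(1)] by simp
qed

lemma augmentation_res_diff:
  assumes "v \<in> gcomp 1 j"
  shows "augmentation F (lin_ext (res_diff F 1) v) \<in> mideal M"
  using augmentation_kernel assms comp_subset by blast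

text \<open>Again only the degree j part of a preimage is kept. The defect stays in the ideal
  because membership in \<open>mideal M\<close> is tested monomial by monomial.\<close>

lemma augmentation_surj:
  assumes "\<And>m. m \<in> keys p \<Longrightarrow> keys m \<subseteq> V \<and> mdeg m = j"
  shows "\<exists>v \<in> gcomp 0 j. p - augmentation F v \<in> mideal M"
proof -
  have "p \<in> carrier (poly_ring V)" using assms by (auto simp: poly_ring_def)
  then obtain v where v: "v \<in> free_module V (res_basis F 0)" "p - augmentation F v \<in> mideal M"
    using resolution[unfolded graded_free_resolution_def, THEN conjunct2, THEN conjunct2, THEN conjunct1] by blast
  obtain v1 v2 where s: "v = v1 + v2"
      "v1 \<in> fsup (\<lambda>b m. (b \<in> res_basis F 0 \<and> keys m \<subseteq> V) \<and> mdeg m + res_degree F 0 b = j)"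
      "v2 \<in> fsup (\<lambda>b m. (b \<in> res_basis F 0 \<and> keys m \<subseteq> V) \<and> \<not> (mdeg m + res_degree F 0 b = j))"
    using fsup_split[OF v(1)[unfolded free_module_fsup]] .
  have v1: "v1 \<in> gcomp 0 j"
    using s(2) unfolding free_module_component_fsup by (rule fsup_mono) auto
  have "m \<in> M" if "m \<in> keys (p - augmentation F v1)" for m
  proof -
    have "lookup p m \<noteq> 0 \<or> lookup (augmentation F v1) m \<noteq> 0"
      using that by (auto simp: in_keys_iff lookup_minus)
    then have "mdeg m = j"
      using assms augmentation_coeff[of v1 "\<lambda>d. d = j" m] s(2) by (auto simp: in_keys_iff conj_assoc)
    then have "lookup (augmentation F v2) m = 0"
      using augmentation_coeff[of v2 "\<lambda>d. d \<noteq> j" m] s(3) by (auto simp: conj_assoc)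
    then have "m \<in> keys (p - augmentation F v)"
      using that s(1) by (simp add: augmentation_add in_keys_iff lookup_minus lookup_add)
    then show ?thesis using v(2) by (auto simp: mideal_def)
  qed
  then show ?thesis using v1 by (auto simp: mideal_def)
qed

end

section \<open>Koszul complexes with coefficients in a free resolution\<close>

text \<open>Tracing a nonzero coefficient back to one of \<open>f\<close> is how supports and
  degrees of chains are controlled.\<close>

lemma tdiff_coeff:
  assumes "lookup (tdiff u r f \<tau>) m \<noteq> 0"
  obtains s where "s < r" "s \<notin> \<tau>" "edvd (elcm u r (insert s \<tau>) - elcm u r \<tau>) m"
    "lookup (f (insert s \<tau>)) (m - (elcm u r (insert s \<tau>) - elcm u r \<tau>)) \<noteq> 0"
proof -
  have "(\<Sum>s\<in>{..<r} - \<tau>. lookup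
    (single (elcm u r (insert s \<tau>) - elcm u r \<tau>) (ksign s \<tau>) * f (insert s \<tau>)) m) \<noteq> 0"
    using assms by (simp add: tdiff_def lookup_sum)
  then obtain s where "s \<in> {..<r} - \<tau>" "lookup
    (single (elcm u r (insert s \<tau>) - elcm u r \<tau>) (ksign s \<tau>) * f (insert s \<tau>)) m \<noteq> 0"
    by (rule sum.not_neutral_contains_not_neutral)
  then show ?thesis using that[of s] by (auto simp: lookup_single_mult split: if_splits)
qed

lemma thom_coeff:
  assumes "lookup (thom u r f \<sigma>) m \<noteq> 0"
  obtains s where "s < r" "s \<in> \<sigma>"
    "lookup (f (\<sigma> - {s})) (m + elcm u r \<sigma> - elcm u r (\<sigma> - {s})) \<noteq> 0"
proof -
  define s where "s = first_divisor u r (m + elcm u r \<sigma>)"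
  have "\<exists>s<r. edvd (u s) (m + elcm u r \<sigma>)" "s \<in> \<sigma>"
    "lookup (f (\<sigma> - {s})) (m + elcm u r \<sigma> - elcm u r (\<sigma> - {s})) \<noteq> 0"
    using assms unfolding lookup_thom Let_def s_def by (auto split: if_splits)
  then show ?thesis using that[of s] first_divisor(1) unfolding s_def by blast
qed

text \<open>The variables as Taylor generators; \<open>klcm xs \<sigma>\<close> is then the
  squarefree monomial of \<sigma>.\<close>

definition ku :: "'x list \<Rightarrow> nat \<Rightarrow> 'x expo"
  where "ku xs s = single (xs ! s) 1"

abbreviation "klcm xs \<equiv> elcm (ku xs) (length xs)"
abbreviation "kdiff xs \<equiv> tdiff (ku xs) (length xs)"
abbreviation "kstrand xs \<equiv> strand (ku xs) (length xs)"

lemma lookup_klcm: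
  "lookup (klcm xs \<sigma>) x = (if \<exists>s\<in>\<sigma>. s < length xs \<and> xs ! s = x then 1 else 0)"
  unfolding lookup_elcm ku_def by (rule Max_eqI) (auto simp: lookup_single when_def)

lemma klcm_insert:
  assumes "distinct xs" "s < length xs" "s \<notin> \<tau>"
  shows "klcm xs (insert s \<tau>) = klcm xs \<tau> + single (xs ! s) 1"
proof (rule poly_mapping_eqI)
  fix x
  show "lookup (klcm xs (insert s \<tau>)) x =
      lookup (klcm xs \<tau> + single (xs ! s) 1) x"
    using assms by (auto simp: lookup_klcm lookup_add lookup_single when_def nth_eq_iff_index_eq)
qed

lemma mdeg_klcm:
  assumes "distinct xs" "\<sigma> \<subseteq> {..<length xs}"
  shows "mdeg (klcm xs \<sigma>) = card \<sigma>"
proof -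
  have "finite \<sigma>" using assms(2) finite_subset by blast
  then show ?thesis using assms(2)
    by (induction rule: finite_induct) (simp_all add: klcm_insert assms(1))
qed

lemma keys_klcm: "keys (klcm xs \<sigma>) \<subseteq> set xs"
  using keys_elcm[of "ku xs" "length xs" \<sigma>] by (fastforce simp: ku_def)

lemma edvd_ku_iff: "edvd (ku xs s) a \<longleftrightarrow> xs ! s \<in> keys a"
  by (auto simp: edvd_def ku_def lookup_single when_def in_keys_iff Suc_le_eq)

text \<open>Koszul chains with \<open>p\<close> exterior generators and total degree \<open>j\<close>, with coefficients in the free module on
  one basis element of degree \<open>e\<close>.\<close>

definition kchains :: "'x list \<Rightarrow> nat \<Rightarrow> nat \<Rightarrow> nat \<Rightarrow> (nat set \<Rightarrow> ('x, 'k::field) mpoly) set"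
  where "kchains xs j e p = {f. \<forall>\<sigma> m. lookup (f \<sigma>) m \<noteq> 0 \<longrightarrow>
    \<sigma> \<subseteq> {..<length xs} \<and> card \<sigma> = p \<and> keys m \<subseteq> set xs \<and> mdeg m + e + p = j}"

lemma kchainsD:
  assumes "f \<in> kchains xs j e p" "lookup (f \<sigma>) m \<noteq> 0"
  shows "\<sigma> \<subseteq> {..<length xs}" "card \<sigma> = p" "keys m \<subseteq> set xs" "mdeg m + e + p = j"
  using assms unfolding kchains_def by blast+

lemma kchainsI:
  assumes "\<And>\<sigma> m. lookup (f \<sigma>) m \<noteq> 0 \<Longrightarrow>
    \<sigma> \<subseteq> {..<length xs} \<and> card \<sigma> = p \<and> keys m \<subseteq> set xs \<and> mdeg m + e + p = j"
  shows "f \<in> kchains xs j e p"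
  using assms unfolding kchains_def by blast

lemma kchains_diff:
  assumes "f \<in> kchains xs j e p" "g \<in> kchains xs j e p"
  shows "f - g \<in> kchains xs j e p"
proof (rule kchainsI)
  fix \<sigma> m assume "lookup ((f - g) \<sigma>) m \<noteq> 0"
  then have "lookup (f \<sigma>) m \<noteq> 0 \<or> lookup (g \<sigma>) m \<noteq> 0"
    by (auto simp: lookup_minus)
  then show "\<sigma> \<subseteq> {..<length xs} \<and> card \<sigma> = p \<and> keys m \<subseteq> set xs \<and> mdeg m + e + p = j"
    using kchainsD[OF assms(1)] kchainsD[OF assms(2)] by metis
qed

lemma kchains_zero [simp]: "0 \<in> kchains xs j e p"
  by (simp add: kchains_def)

lemma kdiff_kchains:
  assumes "distinct xs" "f \<in> kchains xs j e (Suc p)"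
  shows "kdiff xs f \<in> kchains xs j e p"
proof (rule kchainsI)
  fix \<tau> m assume "lookup (kdiff xs f \<tau>) m \<noteq> 0"
  then obtain s where s: "s < length xs" "s \<notin> \<tau>" "edvd (klcm xs (insert s \<tau>) - klcm xs \<tau>) m"
    "lookup (f (insert s \<tau>)) (m - (klcm xs (insert s \<tau>) - klcm xs \<tau>)) \<noteq> 0"
    by (rule tdiff_coeff)
  have e: "klcm xs (insert s \<tau>) - klcm xs \<tau> = single (xs ! s) 1"
    using klcm_insert[OF assms(1) s(1,2)] by simp
  define m' where "m' = m - single (xs ! s) 1"
  have m: "m = m' + single (xs ! s) 1"
    using s(3) unfolding e m'_def by (simp add: edvd_minus_add)
  note k = kchainsD[OF assms(2) s(4)[unfolded e, folded m'_def]]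
  have "finite \<tau>" using k(1) finite_subset[of \<tau> "{..<length xs}"] by simp
  then have "card (insert s \<tau>) = Suc (card \<tau>)" using s(2) by simp
  then show "\<tau> \<subseteq> {..<length xs} \<and> card \<tau> = p \<and> keys m \<subseteq> set xs \<and> mdeg m + e + p = j"
    using k s(1) by (auto simp: m keys_add_exp)
qed

lemma thom_kchains:
  assumes "distinct xs" "f \<in> kchains xs j e p"
  shows "thom (ku xs) (length xs) f \<in> kchains xs j e (Suc p)"
proof (rule kchainsI)
  fix \<sigma> m assume "lookup (thom (ku xs) (length xs) f \<sigma>) m \<noteq> 0"
  then obtain s where s: "s < length xs" "s \<in> \<sigma>"
    "lookup (f (\<sigma> - {s})) (m + klcm xs \<sigma> - klcm xs (\<sigma> - {s})) \<noteq> 0"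
    by (rule thom_coeff)
  have "klcm xs \<sigma> = klcm xs (\<sigma> - {s}) + single (xs ! s) 1"
    using klcm_insert[OF assms(1) s(1), of "\<sigma> - {s}"] s(2) by (simp add: insert_absorb)
  then have "m + klcm xs \<sigma> - klcm xs (\<sigma> - {s}) = m + single (xs ! s) 1"
    by (intro poly_mapping_eqI) (simp add: lookup_add lookup_minus)
  note k = kchainsD[OF assms(2) s(3)[unfolded this]]
  have "finite \<sigma>" using k(1) finite_subset[of "\<sigma> - {s}" "{..<length xs}"] by simp
  then have "card \<sigma> = Suc p" using k(2) s(2) by (metis card_Suc_Diff1)
  then show "\<sigma> \<subseteq> {..<length xs} \<and> card \<sigma> = Suc p \<and> keys m \<subseteq> set xs \<and> mdeg m + e + Suc p = j"
    using k s(1) by (auto simp: keys_add_exp)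
qed

text \<open>The one multidegree divisible by no variable is 0, where the complex is K on the empty
  face. Hence the only obstruction is the constant term at p = 0.\<close>

lemma kdiff_thom:
  assumes "f \<in> kchains xs j e p" "kdiff xs f = 0"
    and "p = 0 \<Longrightarrow> lookup (f {}) 0 = 0"
  shows "kdiff xs (thom (ku xs) (length xs) f) = f"
proof (rule tdiff_thom[OF assms(2)])
  fix a assume a: "\<not> (\<exists>s<length xs. edvd (ku xs s) a)"
  show "kstrand xs f a = 0"
  proof (rule ccontr)
    assume "kstrand xs f a \<noteq> 0"
    then obtain \<sigma> where "kstrand xs f a \<sigma> \<noteq> 0" by (auto simp: fun_eq_iff)
    then have e: "edvd (klcm xs \<sigma>) a" and l: "lookup (f \<sigma>) (a - klcm xs \<sigma>) \<noteq> 0"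
      by (auto simp: strand_def split: if_splits)
    note k = kchainsD[OF assms(1) l]
    have "\<sigma> = {}" using e a k(1) unfolding edvd_elcm_iff by auto
    then have "p = 0" "lookup (f {}) a \<noteq> 0" using k(2) l by auto
    moreover have "keys a = {}"
      using a k(3) \<open>\<sigma> = {}\<close> unfolding edvd_ku_iff
      by (simp add: in_set_conv_nth subset_iff del: keys_eq_empty) blast
    ultimately show False using assms(3) by simp
  qed
qed

text \<open>The scalars act on whole vectors of a free module, so this is the Koszul differential in
  each coordinate and commutes with every linear extension.\<close>

definition mdiff ::
    "'x list \<Rightarrow> (nat set \<Rightarrow> nat \<Rightarrow>\<^sub>0 ('x, 'k::field) mpoly) \<Rightarrow> nat set \<Rightarrow> nat \<Rightarrow>\<^sub>0 ('x, 'k) mpoly"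
  where "mdiff xs f \<tau> = (\<Sum>s\<in>{..<length xs} - \<tau>. Poly_Mapping.map
    ((*) (single (klcm xs (insert s \<tau>) - klcm xs \<tau>) (ksign s \<tau>))) (f (insert s \<tau>)))"

definition mcoord :: "(nat set \<Rightarrow> nat \<Rightarrow>\<^sub>0 'c::zero) \<Rightarrow> nat \<Rightarrow> nat set \<Rightarrow> 'c"
  where "mcoord f b \<sigma> = lookup (f \<sigma>) b"

lemma mcoord_mdiff: "mcoord (mdiff xs f) b = kdiff xs (mcoord f b)"
  by (simp add: mcoord_def mdiff_def tdiff_def fun_eq_iff lookup_sum)

lemma mcoord_inject: "(\<And>b. mcoord f b = mcoord g b) \<Longrightarrow> f = g"
  by (intro ext poly_mapping_eqI) (simp add: mcoord_def fun_eq_iff)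

lemma mcoord_zero [simp]: "mcoord 0 b = 0"
  by (simp add: mcoord_def fun_eq_iff)

lemma mdiff_diff: "mdiff xs (f - g) = mdiff xs f - mdiff xs g"
  by (rule mcoord_inject, unfold mcoord_mdiff)
    (simp add: mcoord_def[abs_def] lookup_minus fun_eq_iff mdiff_def tdiff_def right_diff_distrib sum_subtractf lookup_sum)

lemma mdiff_mdiff: "mdiff xs (mdiff xs f) = 0"
  by (rule mcoord_inject) (simp add: mcoord_mdiff tdiff_tdiff)

lemma thom_zero [simp]: "thom u r 0 = 0"
  by (rule ext, rule poly_mapping_eqI) (simp add: lookup_thom Let_def)

definition mthom ::
    "'x list \<Rightarrow> (nat set \<Rightarrow> nat \<Rightarrow>\<^sub>0 ('x, 'k::field) mpoly) \<Rightarrow> nat set \<Rightarrow> nat \<Rightarrow>\<^sub>0 ('x, 'k) mpoly"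
  where "mthom xs f \<sigma> = Abs_poly_mapping (\<lambda>b. thom (ku xs) (length xs) (mcoord f b) \<sigma>)"

text \<open>The coordinatewise definition is sound because nonzero coordinates occur only among
  those of the finitely many vectors \<open>f (\<sigma> - {s})\<close>.\<close>

lemma mcoord_mthom: "mcoord (mthom xs f) b = thom (ku xs) (length xs) (mcoord f b)"
proof
  fix \<sigma>
  have "{b. thom (ku xs) (length xs) (mcoord f b) \<sigma> \<noteq> 0} \<subseteq> (\<Union>s<length xs. keys (f (\<sigma> - {s})))"
  proof
    fix b assume "b \<in> {b. thom (ku xs) (length xs) (mcoord f b) \<sigma> \<noteq> 0}"
    then obtain m where "lookup (thom (ku xs) (length xs) (mcoord f b) \<sigma>) m \<noteq> 0"
      unfolding poly_mapping_neq_0_iff by blast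
    then obtain s where "s < length xs" "lookup (mcoord f b (\<sigma> - {s})) (m + klcm xs \<sigma> - klcm xs (\<sigma> - {s})) \<noteq> 0"
      by (rule thom_coeff)
    then have "mcoord f b (\<sigma> - {s}) \<noteq> 0" by (metis lookup_zero)
    then show "b \<in> (\<Union>s<length xs. keys (f (\<sigma> - {s})))"
      using \<open>s < length xs\<close> by (auto simp: mcoord_def in_keys_iff[of b])
  qed
  then have "finite {b. thom (ku xs) (length xs) (mcoord f b) \<sigma> \<noteq> 0}"
    by (rule finite_subset) simp
  then show "mcoord (mthom xs f) b \<sigma> = thom (ku xs) (length xs) (mcoord f b) \<sigma>"
    unfolding mcoord_def[of "mthom xs f"] mthom_def by (simp add: lookup_Abs_poly_mapping)
qed

section \<open>The double complex of a resolution and the Koszul complex\<close>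

locale koszul_resolution = monomial_resolution V M F
  for V :: "'x set" and M and F :: "('x, 'k::field) resolution" +
  fixes xs :: "'x list" and j :: nat
  assumes distinct_xs: "distinct xs" and set_xs: "set xs = V"
begin

text \<open>The part of total degree j of the tensor product of F_i with the p-th Koszul module.
  Both differentials preserve the total degree, so j is fixed once and for all.\<close>

definition C :: "nat \<Rightarrow> nat \<Rightarrow> (nat set \<Rightarrow> nat \<Rightarrow>\<^sub>0 ('x, 'k) mpoly) set"
  where "C i p = {f. \<forall>b. mcoord f b \<in> kchains xs j (res_degree F i b) p \<and>
    (b \<notin> res_basis F i \<longrightarrow> mcoord f b = 0)}"

definition dh :: "nat \<Rightarrow> (nat set \<Rightarrow> nat \<Rightarrow>\<^sub>0 ('x, 'k) mpoly) \<Rightarrow> nat set \<Rightarrow> nat \<Rightarrow>\<^sub>0 ('x, 'k) mpoly"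
  where "dh i f \<sigma> = lin_ext (res_diff F (Suc i)) (f \<sigma>)"

text \<open>Regroups by faces instead of by basis elements of the resolution: \<open>C\<close> is
  built from Koszul chains, whereas horizontal exactness applies to the vector sitting on one
  face.\<close>

lemma C_component:
  assumes "f \<in> C i p" "f \<sigma> \<noteq> 0"
  shows "\<sigma> \<subseteq> {..<length xs}" "card \<sigma> = p" "p \<le> j" "f \<sigma> \<in> gcomp i (j - p)"
proof -
  have c: "\<sigma> \<subseteq> {..<length xs} \<and> card \<sigma> = p \<and> p \<le> j \<and>
      b \<in> res_basis F i \<and> keys m \<subseteq> V \<and> mdeg m + res_degree F i b = j - p"
    if "lookup (lookup (f \<sigma>) b) m \<noteq> 0" for b m
  proof -
    have l: "lookup (mcoord f b \<sigma>) m \<noteq> 0" using that by (simp add: mcoord_def)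
    have f: "mcoord f b \<in> kchains xs j (res_degree F i b) p" "b \<notin> res_basis F i \<longrightarrow> mcoord f b = 0"
      using assms(1) unfolding C_def by blast+
    moreover have "mcoord f b \<noteq> 0" using l by auto
    ultimately show ?thesis using kchainsD[OF f(1) l] set_xs by auto
  qed
  obtain b m where bm: "lookup (lookup (f \<sigma>) b) m \<noteq> 0"
    using assms(2) unfolding poly_mapping_neq_0_iff by blast
  show "\<sigma> \<subseteq> {..<length xs}" "card \<sigma> = p" "p \<le> j" using c[OF bm] by simp_all
  show "f \<sigma> \<in> gcomp i (j - p)"
    unfolding free_module_component_fsup fsup_def using c by blast
qed

lemma C_I:
  assumes "\<And>\<sigma>. f \<sigma> \<noteq> 0 \<Longrightarrow> \<sigma> \<subseteq> {..<length xs} \<and> card \<sigma> = p \<and> p \<le> j \<and> f \<sigma> \<in> gcomp i (j - p)"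
  shows "f \<in> C i p"
proof -
  have c: "\<sigma> \<subseteq> {..<length xs} \<and> card \<sigma> = p \<and> p \<le> j \<and>
      b \<in> res_basis F i \<and> keys m \<subseteq> V \<and> mdeg m + res_degree F i b = j - p"
    if "lookup (mcoord f b \<sigma>) m \<noteq> 0" for b m \<sigma>
  proof -
    have l: "lookup (lookup (f \<sigma>) b) m \<noteq> 0"
      using that by (simp add: mcoord_def)
    then have "f \<sigma> \<noteq> 0" by auto
    with l assms[of \<sigma>] show ?thesis unfolding free_module_component_fsup fsup_def by blast
  qed
  have "mcoord f b \<in> kchains xs j (res_degree F i b) p" for b
    by (rule kchainsI) (use c[of b] set_xs in auto)
  moreover have "mcoord f b = 0" if "b \<notin> res_basis F i" for b
    by (intro ext poly_mapping_eqI) (use c[of b] that in auto)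
  ultimately show ?thesis unfolding C_def by blast
qed

text \<open>Preimages are chosen face by face. Zero is chosen where x vanishes, which keeps the
  support inside the admissible faces and is why \<open>P 0 0\<close> is demanded.\<close>

lemma C_lift:
  assumes "\<And>\<sigma>. x \<sigma> \<noteq> 0 \<Longrightarrow> \<sigma> \<subseteq> {..<length xs} \<and> card \<sigma> = p \<and> p \<le> j \<and> (\<exists>w \<in> gcomp i (j - p). P (x \<sigma>) w)"
    and "P 0 0"
  shows "\<exists>y \<in> C i p. \<forall>\<sigma>. P (x \<sigma>) (y \<sigma>)"
proof -
  define y where "y = (\<lambda>\<sigma>. if x \<sigma> = 0 then 0 else SOME w. w \<in> gcomp i (j - p) \<and> P (x \<sigma>) w)"
  have y: "y \<sigma> \<in> gcomp i (j - p) \<and> P (x \<sigma>) (y \<sigma>)" if "x \<sigma> \<noteq> 0" for \<sigma>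
    using assms(1)[OF that] that someI_ex[of "\<lambda>w. w \<in> gcomp i (j - p) \<and> P (x \<sigma>) w"]
    by (auto simp: y_def)
  have "y \<in> C i p"
  proof (rule C_I)
    fix \<sigma> assume "y \<sigma> \<noteq> 0"
    then have "x \<sigma> \<noteq> 0" by (auto simp: y_def)
    then show "\<sigma> \<subseteq> {..<length xs} \<and> card \<sigma> = p \<and> p \<le> j \<and> y \<sigma> \<in> gcomp i (j - p)"
      using assms(1) y by blast
  qed
  moreover have "P (x \<sigma>) (y \<sigma>)" for \<sigma>
    using y[of \<sigma>] assms(2) by (cases "x \<sigma> = 0") (auto simp: y_def)
  ultimately show ?thesis by blast
qed

lemma dh_C:
  assumes "f \<in> C (Suc i) p"
  shows "dh i f \<in> C i p"
proof (rule C_I)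
  fix \<sigma> assume "dh i f \<sigma> \<noteq> 0"
  then have "f \<sigma> \<noteq> 0" by (auto simp: dh_def)
  then show "\<sigma> \<subseteq> {..<length xs} \<and> card \<sigma> = p \<and> p \<le> j \<and> dh i f \<sigma> \<in> gcomp i (j - p)"
    using C_component[OF assms] lin_ext_res_diff_comp by (simp add: dh_def)
qed

lemma mdiff_C:
  assumes "f \<in> C i (Suc p)"
  shows "mdiff xs f \<in> C i p"
  using assms unfolding C_def by (simp add: mcoord_mdiff kdiff_kchains[OF distinct_xs])

lemma mthom_C:
  assumes "f \<in> C i p"
  shows "mthom xs f \<in> C i (Suc p)"
  using assms unfolding C_def by (simp add: mcoord_mthom thom_kchains[OF distinct_xs])

lemma mdiff_mthom:
  assumes "f \<in> C i p" "mdiff xs f = 0" "p = 0 \<Longrightarrow> Poly_Mapping.map residue (f {}) = 0"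
  shows "mdiff xs (mthom xs f) = f"
proof (rule mcoord_inject)
  fix b
  have "kdiff xs (thom (ku xs) (length xs) (mcoord f b)) = mcoord f b"
  proof (rule kdiff_thom)
    show "mcoord f b \<in> kchains xs j (res_degree F i b) p"
      using assms(1) unfolding C_def by blast
    show "kdiff xs (mcoord f b) = 0"
      using assms(2) unfolding mcoord_mdiff[symmetric] by simp
    assume "p = 0"
    then have "lookup (Poly_Mapping.map residue (f {})) b = 0" using assms(3) by simp
    then show "lookup (mcoord f b {}) 0 = 0"
      by (auto simp: mcoord_def residue_def Poly_Mapping.map.rep_eq when_def split: if_splits)
  qed
  then show "mcoord (mdiff xs (mthom xs f)) b = mcoord f b"
    by (simp add: mcoord_mdiff mcoord_mthom)
qed

sublocale dc: double_complex C dh "\<lambda>_. mdiff xs"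
proof
  fix i p x y
  show "x \<in> C i p \<Longrightarrow> y \<in> C i p \<Longrightarrow> x - y \<in> C i p"
  proof -
    assume *: "x \<in> C i p" "y \<in> C i p"
    have "mcoord (x - y) b = mcoord x b - mcoord y b" for b
      by (simp add: mcoord_def fun_eq_iff lookup_minus)
    with * show "x - y \<in> C i p" unfolding C_def by (simp add: kchains_diff)
  qed
  show "dh i (x - y) = dh i x - dh i y"
    by (simp add: dh_def fun_eq_iff lin_ext_diff)
  show "mdiff xs (x - y) = mdiff xs x - mdiff xs y"
    by (rule mdiff_diff)
  show "dh i (mdiff xs x) = mdiff xs (dh i x)"
    by (simp add: dh_def mdiff_def fun_eq_iff lin_ext_sum lin_ext_scale)
  show "mdiff xs (mdiff xs x) = 0" by (rule mdiff_mdiff)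
  show "x \<in> C (Suc i) p \<Longrightarrow> dh i x \<in> C i p" by (rule dh_C)
  show "x \<in> C i (Suc p) \<Longrightarrow> mdiff xs x \<in> C i p" by (rule mdiff_C)
  show "dh i (dh (Suc i) x) = 0" if "x \<in> C (Suc (Suc i)) p"
  proof
    fix \<sigma>
    show "dh i (dh (Suc i) x) \<sigma> = 0 \<sigma>"
      using C_component(4)[OF that, of \<sigma>] res_diff_res_diff
      by (cases "x \<sigma> = 0") (auto simp: dh_def)
  qed
  show "\<exists>y \<in> C (Suc (Suc i)) p. dh (Suc i) y = x" if "x \<in> C (Suc i) p" "dh i x = 0"
  proof -
    have "\<exists>y \<in> C (Suc (Suc i)) p. \<forall>\<sigma>. lin_ext (res_diff F (Suc (Suc i))) (y \<sigma>) = x \<sigma>"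
    proof (rule C_lift)
      fix \<sigma> assume "x \<sigma> \<noteq> 0"
      moreover have "lin_ext (res_diff F (Suc i)) (x \<sigma>) = 0"
        using that(2) by (simp add: dh_def fun_eq_iff)
      ultimately show "\<sigma> \<subseteq> {..<length xs} \<and> card \<sigma> = p \<and> p \<le> j \<and>
          (\<exists>w \<in> gcomp (Suc (Suc i)) (j - p). lin_ext (res_diff F (Suc (Suc i))) w = x \<sigma>)"
        using C_component[OF that(1)] exact_component by simp
    qed simp
    then show ?thesis by (auto simp: dh_def fun_eq_iff)
  qed
  \<comment> \<open>In positive Koszul degree the proviso of \<open>mdiff_mthom\<close> about
    constant terms is void.\<close>
  show "\<exists>y \<in> C i (Suc (Suc p)). mdiff xs y = x" if "x \<in> C i (Suc p)" "mdiff xs x = 0"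
    using mthom_C[OF that(1)] mdiff_mthom[OF that] by auto
qed

end

section \<open>Tor as Koszul homology\<close>

lemma scale_zero: "Poly_Mapping.map ((*) (p::'c::comm_ring_1)) 0 = 0"
  by (rule poly_mapping_eqI) simp

lemma residue_zero [simp]: "residue 0 = 0"
  by (simp add: residue_def)

lemma residue_sum: "residue (sum g S) = (\<Sum>s\<in>S. residue (g s))"
  by (simp add: residue_def lookup_sum)

text \<open>A product of monomials is 1 only if both factors are. Multiplicativity allows the
  matrices of a resolution to be reduced entry by entry.\<close>

lemma residue_mult:
  fixes p q :: "('x, 'k::field) mpoly"
  shows "residue (p * q) = residue p * residue q"
proof -
  have "residue (p * q) = (\<Sum>l. lookup p l * (\<Sum>q'. lookup q q' when 0 = l + q'))"
    by (simp add: residue_def lookup_mult)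
  also have "(\<lambda>l. lookup p l * (\<Sum>q'. lookup q q' when 0 = l + q')) =
      (\<lambda>l. (lookup p l * residue q) when l = 0)"
  proof
    fix l :: "'x expo"
    have "0 = l + q' \<longleftrightarrow> l = 0 \<and> q' = 0" for q' :: "'x expo"
      by (metis add_is_0 mdeg_add mdeg_eq_0_iff)
    then show "lookup p l * (\<Sum>q'. lookup q q' when 0 = l + q') =
        ((lookup p l * residue q) when l = 0)"
      by (cases "l = 0") (simp_all add: residue_def)
  qed
  finally show ?thesis by (simp add: residue_def)
qed

abbreviation "resid v \<equiv> Poly_Mapping.map residue v"

lemma lookup_resid [simp]: "lookup (resid v) b = residue (lookup v b)"
  by (simp add: Poly_Mapping.map.rep_eq when_def)

lemma resid_lin_ext: "resid (lin_ext D v) = lin_ext (\<lambda>b. resid (D b)) (resid v)"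
proof (rule poly_mapping_eqI)
  fix c
  have "keys (resid v) \<subseteq> keys v"
    by (auto simp: in_keys_iff)
  then show "lookup (resid (lin_ext D v)) c =
      lookup (lin_ext (\<lambda>b. resid (D b)) (resid v)) c"
    by (simp add: lookup_lin_ext[where A = "keys v"] residue_sum residue_mult)
qed

lemma resid_diff: "resid (v - w) = resid v - resid w"
  by (rule poly_mapping_eqI) (simp add: residue_def lookup_minus)

lemma resid_zero [simp]: "resid 0 = 0"
  by (rule poly_mapping_eqI) simp

lemma tensor_diff_resid:
  "tensor_diff F (Suc i) (resid v) = resid (lin_ext (res_diff F (Suc i)) v)"
  by (simp add: tensor_diff_def resid_lin_ext)

lemma tensor_diff_add: "tensor_diff F i (c + d) = tensor_diff F i c + tensor_diff F i d"
  by (simp add: tensor_diff_def lin_ext_add)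

lemma tensor_diff_zero [simp]: "tensor_diff F i 0 = 0"
  by (simp add: tensor_diff_def)

lemma tensor_diff_uminus: "tensor_diff F i (- c) = - tensor_diff F i c"
  using lin_ext_diff[of "\<lambda>b. resid (res_diff F i b)" 0 c] by (simp add: tensor_diff_def)

lemma tensor_component_add:
  "c \<in> tensor_component F i j \<Longrightarrow> d \<in> tensor_component F i j \<Longrightarrow> c + d \<in> tensor_component F i j"
  unfolding tensor_component_def using Poly_Mapping.keys_add[of c d] by blast

lemma tensor_component_uminus:
  "c \<in> tensor_component F i j \<Longrightarrow> - c \<in> tensor_component F i j"
  unfolding tensor_component_def by simp

lemma tensor_component_zero [simp]: "0 \<in> tensor_component F i j"
  by (simp add: tensor_component_def)

lemma comm_group_tensor_cycles: "comm_group (tensor_cycles F i j)"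
proof (rule comm_groupI)
  fix c assume "c \<in> carrier (tensor_cycles F i j)"
  then show "\<exists>d \<in> carrier (tensor_cycles F i j). d \<otimes>\<^bsub>tensor_cycles F i j\<^esub> c = \<one>\<^bsub>tensor_cycles F i j\<^esub>"
    by (intro bexI[of _ "- c"]) (auto simp: tensor_cycles_def tensor_component_uminus tensor_diff_uminus)
next
  show "\<one>\<^bsub>tensor_cycles F i j\<^esub> \<in> carrier (tensor_cycles F i j)"
    by (simp add: tensor_cycles_def)
qed (auto simp: tensor_cycles_def tensor_component_add tensor_diff_add ac_simps)

lemma trivial_FactGroup_iff:
  assumes "comm_group G" "subgroup H G"
  shows "trivial_group (G Mod H) \<longleftrightarrow> carrier G \<subseteq> H"
proof -
  interpret G: comm_group G by fact
  have grp: "group (G Mod H)"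
    using G.subgroup_imp_normal[OF assms(2)] by (rule normal.factorgroup_is_group)
  have "carrier (G Mod H) = {H} \<longleftrightarrow> carrier G \<subseteq> H"
  proof
    assume eq: "carrier (G Mod H) = {H}"
    show "carrier G \<subseteq> H"
    proof
      fix x assume x: "x \<in> carrier G"
      then have "H #>\<^bsub>G\<^esub> x = H" using eq unfolding FactGroup_def RCOSETS_def by auto
      then show "x \<in> H" using G.rcos_self[OF x assms(2)] by simp
    qed
  next
    assume "carrier G \<subseteq> H"
    then have "H #>\<^bsub>G\<^esub> x = H" if "x \<in> carrier G" for x
      using that assms(2) G.coset_join2 by blast
    then show "carrier (G Mod H) = {H}" unfolding FactGroup_def RCOSETS_def by auto
  qed
  then show ?thesis using grp unfolding trivial_group_def by (simp add: FactGroup_def)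
qed

definition tensor_exact :: "('x, 'k::field) resolution \<Rightarrow> nat \<Rightarrow> nat \<Rightarrow> bool"
  where "tensor_exact F i j \<longleftrightarrow>
    (\<forall>c \<in> tensor_component F i j. tensor_diff F i c = 0 \<longrightarrow> c \<in> tensor_boundaries F i j)"

context monomial_resolution
begin

lemma resid_component:
  assumes "v \<in> gcomp i j"
  shows "resid v \<in> tensor_component F i j"
  unfolding tensor_component_def
proof (intro CollectI subsetI)
  fix b assume "b \<in> keys (resid v)"
  then have "lookup (lookup v b) 0 \<noteq> 0"
    by (simp add: in_keys_iff residue_def)
  then have "b \<in> res_basis F i \<and> mdeg (0 :: 'x expo) + res_degree F i b = j"
    using assms unfolding free_module_component_fsup fsup_def by blast
  then show "b \<in> res_basis F i \<and> res_degree F i b = j" by simp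
qed

lemma component_resid:
  assumes "c \<in> tensor_component F i j"
  shows "\<exists>v \<in> gcomp i j. resid v = c"
proof
  \<comment> \<open>Constant polynomials have degree 0, so this lift stays in degree j.\<close>
  define v where "v = Poly_Mapping.map (\<lambda>a. single (0 :: 'x expo) a) c"
  have v: "lookup v b = single 0 (lookup c b)" for b
    by (simp add: v_def Poly_Mapping.map.rep_eq when_def)
  show "resid v = c"
    by (rule poly_mapping_eqI) (simp add: v residue_def)
  show "v \<in> gcomp i j"
    unfolding free_module_component_fsup fsup_def using assms
    by (auto simp: v lookup_single when_def tensor_component_def in_keys_iff subset_iff split: if_splits)
qed

text \<open>Lift to the resolution, where consecutive differentials compose to zero by exactness.
  This is needed for the boundaries to be a subgroup of the cycles.\<close>

lemma tensor_boundaries_subset: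
  "tensor_boundaries F (Suc i) j \<subseteq> {c \<in> tensor_component F (Suc i) j. tensor_diff F (Suc i) c = 0}"
proof
  fix d assume "d \<in> tensor_boundaries F (Suc i) j"
  then obtain c where c: "c \<in> tensor_component F (Suc (Suc i)) j" "d = tensor_diff F (Suc (Suc i)) c"
    by (auto simp: tensor_boundaries_def)
  obtain v where v: "v \<in> gcomp (Suc (Suc i)) j" "resid v = c" using component_resid[OF c(1)] by blast
  have d: "d = resid (lin_ext (res_diff F (Suc (Suc i))) v)"
    unfolding c(2) v(2)[symmetric] by (rule tensor_diff_resid)
  have "d \<in> tensor_component F (Suc i) j"
    unfolding d by (intro resid_component lin_ext_res_diff_comp v)
  moreover have "tensor_diff F (Suc i) d = 0"
    unfolding d tensor_diff_resid by (simp add: res_diff_res_diff[OF v(1)])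
  ultimately show "d \<in> {c \<in> tensor_component F (Suc i) j. tensor_diff F (Suc i) c = 0}" by blast
qed

lemma tensor_homology_trivial_iff:
  "trivial_group (tensor_cycles F (Suc i) j Mod tensor_boundaries F (Suc i) j) \<longleftrightarrow> tensor_exact F (Suc i) j"
proof -
  interpret comm_group "tensor_cycles F (Suc i) j" by (rule comm_group_tensor_cycles)
  have inv: "inv\<^bsub>tensor_cycles F (Suc i) j\<^esub> c = - c" if "c \<in> carrier (tensor_cycles F (Suc i) j)" for c
    by (rule inv_equality)
      (use that in \<open>auto simp: tensor_cycles_def tensor_component_uminus tensor_diff_uminus\<close>)
  have "subgroup (tensor_boundaries F (Suc i) j) (tensor_cycles F (Suc i) j)"
  proof (rule subgroupI)
    show sub: "tensor_boundaries F (Suc i) j \<subseteq> carrier (tensor_cycles F (Suc i) j)"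
      using tensor_boundaries_subset by (simp add: tensor_cycles_def)
    show "tensor_boundaries F (Suc i) j \<noteq> {}"
      unfolding tensor_boundaries_def using tensor_component_zero by blast
    fix a assume a: "a \<in> tensor_boundaries F (Suc i) j"
    then obtain c where c: "c \<in> tensor_component F (Suc (Suc i)) j" "a = tensor_diff F (Suc (Suc i)) c"
      by (auto simp: tensor_boundaries_def)
    have "- a \<in> tensor_boundaries F (Suc i) j"
      unfolding c(2) tensor_diff_uminus[symmetric] tensor_boundaries_def
      by (intro imageI tensor_component_uminus c(1))
    then show "inv\<^bsub>tensor_cycles F (Suc i) j\<^esub> a \<in> tensor_boundaries F (Suc i) j"
      using inv[of a] sub a by auto
    fix b assume "b \<in> tensor_boundaries F (Suc i) j"
    then obtain d where d: "d \<in> tensor_component F (Suc (Suc i)) j" "b = tensor_diff F (Suc (Suc i)) d"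
      by (auto simp: tensor_boundaries_def)
    have "a + b \<in> tensor_boundaries F (Suc i) j"
      unfolding c(2) d(2) tensor_diff_add[symmetric] tensor_boundaries_def
      by (intro imageI tensor_component_add c(1) d(1))
    then show "a \<otimes>\<^bsub>tensor_cycles F (Suc i) j\<^esub> b \<in> tensor_boundaries F (Suc i) j"
      by (simp add: tensor_cycles_def)
  qed
  from trivial_FactGroup_iff[OF comm_group_tensor_cycles this] show ?thesis
    by (auto simp: tensor_cycles_def tensor_exact_def)
qed

end

context koszul_resolution
begin

lemma C_0_eq_0:
  assumes "f \<in> C i 0" "\<sigma> \<noteq> {}"
  shows "f \<sigma> = 0"
proof (rule ccontr)
  assume "f \<sigma> \<noteq> 0"
  note c = C_component[OF assms(1) this]
  then have "finite \<sigma>" using finite_subset by blast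
  with c assms(2) show False by simp
qed

lemma C_0_I:
  assumes "v \<in> gcomp i j"
  shows "(\<lambda>\<sigma>. if \<sigma> = {} then v else 0) \<in> C i 0"
  by (rule C_I) (use assms in \<open>auto split: if_splits\<close>)

lemma C_0_D: "f \<in> C i 0 \<Longrightarrow> f {} \<in> gcomp i j"
  using C_component(4)[of f i 0 "{}"] by (cases "f {} = 0") (auto simp: free_module_component_fsup)

text \<open>At its end the Koszul complex has cokernel K: coefficients without constant term are
  combinations of variables, found by \<open>mthom\<close>, and conversely no variable divides
  1.\<close>

lemma mdiff_image_iff:
  assumes "x \<in> C i 0"
  shows "x \<in> mdiff xs ` C i 1 \<longleftrightarrow> resid (x {}) = 0"
proof
  assume "resid (x {}) = 0"
  moreover have "mdiff xs x = 0"
    unfolding mdiff_def by (intro ext) (simp add: C_0_eq_0[OF assms] scale_zero)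
  ultimately have "mdiff xs (mthom xs x) = x" by (intro mdiff_mthom[OF assms]) auto
  then show "x \<in> mdiff xs ` C i 1" using mthom_C[OF assms] by (metis One_nat_def imageI)
next
  assume "x \<in> mdiff xs ` C i 1"
  then obtain y where y: "x = mdiff xs y" by blast
  show "resid (x {}) = 0"
  proof (rule poly_mapping_eqI, rule ccontr)
    fix b assume "lookup (resid (x {})) b \<noteq> lookup 0 b"
    then have "lookup (kdiff xs (mcoord y b) {}) 0 \<noteq> 0"
      by (simp add: y residue_def flip: mcoord_mdiff) (simp add: mcoord_def)
    then obtain s where "s < length xs" "edvd (klcm xs (insert s {}) - klcm xs {}) 0"
      by (rule tdiff_coeff)
    then show False
      using klcm_insert[OF distinct_xs, of s "{}"] edvd_mdeg by fastforce
  qed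
qed

text \<open>At p = 0 a vector modulo Koszul boundaries is its residue, so this edge of the double
  complex is F tensored with K.\<close>

lemma h_exact_iff_tensor_exact: "dc.h_exact_mod_v i 0 \<longleftrightarrow> tensor_exact F (Suc i) j"
proof
  assume h: "dc.h_exact_mod_v i 0"
  show "tensor_exact F (Suc i) j"
    unfolding tensor_exact_def
  proof (intro ballI impI)
    fix c assume c: "c \<in> tensor_component F (Suc i) j" "tensor_diff F (Suc i) c = 0"
    obtain v where v: "v \<in> gcomp (Suc i) j" "resid v = c" using component_resid[OF c(1)] by blast
    define x where "x = (\<lambda>\<sigma>::nat set. if \<sigma> = {} then v else 0)"
    have x: "x \<in> C (Suc i) 0" unfolding x_def by (rule C_0_I[OF v(1)])
    have "resid (dh i x {}) = 0"
      using c(2) unfolding v(2)[symmetric] tensor_diff_resid by (simp add: dh_def x_def)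
    then have "dh i x \<in> mdiff xs ` C i (Suc 0)"
      using mdiff_image_iff[OF dh_C[OF x]] by simp
    then obtain y z where y: "y \<in> C (Suc (Suc i)) 0" and z: "z \<in> C (Suc i) (Suc 0)"
      and xyz: "x = dh (Suc i) y + mdiff xs z"
      using h x unfolding dc.h_exact_mod_v_def by blast
    have "resid (mdiff xs z {}) = 0"
      using mdiff_image_iff[OF mdiff_C[OF z]] z by auto
    moreover have "v - mdiff xs z {} = lin_ext (res_diff F (Suc (Suc i))) (y {})"
      using fun_cong[OF xyz, of "{}"] by (simp add: x_def dh_def)
    ultimately have "resid (lin_ext (res_diff F (Suc (Suc i))) (y {})) = c"
      using v(2) resid_diff[of v "mdiff xs z {}"] by simp
    then have "c = tensor_diff F (Suc (Suc i)) (resid (y {}))" by (simp add: tensor_diff_resid)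
    then show "c \<in> tensor_boundaries F (Suc i) j"
      unfolding tensor_boundaries_def using resid_component[OF C_0_D[OF y]] by blast
  qed
next
  assume t: "tensor_exact F (Suc i) j"
  show "dc.h_exact_mod_v i 0"
    unfolding dc.h_exact_mod_v_def
  proof (intro ballI impI)
    fix x assume x: "x \<in> C (Suc i) 0" and "dh i x \<in> mdiff xs ` C i (Suc 0)"
    then have "resid (dh i x {}) = 0" using mdiff_image_iff[OF dh_C[OF x]] by simp
    then have "tensor_diff F (Suc i) (resid (x {})) = 0"
      by (simp add: dh_def tensor_diff_resid)
    then have "resid (x {}) \<in> tensor_boundaries F (Suc i) j"
      using t resid_component[OF C_0_D[OF x]] unfolding tensor_exact_def by blast
    then obtain c where c: "c \<in> tensor_component F (Suc (Suc i)) j"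
      "resid (x {}) = tensor_diff F (Suc (Suc i)) c"
      by (auto simp: tensor_boundaries_def)
    obtain v where v: "v \<in> gcomp (Suc (Suc i)) j" "resid v = c" using component_resid[OF c(1)] by blast
    define y where "y = (\<lambda>\<sigma>::nat set. if \<sigma> = {} then v else 0)"
    have y: "y \<in> C (Suc (Suc i)) 0" unfolding y_def by (rule C_0_I[OF v(1)])
    have "x - dh (Suc i) y \<in> C (Suc i) 0" by (intro dc.diff_closed x dh_C y)
    moreover have "resid ((x - dh (Suc i) y) {}) = 0"
      using c(2) unfolding v(2)[symmetric] tensor_diff_resid by (simp add: resid_diff dh_def y_def)
    ultimately have "x - dh (Suc i) y \<in> mdiff xs ` C (Suc i) 1" by (simp only: mdiff_image_iff)
    then obtain z where "z \<in> C (Suc i) (Suc 0)" "x - dh (Suc i) y = mdiff xs z" by auto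
    with y show "\<exists>y \<in> C (Suc (Suc i)) 0. \<exists>z \<in> C (Suc i) (Suc 0). x = dh (Suc i) y + mdiff xs z"
      by (intro bexI[of _ y] bexI[of _ z]) (auto simp: algebra_simps)
  qed
qed

section \<open>The edge of the double complex over A/L\<close>

definition aug :: "(nat set \<Rightarrow> nat \<Rightarrow>\<^sub>0 ('x, 'k) mpoly) \<Rightarrow> nat set \<Rightarrow> ('x, 'k) mpoly"
  where "aug f \<sigma> = augmentation F (f \<sigma>)"

lemma aug_mdiff: "aug (mdiff xs x) = kdiff xs (aug x)"
  by (simp add: aug_def mdiff_def tdiff_def fun_eq_iff augmentation_sum augmentation_scale)

lemma aug_diff: "aug (x - y) = aug x - aug y"
  by (simp add: aug_def fun_eq_iff augmentation_diff)

lemma aug_kchains: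
  assumes "x \<in> C 0 p"
  shows "aug x \<in> kchains xs j 0 p"
proof (rule kchainsI)
  fix \<sigma> m assume a: "lookup (aug x \<sigma>) m \<noteq> 0"
  then have "x \<sigma> \<noteq> 0" by (auto simp: aug_def)
  note c = C_component[OF assms this]
  show "\<sigma> \<subseteq> {..<length xs} \<and> card \<sigma> = p \<and> keys m \<subseteq> set xs \<and> mdeg m + 0 + p = j"
    using c augmentation_coeff[of "x \<sigma>" "\<lambda>d. d = j - p" m] a set_xs
    by (simp add: free_module_component_fsup aug_def)
qed

lemma aug_lift:
  assumes "w \<in> kchains xs j 0 p"
  obtains x where "x \<in> C 0 p" "\<And>\<sigma>. w \<sigma> - aug x \<sigma> \<in> mideal M"
proof -
  have "\<exists>x \<in> C 0 p. \<forall>\<sigma>. w \<sigma> - augmentation F (x \<sigma>) \<in> mideal M"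
  proof (rule C_lift)
    fix \<sigma> assume "w \<sigma> \<noteq> 0"
    then obtain m0 where m0: "lookup (w \<sigma>) m0 \<noteq> 0"
      unfolding poly_mapping_neq_0_iff by blast
    note k = kchainsD[OF assms m0]
    have "\<exists>v \<in> gcomp 0 (j - p). w \<sigma> - augmentation F v \<in> mideal M"
    proof (rule augmentation_surj)
      fix m assume "m \<in> keys (w \<sigma>)"
      then have "lookup (w \<sigma>) m \<noteq> 0" by (simp add: in_keys_iff)
      from kchainsD[OF assms this] show "keys m \<subseteq> V \<and> mdeg m = j - p"
        using set_xs by auto
    qed
    then show "\<sigma> \<subseteq> {..<length xs} \<and> card \<sigma> = p \<and> p \<le> j \<and>
        (\<exists>v \<in> gcomp 0 (j - p). w \<sigma> - augmentation F v \<in> mideal M)"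
      using k by simp
  qed simp
  then show ?thesis using that unfolding aug_def by blast
qed

text \<open>Exactness at F_0, applied face by face: the horizontal cokernel at i = 0 is the Koszul
  module over A/L.\<close>

lemma dh_image_iff:
  assumes "x \<in> C 0 p"
  shows "x \<in> dh 0 ` C 1 p \<longleftrightarrow> (\<forall>\<sigma>. aug x \<sigma> \<in> mideal M)"
proof
  assume "x \<in> dh 0 ` C 1 p"
  then obtain y where y: "y \<in> C 1 p" "x = dh 0 y" by blast
  show "\<forall>\<sigma>. aug x \<sigma> \<in> mideal M"
  proof
    fix \<sigma>
    show "aug x \<sigma> \<in> mideal M"
      using C_component(4)[OF y(1), of \<sigma>] augmentation_res_diff
      by (cases "y \<sigma> = 0") (auto simp: aug_def y(2) dh_def)
  qed
next
  assume a: "\<forall>\<sigma>. aug x \<sigma> \<in> mideal M"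
  have "\<exists>y \<in> C 1 p. \<forall>\<sigma>. lin_ext (res_diff F 1) (y \<sigma>) = x \<sigma>"
  proof (rule C_lift)
    fix \<sigma> assume "x \<sigma> \<noteq> 0"
    then show "\<sigma> \<subseteq> {..<length xs} \<and> card \<sigma> = p \<and> p \<le> j \<and>
        (\<exists>w \<in> gcomp 1 (j - p). lin_ext (res_diff F 1) w = x \<sigma>)"
      using C_component[OF assms] exact_augmentation a by (simp add: aug_def)
  qed simp
  then obtain y where "y \<in> C 1 p" "\<forall>\<sigma>. lin_ext (res_diff F 1) (y \<sigma>) = x \<sigma>" by blast
  then have "x = dh 0 y" "y \<in> C 1 p" by (auto simp: dh_def fun_eq_iff)
  then show "x \<in> dh 0 ` C 1 p" by blast
qed

lemma kdiff_mideal: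
  fixes w :: "nat set \<Rightarrow> ('x, 'k) mpoly"
  assumes "\<And>\<sigma>. w \<sigma> \<in> mideal M"
  shows "kdiff xs w \<tau> \<in> mideal M"
  unfolding tdiff_def
proof (intro mideal_sum mideal_mult[OF upset] assms)
  fix s m
  assume s: "s \<in> {..<length xs} - \<tau>" and "m \<in> keys
    (single (klcm xs (insert s \<tau>) - klcm xs \<tau>) (ksign s \<tau> :: 'k))"
  then have "m = single (xs ! s) 1"
    using klcm_insert[OF distinct_xs, of s \<tau>] by (auto split: if_splits)
  then show "keys m \<subseteq> V" using s set_xs by auto
qed

text \<open>Exactness at p + 1 of the Koszul complex over A/L, written with representatives so that
  no quotient modules are formed.\<close>

definition quotient_exact :: "nat \<Rightarrow> bool"
  where "quotient_exact p \<longleftrightarrow>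
    (\<forall>w \<in> (kchains xs j 0 (Suc p) :: (nat set \<Rightarrow> ('x, 'k) mpoly) set). (\<forall>\<sigma>. kdiff xs w \<sigma> \<in> mideal M) \<longrightarrow>
    (\<exists>y \<in> kchains xs j 0 (Suc (Suc p)). \<forall>\<sigma>. w \<sigma> - kdiff xs y \<sigma> \<in> mideal M))"

text \<open>For the ideal itself, with one exterior generator less: this is the shift of the
  connecting map.\<close>

definition ideal_exact :: "nat \<Rightarrow> bool"
  where "ideal_exact p \<longleftrightarrow> (\<forall>z \<in> (kchains xs j 0 p :: (nat set \<Rightarrow> ('x, 'k) mpoly) set).
    (\<forall>\<sigma>. z \<sigma> \<in> mideal M) \<longrightarrow> kdiff xs z = 0 \<longrightarrow>
    (\<exists>w \<in> kchains xs j 0 (Suc p). (\<forall>\<sigma>. w \<sigma> \<in> mideal M) \<and> kdiff xs w = z))"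

text \<open>\<open>aug\<close> identifies the horizontal cokernel with the chains over A/L.
  Representatives are moved across by \<open>aug_lift\<close>, and errors in the ideal stay there
  under \<open>kdiff\<close>.\<close>

lemma v_exact_iff_quotient_exact: "dc.v_exact_mod_h 0 p \<longleftrightarrow> quotient_exact p"
proof
  assume v: "dc.v_exact_mod_h 0 p"
  show "quotient_exact p"
    unfolding quotient_exact_def
  proof (intro ballI impI)
    fix w :: "nat set \<Rightarrow> ('x, 'k) mpoly"
    assume w: "w \<in> kchains xs j 0 (Suc p)" "\<forall>\<sigma>. kdiff xs w \<sigma> \<in> mideal M"
    obtain x where x: "x \<in> C 0 (Suc p)" "\<And>\<sigma>. w \<sigma> - aug x \<sigma> \<in> mideal M"
      using aug_lift[OF w(1)] by blast
    have "aug (mdiff xs x) \<sigma> \<in> mideal M" for \<sigma>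
    proof -
      have "aug (mdiff xs x) \<sigma> = kdiff xs w \<sigma> - kdiff xs (w - aug x) \<sigma>"
        by (simp add: aug_mdiff tdiff_diff)
      then show ?thesis using w(2) kdiff_mideal[of "w - aug x"] x(2) by (simp add: mideal_diff)
    qed
    then have "mdiff xs x \<in> dh 0 ` C (Suc 0) p"
      using dh_image_iff[OF mdiff_C[OF x(1)]] by simp
    then obtain y z where y: "y \<in> C (Suc 0) (Suc p)" and z: "z \<in> C 0 (Suc (Suc p))"
      and xyz: "x = dh 0 y + mdiff xs z"
      using v x(1) unfolding dc.v_exact_mod_h_def by blast
    have "aug (dh 0 y) \<sigma> \<in> mideal M" for \<sigma>
      using dh_image_iff[OF dh_C[OF y]] y by auto
    moreover have "aug (dh 0 y) = aug x - kdiff xs (aug z)"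
      using xyz aug_diff[of x "mdiff xs z"] by (simp add: aug_mdiff)
    ultimately have "(aug x - kdiff xs (aug z)) \<sigma> \<in> mideal M" for \<sigma> by simp
    then have "w \<sigma> - kdiff xs (aug z) \<sigma> \<in> mideal M" for \<sigma>
      using mideal_add[OF x(2)[of \<sigma>], of "(aug x - kdiff xs (aug z)) \<sigma>"] by simp
    then show "\<exists>y \<in> kchains xs j 0 (Suc (Suc p)). \<forall>\<sigma>. w \<sigma> - kdiff xs y \<sigma> \<in> mideal M"
      using aug_kchains[OF z] by blast
  qed
next
  assume q: "quotient_exact p"
  show "dc.v_exact_mod_h 0 p"
    unfolding dc.v_exact_mod_h_def
  proof (intro ballI impI)
    fix x assume x: "x \<in> C 0 (Suc p)" and "mdiff xs x \<in> dh 0 ` C (Suc 0) p"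
    then have "\<forall>\<sigma>. kdiff xs (aug x) \<sigma> \<in> mideal M"
      using dh_image_iff[OF mdiff_C[OF x]] by (simp add: aug_mdiff)
    then obtain y where y: "y \<in> kchains xs j 0 (Suc (Suc p))"
      "\<And>\<sigma>. aug x \<sigma> - kdiff xs y \<sigma> \<in> mideal M"
      using q aug_kchains[OF x] unfolding quotient_exact_def by blast
    obtain z where z: "z \<in> C 0 (Suc (Suc p))" "\<And>\<sigma>. y \<sigma> - aug z \<sigma> \<in> mideal M"
      using aug_lift[OF y(1)] by blast
    have "aug (x - mdiff xs z) \<sigma> \<in> mideal M" for \<sigma>
    proof -
      have "aug (x - mdiff xs z) \<sigma> = (aug x \<sigma> - kdiff xs y \<sigma>) + kdiff xs (y - aug z) \<sigma>"
        by (simp add: aug_diff aug_mdiff tdiff_diff)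
      then show ?thesis using y(2) kdiff_mideal[of "y - aug z"] z(2) by (simp add: mideal_add)
    qed
    moreover have "x - mdiff xs z \<in> C 0 (Suc p)" by (intro dc.diff_closed x mdiff_C z(1))
    ultimately have "x - mdiff xs z \<in> dh 0 ` C 1 (Suc p)" by (simp only: dh_image_iff simp_thms)
    then obtain u where "u \<in> C (Suc 0) (Suc p)" "x - mdiff xs z = dh 0 u" by auto
    then show "\<exists>y \<in> C (Suc 0) (Suc p). \<exists>z \<in> C 0 (Suc (Suc p)). x = dh 0 y + mdiff xs z"
      using z(1) by (intro bexI[of _ u] bexI[of _ z]) (auto simp: algebra_simps)
  qed
qed

text \<open>The connecting isomorphism between \<open>Tor\<close> of \<open>A/L\<close> and of \<open>L\<close>.  It needs positive degree because the Koszul complex is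
  not exact in degree 0.\<close>

lemma quotient_exact_iff_ideal_exact:
  assumes "j > 0"
  shows "quotient_exact p \<longleftrightarrow> ideal_exact p"
proof
  assume q: "quotient_exact p"
  show "ideal_exact p"
    unfolding ideal_exact_def
  proof (intro ballI impI)
    fix z :: "nat set \<Rightarrow> ('x, 'k) mpoly"
    assume z: "z \<in> kchains xs j 0 p" "\<forall>\<sigma>. z \<sigma> \<in> mideal M" "kdiff xs z = 0"
    \<comment> \<open>A chain over the whole ring with boundary z; since z has entries in L, it is a
      cycle over A/L.\<close>
    let ?g = "thom (ku xs) (length xs) z"
    have g: "?g \<in> kchains xs j 0 (Suc p)" by (rule thom_kchains[OF distinct_xs z(1)])
    have dg: "kdiff xs ?g = z"
    proof (rule kdiff_thom[OF z(1,3)])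
      assume "p = 0"
      then show "lookup (z {}) 0 = 0"
        using kchainsD(4)[OF z(1), of "{}" 0] assms by auto
    qed
    then obtain y where y: "y \<in> kchains xs j 0 (Suc (Suc p))" "\<forall>\<sigma>. ?g \<sigma> - kdiff xs y \<sigma> \<in> mideal M"
      using q g z(2) unfolding quotient_exact_def by force
    have "?g - kdiff xs y \<in> kchains xs j 0 (Suc p)"
      by (intro kchains_diff g kdiff_kchains[OF distinct_xs] y(1))
    moreover have "kdiff xs (?g - kdiff xs y) = z"
      by (simp add: tdiff_diff tdiff_tdiff dg)
    ultimately show "\<exists>w \<in> kchains xs j 0 (Suc p). (\<forall>\<sigma>. w \<sigma> \<in> mideal M) \<and> kdiff xs w = z"
      using y(2) by (intro bexI[of _ "?g - kdiff xs y"]) auto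
  qed
next
  assume i: "ideal_exact p"
  show "quotient_exact p"
    unfolding quotient_exact_def
  proof (intro ballI impI)
    fix w :: "nat set \<Rightarrow> ('x, 'k) mpoly"
    assume w: "w \<in> kchains xs j 0 (Suc p)" "\<forall>\<sigma>. kdiff xs w \<sigma> \<in> mideal M"
    \<comment> \<open>The boundary of w has entries in L, so it is also the boundary of some w' over
      L; then w - w' is a cycle over the whole ring, where the Koszul complex is contracted.\<close>
    obtain w' where w': "w' \<in> kchains xs j 0 (Suc p)" "\<forall>\<sigma>. w' \<sigma> \<in> mideal M" "kdiff xs w' = kdiff xs w"
      using i kdiff_kchains[OF distinct_xs w(1)] w(2) tdiff_tdiff unfolding ideal_exact_def by blast
    have d: "w - w' \<in> kchains xs j 0 (Suc p)" by (intro kchains_diff w(1) w'(1))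
    have "kdiff xs (thom (ku xs) (length xs) (w - w')) = w - w'"
      by (rule kdiff_thom[OF d]) (simp_all add: tdiff_diff w'(3))
    then show "\<exists>y \<in> kchains xs j 0 (Suc (Suc p)). \<forall>\<sigma>. w \<sigma> - kdiff xs y \<sigma> \<in> mideal M"
      using w'(2) thom_kchains[OF distinct_xs d] by (intro bexI[of _ "thom (ku xs) (length xs) (w - w')"]) auto
  qed
qed

text \<open>A nonzero chain with at least one exterior generator has positive total degree.\<close>

lemma quotient_exact_degree_0:
  assumes "j = 0"
  shows "quotient_exact p"
  unfolding quotient_exact_def
proof (intro ballI impI)
  fix w :: "nat set \<Rightarrow> ('x, 'k) mpoly" assume w: "w \<in> kchains xs j 0 (Suc p)"
  have "w = 0"
    by (intro ext poly_mapping_eqI) (use kchainsD(4)[OF w] assms in auto)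
  then show "\<exists>y \<in> kchains xs j 0 (Suc (Suc p)). \<forall>\<sigma>. w \<sigma> - kdiff xs y \<sigma> \<in> mideal M"
    by (intro bexI[of _ 0]) auto
qed

end

text \<open>Vanishing of reduced simplicial homology, indexed by cardinality instead of dimension: p
  = 0 is the empty face. The type argument carries the field.\<close>

definition acyclic_at :: "'k::field itself \<Rightarrow> nat \<Rightarrow> nat set set \<Rightarrow> nat \<Rightarrow> bool"
  where "acyclic_at _ r \<Delta> p \<longleftrightarrow>
    (\<forall>g :: nat set \<Rightarrow> 'k. (\<forall>\<sigma>. g \<sigma> \<noteq> 0 \<longrightarrow> \<sigma> \<in> \<Delta> \<and> card \<sigma> = p) \<longrightarrow> bd r g = 0 \<longrightarrow>
      (\<exists>h. (\<forall>\<sigma>. h \<sigma> \<noteq> 0 \<longrightarrow> \<sigma> \<in> \<Delta> \<and> card \<sigma> = Suc p) \<and> bd r h = g))"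

text \<open>Known as the upper Koszul simplicial complex of the ideal in degree a.\<close>

definition koszul_complex :: "'x list \<Rightarrow> 'x expo set \<Rightarrow> 'x expo \<Rightarrow> nat set set"
  where "koszul_complex xs M a =
    {\<sigma>. \<sigma> \<subseteq> {..<length xs} \<and> edvd (klcm xs \<sigma>) a \<and> a - klcm xs \<sigma> \<in> M}"

text \<open>Faces of cardinality \<open>p\<close> account for \<open>Tor\<close> of \<open>A/L\<close> in homological degree \<open>p + 1\<close>.\<close>

definition koszul_acyclic :: "'k::field itself \<Rightarrow> 'x list \<Rightarrow> 'x expo set \<Rightarrow> nat \<Rightarrow> nat \<Rightarrow> bool"
  where "koszul_acyclic T xs M p j \<longleftrightarrow> (\<forall>a. keys a \<subseteq> set xs \<longrightarrow> mdeg a = j \<longrightarrow>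
    acyclic_at T (length xs) (koszul_complex xs M a) p)"

lemma edvd_minus_eq: "edvd e a \<Longrightarrow> edvd e b \<Longrightarrow> a - e = b - e \<longleftrightarrow> a = b"
  by (metis edvd_minus_add)

context koszul_resolution
begin

lemma kchains_coeffI:
  assumes "\<And>a \<sigma>. kstrand xs f a \<sigma> \<noteq> 0 \<Longrightarrow>
    \<sigma> \<subseteq> {..<length xs} \<and> card \<sigma> = p \<and> keys a \<subseteq> V \<and> mdeg a = j"
  shows "f \<in> kchains xs j 0 p"
proof (rule kchainsI)
  fix \<sigma> m assume "lookup (f \<sigma>) m \<noteq> 0"
  then have "kstrand xs f (m + klcm xs \<sigma>) \<sigma> \<noteq> 0" by (simp add: strand_def)
  from assms[OF this] show "\<sigma> \<subseteq> {..<length xs} \<and> card \<sigma> = p \<and> keys m \<subseteq> set xs \<and> mdeg m + 0 + p = j"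
    using set_xs by (auto simp: keys_add_exp mdeg_klcm[OF distinct_xs])
qed

lemma kchains_coeffD:
  assumes "f \<in> kchains xs j 0 p" "kstrand xs f a \<sigma> \<noteq> 0"
  shows "\<sigma> \<subseteq> {..<length xs}" "card \<sigma> = p" "keys a \<subseteq> V" "mdeg a = j" "edvd (klcm xs \<sigma>) a"
proof -
  have e: "edvd (klcm xs \<sigma>) a" and l: "lookup (f \<sigma>) (a - klcm xs \<sigma>) \<noteq> 0"
    using assms(2) by (auto simp: strand_def split: if_splits)
  note k = kchainsD[OF assms(1) l]
  have a: "a = (a - klcm xs \<sigma>) + klcm xs \<sigma>" using e by (simp add: edvd_minus_add)
  show "\<sigma> \<subseteq> {..<length xs}" "card \<sigma> = p" "edvd (klcm xs \<sigma>) a" using k e by blast+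
  show "keys a \<subseteq> V"
    using k(3) keys_klcm[of xs \<sigma>] set_xs by (subst a, subst keys_add_exp) auto
  show "mdeg a = j"
    using k mdeg_klcm[OF distinct_xs k(1)] by (subst a) simp
qed

lemma ideal_exact_imp_koszul_acyclic:
  assumes "ideal_exact p"
  shows "koszul_acyclic TYPE('k) xs M p j"
  unfolding koszul_acyclic_def acyclic_at_def
proof (intro allI impI)
  fix a and g :: "nat set \<Rightarrow> 'k"
  assume a: "keys a \<subseteq> set xs" "mdeg a = j"
    and g: "\<forall>\<sigma>. g \<sigma> \<noteq> 0 \<longrightarrow> \<sigma> \<in> koszul_complex xs M a \<and> card \<sigma> = p" and bdg: "bd (length xs) g = 0"
  \<comment> \<open>The monomials are chosen so that all of z lives in multidegree a, where it is
    g.\<close>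
  define z :: "nat set \<Rightarrow> ('x, 'k) mpoly" where "z = (\<lambda>\<sigma>. single (a - klcm xs \<sigma>) (g \<sigma>))"
  have strand_z: "kstrand xs z b = (if b = a then g else 0)" for b
  proof
    fix \<sigma>
    show "kstrand xs z b \<sigma> = (if b = a then g else 0) \<sigma>"
    proof (cases "g \<sigma> = 0")
      case False
      then have "edvd (klcm xs \<sigma>) a" using g by (auto simp: koszul_complex_def)
      then show ?thesis
        using edvd_minus_eq[of "klcm xs \<sigma>" a b] by (auto simp: strand_def z_def lookup_single when_def)
    qed (simp add: strand_def z_def)
  qed
  have z: "z \<in> kchains xs j 0 p"
  proof (rule kchains_coeffI)
    fix b \<sigma> assume "kstrand xs z b \<sigma> \<noteq> 0"
    then have "b = a" "g \<sigma> \<noteq> 0" unfolding strand_z by (simp_all split: if_splits)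
    then show "\<sigma> \<subseteq> {..<length xs} \<and> card \<sigma> = p \<and> keys b \<subseteq> V \<and> mdeg b = j"
      using g a set_xs by (auto simp: koszul_complex_def)
  qed
  have "z \<sigma> \<in> mideal M" for \<sigma>
    using g by (cases "g \<sigma> = 0") (auto simp: z_def mideal_def koszul_complex_def)
  moreover have "kdiff xs z = 0"
    by (rule strand_inject[of "ku xs" "length xs"]) (simp add: strand_tdiff strand_z bdg)
  ultimately obtain w where w: "w \<in> kchains xs j 0 (Suc p)" "\<forall>\<sigma>. w \<sigma> \<in> mideal M" "kdiff xs w = z"
    using assms z unfolding ideal_exact_def by blast
  show "\<exists>h. (\<forall>\<sigma>. h \<sigma> \<noteq> 0 \<longrightarrow> \<sigma> \<in> koszul_complex xs M a \<and> card \<sigma> = Suc p) \<and> bd (length xs) h = g"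
  proof (intro exI conjI allI impI)
    show "bd (length xs) (kstrand xs w a) = g"
      using strand_z[of a] by (simp add: w(3) flip: strand_tdiff)
    fix \<sigma> assume h: "kstrand xs w a \<sigma> \<noteq> 0"
    note k = kchains_coeffD[OF w(1) h]
    have "a - klcm xs \<sigma> \<in> keys (w \<sigma>)"
      using h by (auto simp: strand_def in_keys_iff split: if_splits)
    then show "\<sigma> \<in> koszul_complex xs M a" "card \<sigma> = Suc p"
      using k w(2) by (auto simp: koszul_complex_def mideal_def)
  qed
qed

text \<open>The strands of z are bounded one by one and the solutions reassembled, which is possible
  because only finitely many multidegrees occur in z.\<close>

lemma koszul_acyclic_imp_ideal_exact:
  assumes "koszul_acyclic TYPE('k) xs M p j"
  shows "ideal_exact p"
  unfolding ideal_exact_def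
proof (intro ballI impI)
  fix z :: "nat set \<Rightarrow> ('x, 'k) mpoly"
  assume z: "z \<in> kchains xs j 0 p" "\<forall>\<sigma>. z \<sigma> \<in> mideal M" "kdiff xs z = 0"
  let ?P = "\<lambda>a h. (\<forall>\<sigma>. h \<sigma> \<noteq> 0 \<longrightarrow> \<sigma> \<in> koszul_complex xs M a \<and> card \<sigma> = Suc p) \<and>
    bd (length xs) h = kstrand xs z a"
  have "\<exists>h. ?P a h" if nz: "kstrand xs z a \<noteq> 0" for a
  proof -
    obtain \<sigma>0 where "kstrand xs z a \<sigma>0 \<noteq> 0" using nz by (auto simp: fun_eq_iff)
    note k0 = kchains_coeffD[OF z(1) this]
    have ac: "acyclic_at TYPE('k) (length xs) (koszul_complex xs M a) p"
      using assms k0 set_xs unfolding koszul_acyclic_def by blast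
    have "\<sigma> \<in> koszul_complex xs M a \<and> card \<sigma> = p" if h: "kstrand xs z a \<sigma> \<noteq> 0" for \<sigma>
    proof -
      note k = kchains_coeffD[OF z(1) h]
      have "a - klcm xs \<sigma> \<in> keys (z \<sigma>)"
        using h by (auto simp: strand_def in_keys_iff split: if_splits)
      then show ?thesis using k z(2) by (auto simp: koszul_complex_def mideal_def)
    qed
    moreover have "bd (length xs) (kstrand xs z a) = 0"
      using z(3) by (simp flip: strand_tdiff)
    ultimately show ?thesis using ac unfolding acyclic_at_def by blast
  qed
  then obtain H where H: "\<And>a. kstrand xs z a \<noteq> 0 \<Longrightarrow> ?P a (H a)" by metis
  \<comment> \<open>Solutions for zero strands are set to zero, so that the set A of multidegrees to
    be summed over is finite.\<close>
  define h where "h = (\<lambda>a. if kstrand xs z a = 0 then 0 else H a)"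
  have hP: "?P a (h a)" for a
    using H[of a] by (cases "kstrand xs z a = 0") (auto simp: h_def)
  define A where "A = {a. h a \<noteq> 0}"
  have "A \<subseteq> (\<Union>\<sigma>\<in>Pow {..<length xs}. (\<lambda>m. m + klcm xs \<sigma>) ` keys (z \<sigma>))"
  proof
    fix a assume "a \<in> A"
    then have "kstrand xs z a \<noteq> 0" by (auto simp: A_def h_def)
    then obtain \<sigma> where \<sigma>: "kstrand xs z a \<sigma> \<noteq> 0" by (auto simp: fun_eq_iff)
    note k = kchains_coeffD[OF z(1) \<sigma>]
    have "a - klcm xs \<sigma> \<in> keys (z \<sigma>)"
      using \<sigma> by (auto simp: strand_def in_keys_iff split: if_splits)
    moreover have "a = (a - klcm xs \<sigma>) + klcm xs \<sigma>" using k(5) by (simp add: edvd_minus_add)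
    ultimately show "a \<in> (\<Union>\<sigma>\<in>Pow {..<length xs}. (\<lambda>m. m + klcm xs \<sigma>) ` keys (z \<sigma>))"
      using k(1) by blast
  qed
  then have finA: "finite A" by (rule finite_subset) auto
  have AV: "keys a \<subseteq> V" "mdeg a = j" if "a \<in> A" for a
  proof -
    have "kstrand xs z a \<noteq> 0" using that by (auto simp: A_def h_def)
    then obtain \<sigma> where \<sigma>: "kstrand xs z a \<sigma> \<noteq> 0" by (auto simp: fun_eq_iff)
    from kchains_coeffD[OF z(1) this] show "keys a \<subseteq> V" "mdeg a = j" by simp_all
  qed
  define w :: "nat set \<Rightarrow> ('x, 'k) mpoly"
    where "w = (\<lambda>\<sigma>. \<Sum>a\<in>A. single (a - klcm xs \<sigma>) (h a \<sigma>))"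
  have strand_w: "kstrand xs w b = h b" for b
  proof
    fix \<sigma>
    have div: "edvd (klcm xs \<sigma>) a" if "h a \<sigma> \<noteq> 0" for a
      using hP[of a] that by (auto simp: koszul_complex_def)
    show "kstrand xs w b \<sigma> = h b \<sigma>"
    proof (cases "edvd (klcm xs \<sigma>) b")
      case True
      have "kstrand xs w b \<sigma> = (\<Sum>a\<in>A. if a - klcm xs \<sigma> = b - klcm xs \<sigma> then h a \<sigma> else 0)"
        using True by (simp add: strand_def w_def lookup_sum lookup_single when_def)
      also have "\<dots> = (\<Sum>a\<in>A. if a = b then h a \<sigma> else 0)"
        by (rule sum.cong) (use div edvd_minus_eq[OF _ True] in auto)
      also have "\<dots> = h b \<sigma>" using finA by (auto simp: A_def)
      finally show ?thesis .
    next
      case False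
      then show ?thesis using div by (auto simp: strand_def)
    qed
  qed
  show "\<exists>w \<in> kchains xs j 0 (Suc p). (\<forall>\<sigma>. w \<sigma> \<in> mideal M) \<and> kdiff xs w = z"
  proof (intro bexI conjI allI)
    show "kdiff xs w = z"
      by (rule strand_inject[of "ku xs" "length xs"]) (use hP in \<open>simp add: strand_tdiff strand_w\<close>)
    show "w \<sigma> \<in> mideal M" for \<sigma>
      unfolding mideal_def
    proof (intro CollectI subsetI)
      fix m assume "m \<in> keys (w \<sigma>)"
      then have "h (m + klcm xs \<sigma>) \<sigma> \<noteq> 0"
        by (simp add: in_keys_iff lookup_eq_strand[of w _ _ "ku xs" "length xs"] strand_w)
      then show "m \<in> M" using hP[of "m + klcm xs \<sigma>"] by (auto simp: koszul_complex_def)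
    qed
    show "w \<in> kchains xs j 0 (Suc p)"
    proof (rule kchains_coeffI)
      fix a \<sigma> assume "kstrand xs w a \<sigma> \<noteq> 0"
      then have "h a \<sigma> \<noteq> 0" by (simp add: strand_w)
      moreover from this have "a \<in> A" by (auto simp: A_def)
      ultimately show "\<sigma> \<subseteq> {..<length xs} \<and> card \<sigma> = Suc p \<and> keys a \<subseteq> V \<and> mdeg a = j"
        using hP[of a] AV by (auto simp: koszul_complex_def)
    qed
  qed
qed

text \<open>The exception is genuine: for p = 0 and L the whole ring, the constant 1 on the empty
  face is a cycle over L of degree 0 that bounds nothing, although Tor vanishes there.\<close>

lemma tensor_exact_iff_koszul_acyclic:
  "tensor_exact F (Suc p) j \<longleftrightarrow> j = 0 \<or> koszul_acyclic TYPE('k) xs M p j"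
proof -
  have "tensor_exact F (Suc p) j \<longleftrightarrow> quotient_exact p"
    using dc.balance h_exact_iff_tensor_exact v_exact_iff_quotient_exact by blast
  then show ?thesis
    using quotient_exact_degree_0 quotient_exact_iff_ideal_exact
      ideal_exact_imp_koszul_acyclic koszul_acyclic_imp_ideal_exact by blast
qed

end

section \<open>Dickson's lemma and the Taylor resolution\<close>

text \<open>Induction on the variables: forget the exponent of x and take a finite B whose
  projections lie below all projections. B serves all vectors with large x-exponent; each of the
  finitely many smaller x-exponents gives a slice with a finite set of its own.\<close>

lemma dickson:
  assumes "finite V" "\<And>a. a \<in> A \<Longrightarrow> keys a \<subseteq> V"
  shows "\<exists>B\<subseteq>A. finite B \<and> (\<forall>a\<in>A. \<exists>b\<in>B. edvd b a)"
  using assms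
proof (induction V arbitrary: A rule: finite_induct)
  case empty
  then have "A \<subseteq> {0}" by auto
  then have "finite A" by (rule finite_subset) simp
  then show ?case using edvd_refl by blast
next
  case (insert x V)
  define drop where "drop a = a - single x (lookup a x)" for a :: "'a \<Rightarrow>\<^sub>0 nat"
  have lookup_drop: "lookup (drop a) y = (if y = x then 0 else lookup a y)" for a y
    by (simp add: drop_def lookup_minus lookup_single when_def)
  have edvdI: "edvd b a" if "edvd (drop b) (drop a)" "lookup b x \<le> lookup a x" for a b
    unfolding edvd_def
  proof
    fix y
    show "lookup b y \<le> lookup a y"
      using that spec[OF that(1)[unfolded edvd_def lookup_drop], of y] by (cases "y = x") auto
  qed
  have project: "\<exists>B\<subseteq>A'. finite B \<and> (\<forall>a\<in>A'. \<exists>b\<in>B. edvd (drop b) (drop a))" if A': "A' \<subseteq> A" for A'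
  proof -
    have "\<exists>B\<subseteq>drop ` A'. finite B \<and> (\<forall>a\<in>drop ` A'. \<exists>b\<in>B. edvd b a)"
    proof (rule insert.IH)
      fix a' assume "a' \<in> drop ` A'"
      then obtain a where "a \<in> A" "a' = drop a" using A' by blast
      then have "keys a' = keys a - {x}"
        by (auto simp: in_keys_iff lookup_drop split: if_splits)
      then show "keys a' \<subseteq> V" using insert.prems[OF \<open>a \<in> A\<close>] by blast
    qed
    then obtain B where B: "B \<subseteq> drop ` A'" "finite B" "\<forall>a\<in>drop ` A'. \<exists>b\<in>B. edvd b a" by blast
    obtain B' where "B' \<subseteq> A'" "finite B'" "B = drop ` B'" using finite_subset_image[OF B(2,1)] by blast
    moreover have "\<forall>a\<in>A'. \<exists>b\<in>B'. edvd (drop b) (drop a)"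
      using B(3) unfolding \<open>B = drop ` B'\<close> by simp
    ultimately show ?thesis by blast
  qed
  obtain B where B: "B \<subseteq> A" "finite B" "\<forall>a\<in>A. \<exists>b\<in>B. edvd (drop b) (drop a)"
    using project[of A] by blast
  \<comment> \<open>An upper bound for the x-exponents in B; as a sum it also makes sense for empty
    B.\<close>
  define N where "N = (\<Sum>b\<in>B. lookup b x)"
  have N: "lookup b x \<le> N" if "b \<in> B" for b
    unfolding N_def by (rule member_le_sum) (use that B(2) in auto)
  define S where "S c = {a \<in> A. lookup a x = c}" for c
  have "\<forall>c. \<exists>B. B \<subseteq> S c \<and> finite B \<and> (\<forall>a\<in>S c. \<exists>b\<in>B. edvd (drop b) (drop a))"
    by (intro allI project) (auto simp: S_def)
  from choice[OF this] obtain D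
    where D: "\<forall>c. D c \<subseteq> S c \<and> finite (D c) \<and> (\<forall>a\<in>S c. \<exists>b\<in>D c. edvd (drop b) (drop a))" ..
  have D1: "D c \<subseteq> S c" and D2: "finite (D c)" for c using D by simp_all
  have D3: "\<exists>b\<in>D c. edvd (drop b) (drop a)" if "a \<in> S c" for a c using D that by simp
  have "\<exists>b\<in>B \<union> (\<Union>c<N. D c). edvd b a" if a: "a \<in> A" for a
  proof (cases "lookup a x < N")
    case True
    have "a \<in> S (lookup a x)" using a by (simp add: S_def)
    from D3[OF this] obtain b where b: "b \<in> D (lookup a x)" "edvd (drop b) (drop a)" ..
    have "lookup b x = lookup a x" using subsetD[OF D1 b(1)] by (simp add: S_def)
    then have "edvd b a" using edvdI[OF b(2)] by simp
    moreover have "b \<in> B \<union> (\<Union>c<N. D c)" using b(1) True by blast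
    ultimately show ?thesis ..
  next
    case False
    obtain b where b: "b \<in> B" "edvd (drop b) (drop a)" using B(3) a by blast
    have "edvd b a" using edvdI[OF b(2)] N[OF b(1)] False by simp
    moreover have "b \<in> B \<union> (\<Union>c<N. D c)" using b(1) by simp
    ultimately show ?thesis ..
  qed
  moreover have "D c \<subseteq> A" for c using D1[of c] by (auto simp: S_def)
  then have "B \<union> (\<Union>c<N. D c) \<subseteq> A" using B(1) by (intro Un_least UN_least)
  moreover have "finite (B \<union> (\<Union>c<N. D c))" using B(2) D2 by simp
  ultimately show ?case by (intro exI[of _ "B \<union> (\<Union>c<N. D c)"] conjI ballI)
qed

lemma edvd_add_minus_right:
  assumes "edvd l a"
  shows "edvd m (m + a - l)"
  unfolding edvd_def lookup_add lookup_minus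
proof
  fix x
  show "lookup m x \<le> lookup m x + lookup a x - lookup l x"
    using spec[OF assms[unfolded edvd_def], of x] by simp
qed

definition generated :: "'x set \<Rightarrow> (nat \<Rightarrow> 'x expo) \<Rightarrow> nat \<Rightarrow> 'x expo set"
  where "generated V u r = {m. keys m \<subseteq> V \<and> (\<exists>s<r. edvd (u s) m)}"

lemma finite_imp_generated:
  assumes "finite B"
  obtains u and r :: nat where "u ` {..<r} = B"
  using assms by (metis atLeast0LessThan bij_betw_imp_surj_on ex_bij_betw_nat_finite)

lemma upset_generated:
  assumes "finite V" "upset V M"
  obtains u r where "M = generated V u r" "\<And>s. s < r \<Longrightarrow> keys (u s) \<subseteq> V"
proof -
  obtain B where B: "B \<subseteq> M" "finite B" "\<forall>a\<in>M. \<exists>b\<in>B. edvd b a"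
    using dickson[OF assms(1), of M] assms(2) unfolding upset_def by blast
  obtain u and r :: nat where u: "u ` {..<r} = B" using finite_imp_generated[OF B(2)] .
  have keys: "keys m \<subseteq> V" if "m \<in> M" for m
    using assms(2) that unfolding upset_def by blast
  have "m \<in> M" if "b \<in> M" "edvd b m" "keys m \<subseteq> V" for b m
  proof -
    have "keys (m - b) \<subseteq> V"
      using that(3) by (auto simp: in_keys_iff lookup_minus)
    then have "b + (m - b) \<in> M" using assms(2) that(1) unfolding upset_def by blast
    then show ?thesis using edvd_add_minus[OF that(2)] by simp
  qed
  then have "M = generated V u r"
    using B(1,3) keys unfolding generated_def u[symmetric] by (auto; blast)
  moreover have "keys (u s) \<subseteq> V" if "s < r" for s
    using keys B(1) u that by blast
  ultimately show ?thesis using that by blast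
qed

lemma upset_generated_upset:
  "upset V (generated V u r)"
  unfolding upset_def generated_def by (auto simp: keys_add_exp intro: edvd_trans[OF _ edvd_add(1)])

text \<open>Subsets of the generators are encoded as natural numbers.\<close>

definition taylor :: "(nat \<Rightarrow> 'x expo) \<Rightarrow> nat \<Rightarrow> ('x, 'k::field) resolution"
  where "taylor u r = \<lparr>res_basis = (\<lambda>i. set_encode ` {\<sigma>. \<sigma> \<subseteq> {..<r} \<and> card \<sigma> = i}),
    res_degree = (\<lambda>i b. mdeg (elcm u r (set_decode b))),
    res_diff = (\<lambda>i b. \<Sum>s\<in>set_decode b. single (set_encode (set_decode b - {s}))
      (single (elcm u r (set_decode b) - elcm u r (set_decode b - {s})) (ksign s (set_decode b - {s})))),
    res_aug = (\<lambda>b. 1)\<rparr>"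

text \<open>Decodes a vector into a function on subsets, the form in which \<open>tdiff\<close> and
  \<open>thom\<close> are available.\<close>

definition face_coeff :: "nat \<Rightarrow> (nat \<Rightarrow>\<^sub>0 'c::zero) \<Rightarrow> nat set \<Rightarrow> 'c"
  where "face_coeff r v \<sigma> = (if \<sigma> \<subseteq> {..<r} then lookup v (set_encode \<sigma>) else 0)"

lemma face_coeff_inject:
  assumes "keys v \<subseteq> set_encode ` Pow {..<r}" "keys w \<subseteq> set_encode ` Pow {..<r}"
    and "face_coeff r v = face_coeff r w"
  shows "v = w"
proof (rule poly_mapping_eqI)
  fix b
  show "lookup v b = lookup w b"
  proof (cases "b \<in> set_encode ` Pow {..<r}")
    case True
    then obtain \<sigma> where "\<sigma> \<subseteq> {..<r}" "b = set_encode \<sigma>" by blast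
    then show ?thesis using fun_cong[OF assms(3), of \<sigma>] by (simp add: face_coeff_def)
  next
    case False
    then show ?thesis using assms(1,2) by (metis in_keys_iff subset_iff)
  qed
qed

lemma lookup_taylor_diff:
  assumes "finite \<sigma>" "finite \<tau>"
  shows "lookup (res_diff (taylor u r :: ('x, 'k::field) resolution) i (set_encode \<sigma>)) (set_encode \<tau>) =
    (\<Sum>s\<in>\<sigma>. if \<sigma> - {s} = \<tau> then single (elcm u r \<sigma> - elcm u r \<tau>) (ksign s \<tau>) else 0)"
  using assms by (auto simp: taylor_def lookup_sum lookup_single when_def set_encode_eq intro!: sum.cong)

text \<open>Entry \<tau> of the image receives contributions only from
  \<open>insert s \<tau>\<close> with s outside \<tau>; exchanging the two sums brings this into the
  form of \<open>tdiff\<close>.\<close>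

lemma face_coeff_taylor_diff:
  fixes v :: "nat \<Rightarrow>\<^sub>0 ('x, 'k::field) mpoly"
  assumes "keys v \<subseteq> set_encode ` Pow {..<r}"
  shows "face_coeff r (lin_ext (res_diff (taylor u r) i) v) = tdiff u r (face_coeff r v)"
proof
  fix \<tau>
  let ?m = "\<lambda>s \<sigma>. single (elcm u r \<sigma> - elcm u r \<tau>) (ksign s \<tau>) * lookup v (set_encode \<sigma>)"
  show "face_coeff r (lin_ext (res_diff (taylor u r) i) v) \<tau> = tdiff u r (face_coeff r v) \<tau>"
  proof (cases "\<tau> \<subseteq> {..<r}")
    case False
    then show ?thesis by (simp add: face_coeff_def tdiff_def)
  next
    case True
    then have fin: "finite \<tau>" using finite_subset by blast
    have fin': "finite \<sigma>" if "\<sigma> \<subseteq> {..<r}" for \<sigma> using that finite_subset by blast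
    have inj: "inj_on set_encode (Pow {..<r})"
      using inj_on_set_encode by (rule inj_on_subset) (use fin' in auto)
    have "face_coeff r (lin_ext (res_diff (taylor u r) i) v) \<tau> =
      (\<Sum>\<sigma>\<in>Pow {..<r}. lookup v (set_encode \<sigma>) *
        lookup (res_diff (taylor u r) i (set_encode \<sigma>)) (set_encode \<tau>))"
      using True by (simp add: face_coeff_def lookup_lin_ext[OF _ assms] sum.reindex[OF inj])
    also have "\<dots> = (\<Sum>\<sigma>\<in>Pow {..<r}. \<Sum>s<r. if s \<in> \<sigma> \<and> \<sigma> - {s} = \<tau> then ?m s \<sigma> else 0)"
    proof (rule sum.cong)
      fix \<sigma> assume "\<sigma> \<in> Pow {..<r}"
      then have \<sigma>: "\<sigma> \<subseteq> {..<r}" by simp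
      have "lookup v (set_encode \<sigma>) *
          lookup (res_diff (taylor u r) i (set_encode \<sigma>)) (set_encode \<tau>) =
        (\<Sum>s\<in>\<sigma>. if s \<in> \<sigma> \<and> \<sigma> - {s} = \<tau> then ?m s \<sigma> else 0)"
        unfolding lookup_taylor_diff[OF fin'[OF \<sigma>] fin] sum_distrib_left
        by (rule sum.cong) auto
      also have "\<dots> = (\<Sum>s<r. if s \<in> \<sigma> \<and> \<sigma> - {s} = \<tau> then ?m s \<sigma> else 0)"
        using \<sigma> by (intro sum.mono_neutral_left) auto
      finally show "lookup v (set_encode \<sigma>) *
          lookup (res_diff (taylor u r) i (set_encode \<sigma>)) (set_encode \<tau>) =
        (\<Sum>s<r. if s \<in> \<sigma> \<and> \<sigma> - {s} = \<tau> then ?m s \<sigma> else 0)" .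
    qed simp
    also have "\<dots> = (\<Sum>s<r. \<Sum>\<sigma>\<in>Pow {..<r}. if s \<in> \<sigma> \<and> \<sigma> - {s} = \<tau> then ?m s \<sigma> else 0)"
      by (rule sum.swap)
    also have "\<dots> = (\<Sum>s<r. if s \<in> \<tau> then 0 else ?m s (insert s \<tau>))"
    proof (rule sum.cong)
      fix s assume s: "s \<in> {..<r}"
      have "(\<Sum>\<sigma>\<in>Pow {..<r}. if s \<in> \<sigma> \<and> \<sigma> - {s} = \<tau> then ?m s \<sigma> else 0) =
        (\<Sum>\<sigma>\<in>Pow {..<r}. if \<sigma> = insert s \<tau> then (if s \<in> \<tau> then 0 else ?m s (insert s \<tau>)) else 0)"
        by (rule sum.cong) auto
      also have "\<dots> = (if s \<in> \<tau> then 0 else ?m s (insert s \<tau>))"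
        using s True by simp
      finally show "(\<Sum>\<sigma>\<in>Pow {..<r}. if s \<in> \<sigma> \<and> \<sigma> - {s} = \<tau> then ?m s \<sigma> else 0) =
        (if s \<in> \<tau> then 0 else ?m s (insert s \<tau>))" .
    qed simp
    also have "\<dots> = (\<Sum>s\<in>{..<r} - \<tau>. ?m s (insert s \<tau>))"
      by (rule sum.mono_neutral_cong_right) auto
    also have "\<dots> = tdiff u r (face_coeff r v) \<tau>"
      unfolding tdiff_def using True by (intro sum.cong) (auto simp: face_coeff_def)
    finally show ?thesis .
  qed
qed

lemma taylor_diff_coeff:
  assumes "finite \<sigma>"
    and "lookup (lookup
      (res_diff (taylor u r :: ('x, 'k::field) resolution) i (set_encode \<sigma>)) b) m \<noteq> 0"
  obtains s where "s \<in> \<sigma>" "b = set_encode (\<sigma> - {s})" "m = elcm u r \<sigma> - elcm u r (\<sigma> - {s})"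
proof -
  have "(\<Sum>s\<in>\<sigma>. lookup (lookup (single (set_encode (\<sigma> - {s}))
      (single (elcm u r \<sigma> - elcm u r (\<sigma> - {s})) (ksign s (\<sigma> - {s}) :: 'k))) b) m) \<noteq> 0"
    using assms by (simp add: taylor_def lookup_sum)
  then obtain s where "s \<in> \<sigma>" "lookup (lookup (single (set_encode (\<sigma> - {s}))
      (single (elcm u r \<sigma> - elcm u r (\<sigma> - {s})) (ksign s (\<sigma> - {s}) :: 'k))) b) m \<noteq> 0"
    by (rule sum.not_neutral_contains_not_neutral)
  then show ?thesis using that[of s] by (auto simp: lookup_single when_def split: if_splits)
qed

context
  fixes V :: "'x set" and u :: "nat \<Rightarrow> 'x expo" and r :: nat and K :: "'k::field itself"
  assumes keys_u: "\<And>s. s < r \<Longrightarrow> keys (u s) \<subseteq> V"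
begin

private abbreviation "TR \<equiv> (taylor u r :: ('x, 'k) resolution)"

lemma taylor_basis: "res_basis TR i = set_encode ` {\<sigma>. \<sigma> \<subseteq> {..<r} \<and> card \<sigma> = i}"
  by (simp add: taylor_def)

lemma taylor_diff_component:
  assumes "b \<in> res_basis TR (Suc i)"
  shows "res_diff TR (Suc i) b \<in> free_module_component V (res_basis TR i) (res_degree TR i) (res_degree TR (Suc i) b)"
  unfolding free_module_component_fsup fsup_def
proof (intro CollectI allI impI)
  fix c m assume nz: "lookup (lookup (res_diff TR (Suc i) b) c) m \<noteq> 0"
  obtain \<sigma> where \<sigma>: "\<sigma> \<subseteq> {..<r}" "card \<sigma> = Suc i" "b = set_encode \<sigma>"
    using assms unfolding taylor_basis by blast
  have fin: "finite \<sigma>" using \<sigma>(1) finite_subset by blast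
  obtain s where s: "s \<in> \<sigma>" "c = set_encode (\<sigma> - {s})" "m = elcm u r \<sigma> - elcm u r (\<sigma> - {s})"
    using taylor_diff_coeff[OF fin nz[unfolded \<sigma>(3)]] .
  have "keys m \<subseteq> keys (elcm u r \<sigma>)"
    unfolding s(3) by (auto simp: in_keys_iff lookup_minus)
  also have "\<dots> \<subseteq> V" using keys_elcm[of u r \<sigma>] keys_u by blast
  finally have "keys m \<subseteq> V" .
  moreover have "c \<in> res_basis TR i"
    unfolding taylor_basis s(2) using \<sigma> s(1) fin by (intro imageI) auto
  moreover have "mdeg m + mdeg (elcm u r (\<sigma> - {s})) = mdeg (elcm u r \<sigma>)"
    unfolding s(3) by (simp flip: mdeg_add add: edvd_minus_add edvd_elcm_mono)
  ultimately show "c \<in> res_basis TR i \<and> keys m \<subseteq> V \<and> mdeg m + res_degree TR i c = res_degree TR (Suc i) b"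
    using fin by (simp add: taylor_def s(2) \<sigma>(3))
qed

lemma free_module_taylor_keys:
  "v \<in> free_module V (res_basis TR i) \<Longrightarrow> keys v \<subseteq> set_encode ` Pow {..<r}"
  unfolding free_module_def taylor_basis by blast

lemma lin_ext_taylor_diff:
  assumes "v \<in> free_module V (res_basis TR (Suc i))"
  shows "lin_ext (res_diff TR (Suc i)) v \<in> free_module V (res_basis TR i)"
  unfolding free_module_fsup
proof (rule fsup_lin_ext)
  show "v \<in> fsup (\<lambda>b m. b \<in> res_basis TR (Suc i) \<and> keys m \<subseteq> V)"
    using assms unfolding free_module_fsup .
  fix b c and m m' :: "'x expo"
  assume "b \<in> res_basis TR (Suc i) \<and> keys m \<subseteq> V"
    and "lookup (lookup (res_diff TR (Suc i) b) c) m' \<noteq> 0"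
  then show "c \<in> res_basis TR i \<and> keys (m + m') \<subseteq> V"
    using taylor_diff_component[of b i] unfolding free_module_component_fsup fsup_def keys_add_exp by blast
qed

lemma face_coeff_support:
  assumes "v \<in> free_module V (res_basis TR i)" "lookup (face_coeff r v \<sigma>) m \<noteq> 0"
  shows "\<sigma> \<subseteq> {..<r}" "card \<sigma> = i" "keys m \<subseteq> V"
proof -
  show \<sigma>: "\<sigma> \<subseteq> {..<r}" using assms(2) by (auto simp: face_coeff_def split: if_splits)
  then have "lookup (lookup v (set_encode \<sigma>)) m \<noteq> 0"
    using assms(2) by (simp add: face_coeff_def)
  then have *: "set_encode \<sigma> \<in> res_basis TR i \<and> keys m \<subseteq> V"
    using assms(1) unfolding free_module_fsup fsup_def by blast
  then show "keys m \<subseteq> V" by blast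
  obtain \<sigma>' where \<sigma>': "set_encode \<sigma> = set_encode \<sigma>'" "\<sigma>' \<subseteq> {..<r}" "card \<sigma>' = i"
    using * unfolding taylor_basis by blast
  have "\<sigma> = \<sigma>'"
    using \<sigma>' \<sigma> finite_subset[OF _ finite_lessThan[of r]] by (simp add: set_encode_eq)
  then show "card \<sigma> = i" using \<sigma>' by simp
qed

text \<open>The contraction \<open>thom\<close> supplies the preimage. For i > 0 the faces are
  nonempty, so a generator divides every multidegree that occurs; at i = 0 this has to be assumed,
  as \<open>zero\<close> does.\<close>

lemma taylor_exact:
  assumes v: "v \<in> free_module V (res_basis TR i)"
    and tdiff: "tdiff u r (face_coeff r v) = 0"
    and zero: "\<And>a. i = 0 \<Longrightarrow> lookup (face_coeff r v {}) a \<noteq> 0 \<Longrightarrow> \<exists>s<r. edvd (u s) a"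
  shows "v \<in> lin_ext (res_diff TR (Suc i)) ` free_module V (res_basis TR (Suc i))"
proof -
  let ?f = "face_coeff r v"
  have thom: "tdiff u r (thom u r ?f) = ?f"
  proof (rule tdiff_thom[OF tdiff])
    fix a assume a: "\<not> (\<exists>s<r. edvd (u s) a)"
    show "strand u r ?f a = 0"
    proof (rule ccontr)
      assume "strand u r ?f a \<noteq> 0"
      then obtain \<sigma> where "strand u r ?f a \<sigma> \<noteq> 0" by (auto simp: fun_eq_iff)
      then have e: "edvd (elcm u r \<sigma>) a" and l: "lookup (?f \<sigma>) (a - elcm u r \<sigma>) \<noteq> 0"
        by (auto simp: strand_def split: if_splits)
      note k = face_coeff_support[OF v l]
      have "\<sigma> = {}" using e a k(1) unfolding edvd_elcm_iff by auto
      then show False using zero[of a] k(2) l a by auto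
    qed
  qed
  have supp: "\<sigma> \<subseteq> {..<r} \<and> card \<sigma> = Suc i \<and> keys m \<subseteq> V"
    if "lookup (thom u r ?f \<sigma>) m \<noteq> 0" for \<sigma> m
  proof -
    note nz = that
    obtain s where s: "s < r" "s \<in> \<sigma>"
      "lookup (?f (\<sigma> - {s})) (m + elcm u r \<sigma> - elcm u r (\<sigma> - {s})) \<noteq> 0"
      using thom_coeff[OF nz] .
    note k = face_coeff_support[OF v s(3)]
    have "finite \<sigma>" using k(1) finite_subset[of "\<sigma> - {s}" "{..<r}"] by simp
    then have "card \<sigma> = Suc i" using k(2) s(2) by (metis card_Suc_Diff1)
    \<comment> \<open>So m divides a monomial occurring in v, and involves only variables in
      V.\<close>
    moreover have "edvd m (m + elcm u r \<sigma> - elcm u r (\<sigma> - {s}))"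
      by (rule edvd_add_minus_right, rule edvd_elcm_mono) auto
    ultimately show ?thesis using k s(1) edvd_keys by blast
  qed
  define w where "w = (\<Sum>\<sigma>\<in>Pow {..<r}. single (set_encode \<sigma>) (thom u r ?f \<sigma>))"
  have lookup_w: "lookup w (set_encode \<sigma>) = thom u r ?f \<sigma>" if "\<sigma> \<subseteq> {..<r}" for \<sigma>
  proof -
    have fin: "finite \<rho>" if "\<rho> \<subseteq> {..<r}" for \<rho> using that finite_subset by blast
    have "lookup w (set_encode \<sigma>) = (\<Sum>\<rho>\<in>Pow {..<r}. if \<rho> = \<sigma> then thom u r ?f \<rho> else 0)"
      unfolding w_def lookup_sum lookup_single
      by (rule sum.cong) (use that fin in \<open>auto simp: when_def set_encode_eq\<close>)
    then show ?thesis using that by simp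
  qed
  have keys_w: "b \<in> set_encode ` Pow {..<r}" if nz: "lookup w b \<noteq> 0" for b
  proof (rule ccontr)
    assume "b \<notin> set_encode ` Pow {..<r}"
    then have "lookup w b = 0"
      unfolding w_def lookup_sum lookup_single by (intro sum.neutral) (auto simp: when_def)
    with nz show False by simp
  qed
  have fw: "face_coeff r w = thom u r ?f"
  proof
    fix \<sigma>
    have "thom u r ?f \<sigma> = 0" if "\<not> \<sigma> \<subseteq> {..<r}"
      by (rule poly_mapping_eqI) (use supp that in auto)
    then show "face_coeff r w \<sigma> = thom u r ?f \<sigma>" using lookup_w by (simp add: face_coeff_def)
  qed
  have w: "w \<in> free_module V (res_basis TR (Suc i))"
    unfolding free_module_fsup fsup_def
  proof (intro CollectI allI impI)
    fix b m assume nz: "lookup (lookup w b) m \<noteq> 0"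
    then have "lookup w b \<noteq> 0" by auto
    then obtain \<sigma> where \<sigma>: "\<sigma> \<subseteq> {..<r}" "b = set_encode \<sigma>" using keys_w by blast
    then have "lookup (thom u r ?f \<sigma>) m \<noteq> 0" using nz lookup_w by simp
    from supp[OF this] show "b \<in> res_basis TR (Suc i) \<and> keys m \<subseteq> V"
      unfolding taylor_basis \<sigma>(2) by blast
  qed
  have "lin_ext (res_diff TR (Suc i)) w = v"
    using free_module_taylor_keys[OF lin_ext_taylor_diff[OF w]] free_module_taylor_keys[OF v]
    by (rule face_coeff_inject) (simp add: face_coeff_taylor_diff[OF free_module_taylor_keys[OF w]] fw thom)
  then show ?thesis using w by blast
qed

lemma augmentation_taylor:
  assumes "v \<in> free_module V (res_basis TR 0)"
  shows "augmentation TR v = face_coeff r v {}"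
proof -
  have "keys v \<subseteq> {0}"
  proof
    fix b assume "b \<in> keys v"
    then obtain \<sigma> where "b = set_encode \<sigma>" "\<sigma> \<subseteq> {..<r}" "card \<sigma> = 0"
      using assms unfolding free_module_def taylor_basis by blast
    moreover from this have "\<sigma> = {}" using finite_subset by fastforce
    ultimately show "b \<in> {0}" by simp
  qed
  then have "augmentation TR v = (\<Sum>b\<in>{0}. lookup v b * res_aug TR b)"
    unfolding augmentation_def by (intro sum.mono_neutral_left) (auto simp: in_keys_iff)
  then show ?thesis by (simp add: taylor_def face_coeff_def)
qed

text \<open>Together with \<open>upset_generated\<close> this provides a resolution for every
  monomial ideal in finitely many variables, so the choice in \<open>Tor\<close> is never
  void.\<close>

lemma taylor_resolution:
  "graded_free_resolution V (mideal (generated V u r)) TR"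
  unfolding graded_free_resolution_def
proof (intro conjI ballI allI impI)
  fix b assume "b \<in> res_basis TR 0"
  then obtain \<sigma> where "b = set_encode \<sigma>" "\<sigma> \<subseteq> {..<r}" "card \<sigma> = 0" unfolding taylor_basis by blast
  moreover from this have "\<sigma> = {}" using finite_subset by fastforce
  ultimately have "b = 0" by simp
  then show "res_aug TR b \<in> carrier (poly_ring V)"
    by (simp add: taylor_def poly_ring_def)
  fix m assume "m \<in> keys (res_aug TR b)"
  then show "mdeg m = res_degree TR 0 b" using \<open>b = 0\<close> by (simp add: taylor_def)
next
  fix i b assume "b \<in> res_basis TR (Suc i)"
  then show "res_diff TR (Suc i) b \<in> free_module_component V (res_basis TR i) (res_degree TR i) (res_degree TR (Suc i) b)"
    by (rule taylor_diff_component)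
next
  fix p :: "('x, 'k) mpoly" assume p: "p \<in> carrier (poly_ring V)"
  let ?v = "single 0 p :: nat \<Rightarrow>\<^sub>0 ('x, 'k) mpoly"
  have "{} \<in> {\<sigma>. \<sigma> \<subseteq> {..<r} \<and> card \<sigma> = 0}" by simp
  then have "set_encode {} \<in> res_basis TR 0" unfolding taylor_basis by (rule imageI)
  then have 0: "0 \<in> res_basis TR 0" by simp
  have v: "?v \<in> free_module V (res_basis TR 0)"
    unfolding free_module_fsup fsup_def
  proof (intro CollectI allI impI)
    fix b m assume nz: "lookup (lookup ?v b) m \<noteq> 0"
    then have "b = 0" "m \<in> keys p"
      by (auto simp: lookup_single when_def in_keys_iff split: if_splits)
    then show "b \<in> res_basis TR 0 \<and> keys m \<subseteq> V"
      using 0 p unfolding poly_ring_def by simp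
  qed
  have "augmentation TR ?v = p" unfolding augmentation_taylor[OF v] by (simp add: face_coeff_def)
  then have "p - augmentation TR ?v \<in> mideal (generated V u r)" by simp
  then show "\<exists>v\<in>free_module V (res_basis TR 0). p - augmentation TR v \<in> mideal (generated V u r)"
    using v by (rule bexI)
next
  show "{v \<in> free_module V (res_basis TR 0). augmentation TR v \<in> mideal (generated V u r)} =
      lin_ext (res_diff TR 1) ` free_module V (res_basis TR 1)"
  proof (intro Set.equalityI Set.subsetI)
    fix v assume "v \<in> {v \<in> free_module V (res_basis TR 0). augmentation TR v \<in> mideal (generated V u r)}"
    then have vF: "v \<in> free_module V (res_basis TR 0)" and vL: "augmentation TR v \<in> mideal (generated V u r)"
      by blast+
    note v = vF vL[unfolded augmentation_taylor[OF vF]]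
    \<comment> \<open>Here v sits on the empty face alone, and \<open>tdiff\<close> only reads
      nonempty faces.\<close>
    have "tdiff u r (face_coeff r v) = 0"
    proof (rule ext, rule poly_mapping_eqI, rule ccontr)
      fix \<tau> m assume "lookup (tdiff u r (face_coeff r v) \<tau>) m \<noteq> lookup (0 \<tau>) m"
      then have "lookup (tdiff u r (face_coeff r v) \<tau>) m \<noteq> 0" by simp
      then obtain s where "lookup (face_coeff r v (insert s \<tau>))
          (m - (elcm u r (insert s \<tau>) - elcm u r \<tau>)) \<noteq> 0"
        by (rule tdiff_coeff)
      from face_coeff_support[OF v(1) this] show False
        using finite_subset[of "insert s \<tau>" "{..<r}"] by simp
    qed
    moreover have "\<exists>s<r. edvd (u s) a" if "lookup (face_coeff r v {}) a \<noteq> 0" for a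
    proof -
      have "a \<in> generated V u r" using v(2) that by (auto simp: mideal_def in_keys_iff[of a])
      then show ?thesis by (simp add: generated_def)
    qed
    ultimately show "v \<in> lin_ext (res_diff TR 1) ` free_module V (res_basis TR 1)"
      unfolding One_nat_def by (rule taylor_exact[OF v(1)])
  next
    fix v assume "v \<in> lin_ext (res_diff TR 1) ` free_module V (res_basis TR 1)"
    then obtain w where w: "w \<in> free_module V (res_basis TR (Suc 0))" "v = lin_ext (res_diff TR (Suc 0)) w"
      unfolding One_nat_def by blast
    have v: "v \<in> free_module V (res_basis TR 0)" unfolding w(2) by (rule lin_ext_taylor_diff[OF w(1)])
    have "m \<in> generated V u r" if m: "m \<in> keys (face_coeff r v {})" for m
    proof -
      have nz: "lookup (face_coeff r v {}) m \<noteq> 0" using m by (simp add: in_keys_iff)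
      then have "lookup (tdiff u r (face_coeff r w) {}) m \<noteq> 0"
        by (simp add: w(2) face_coeff_taylor_diff[OF free_module_taylor_keys[OF w(1)]])
      \<comment> \<open>The entry at the empty face is a sum of multiples of the generators.\<close>
      then obtain s where s: "s < r" "edvd (elcm u r (insert s {}) - elcm u r {}) m"
        by (rule tdiff_coeff)
      have "edvd (u s) (elcm u r {s})" using s(1) by (intro edvd_elcm) auto
      also have "edvd \<dots> m" using s(2) by simp
      finally have "edvd (u s) m" .
      then show ?thesis using s(1) face_coeff_support(3)[OF v nz] unfolding generated_def by blast
    qed
    then have "augmentation TR v \<in> mideal (generated V u r)"
      unfolding augmentation_taylor[OF v] mideal_def by blast
    then show "v \<in> {v \<in> free_module V (res_basis TR 0). augmentation TR v \<in> mideal (generated V u r)}"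
      using v by blast
  qed
next
  fix i :: nat assume "i > 0"
  then obtain i' where i: "i = Suc i'" by (cases i) auto
  show "{v \<in> free_module V (res_basis TR i). lin_ext (res_diff TR i) v = 0} =
      lin_ext (res_diff TR (Suc i)) ` free_module V (res_basis TR (Suc i))"
  proof (intro Set.equalityI Set.subsetI)
    fix v assume "v \<in> {v \<in> free_module V (res_basis TR i). lin_ext (res_diff TR i) v = 0}"
    then have v: "v \<in> free_module V (res_basis TR i)" "lin_ext (res_diff TR i) v = 0" by auto
    have "tdiff u r (face_coeff r v) = face_coeff r (lin_ext (res_diff TR i) v)"
      using face_coeff_taylor_diff[OF free_module_taylor_keys[OF v(1)]] by simp
    also have "\<dots> = 0" by (simp add: v(2) face_coeff_def fun_eq_iff)
    finally show "v \<in> lin_ext (res_diff TR (Suc i)) ` free_module V (res_basis TR (Suc i))"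
      by (rule taylor_exact[OF v(1)]) (use i in simp)
  next
    fix v assume "v \<in> lin_ext (res_diff TR (Suc i)) ` free_module V (res_basis TR (Suc i))"
    then obtain w where w: "w \<in> free_module V (res_basis TR (Suc i))" "v = lin_ext (res_diff TR (Suc i)) w"
      by blast
    have v: "v \<in> free_module V (res_basis TR i)" unfolding w(2) by (rule lin_ext_taylor_diff[OF w(1)])
    have dv: "lin_ext (res_diff TR i) v \<in> free_module V (res_basis TR i')"
      unfolding i by (rule lin_ext_taylor_diff) (use v i in simp)
    have "lin_ext (res_diff TR i) v = 0"
    proof (rule face_coeff_inject[OF free_module_taylor_keys[OF dv]])
      show "face_coeff r (lin_ext (res_diff TR i) v) = face_coeff r 0"
        unfolding face_coeff_taylor_diff[OF free_module_taylor_keys[OF v]]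
        unfolding w(2) face_coeff_taylor_diff[OF free_module_taylor_keys[OF w(1)]] tdiff_tdiff
        by (simp add: face_coeff_def fun_eq_iff)
    qed simp
    then show "v \<in> {v \<in> free_module V (res_basis TR i). lin_ext (res_diff TR i) v = 0}" using v by blast
  qed
qed

end

section \<open>Monomial ideals and polarization\<close>

text \<open>Holds for whichever resolution \<open>Tor\<close> picks: existence makes the picked one
  a resolution, and the Koszul side does not mention it.\<close>

lemma Tor_trivial_iff:
  fixes V :: "'x set"
  assumes "finite V" "upset V M" "distinct xs" "set xs = V"
  shows "trivial_group (Tor V (mideal M :: ('x, 'k::field) mpoly set) (Suc p) j) \<longleftrightarrow>
    j = 0 \<or> koszul_acyclic TYPE('k) xs M p j"
proof -
  obtain u r where u: "M = generated V u r" "\<And>s. s < r \<Longrightarrow> keys (u s) \<subseteq> V"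
    using upset_generated[OF assms(1,2)] by blast
  define F where "F = (SOME F. graded_free_resolution V (mideal M :: ('x, 'k) mpoly set) F)"
  have F: "graded_free_resolution V (mideal M) F"
    unfolding F_def u(1) by (rule someI) (rule taylor_resolution[OF u(2)])
  interpret koszul_resolution V M F xs j
    by unfold_locales (use assms F in auto)
  have "Tor V (mideal M) (Suc p) j = tensor_cycles F (Suc p) j Mod tensor_boundaries F (Suc p) j"
    unfolding Tor_def Let_def F_def ..
  then show ?thesis
    by (simp only: tensor_homology_trivial_iff tensor_exact_iff_koszul_acyclic)
qed

text \<open>The criterion for the Taylor resolution itself. Used over both polynomial rings, it
  carries Koszul acyclicity from one to the other.\<close>

lemma tensor_exact_taylor:
  fixes V :: "'x set"
  assumes "finite V" "\<And>s. s < r \<Longrightarrow> keys (u s) \<subseteq> V" "distinct xs" "set xs = V"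
  shows "tensor_exact (taylor u r :: ('x, 'k::field) resolution) (Suc p) j \<longleftrightarrow>
    j = 0 \<or> koszul_acyclic TYPE('k) xs (generated V u r) p j"
proof -
  interpret koszul_resolution V "generated V u r" "taylor u r :: ('x, 'k) resolution" xs j
    using assms taylor_resolution[OF assms(2)] by unfold_locales (auto simp: upset_generated_upset)
  show ?thesis by (rule tensor_exact_iff_koszul_acyclic)
qed

text \<open>An entry of the Taylor matrix is a unit exactly when the two least common multiples
  agree; since one divides the other, their degrees decide this.\<close>

lemma residue_taylor_diff:
  "residue (lookup (res_diff (taylor u r :: ('x, 'k::field) resolution) i b) c) =
    (\<Sum>s\<in>set_decode b. if set_encode (set_decode b - {s}) = c \<and>
       mdeg (elcm u r (set_decode b)) = mdeg (elcm u r (set_decode b - {s}))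
     then ksign s (set_decode b - {s}) else 0)"
proof -
  have "elcm u r \<sigma> - elcm u r (\<sigma> - {s}) = 0 \<longleftrightarrow> mdeg (elcm u r \<sigma>) = mdeg (elcm u r (\<sigma> - {s}))" for \<sigma> s
  proof -
    have e: "edvd (elcm u r (\<sigma> - {s})) (elcm u r \<sigma>)" by (rule edvd_elcm_mono) auto
    have "mdeg (elcm u r \<sigma> - elcm u r (\<sigma> - {s})) = 0 \<longleftrightarrow> mdeg (elcm u r \<sigma>) = mdeg (elcm u r (\<sigma> - {s}))"
      using edvd_mdeg[OF e] by (simp only: mdeg_minus[OF e]) arith
    then show ?thesis by simp
  qed
  then have "residue (lookup (single c' (single
        (elcm u r \<sigma> - elcm u r (\<sigma> - {s})) (a::'k))) c) =
      (if c' = c \<and> mdeg (elcm u r \<sigma>) = mdeg (elcm u r (\<sigma> - {s})) then a else 0)" for c' \<sigma> s a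
    by (auto simp: residue_def lookup_single when_def)
  then show ?thesis by (simp add: taylor_def lookup_sum residue_sum)
qed

text \<open>Tensored with the residue field, the Taylor complex only remembers the degrees of the
  least common multiples, and polarization preserves these.\<close>

lemma tensor_exact_taylor_cong:
  assumes "\<And>\<sigma>. mdeg (elcm u r \<sigma>) = mdeg (elcm u' r \<sigma>)"
  shows "tensor_exact (taylor u r :: ('x, 'k::field) resolution) i j \<longleftrightarrow>
    tensor_exact (taylor u' r :: ('y, 'k) resolution) i j"
proof -
  let ?T = "taylor u r :: ('x, 'k) resolution" and ?T' = "taylor u' r :: ('y, 'k) resolution"
  have comp: "tensor_component ?T i j = tensor_component ?T' i j" for i
    by (simp add: tensor_component_def taylor_def assms)
  have diff: "resid (res_diff ?T i b) = resid (res_diff ?T' i b)" for i b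
    by (rule poly_mapping_eqI) (simp add: residue_taylor_diff assms)
  have "tensor_diff ?T i = tensor_diff ?T' i" for i
    by (simp add: tensor_diff_def diff)
  then show ?thesis unfolding tensor_exact_def tensor_boundaries_def by (simp add: comp)
qed

section \<open>Monomial ideals and truncations in terms of exponents\<close>

definition up_closure :: "'x set \<Rightarrow> 'x expo set \<Rightarrow> 'x expo set"
  where "up_closure V U = {m. keys m \<subseteq> V \<and> (\<exists>u\<in>U. edvd u m)}"

lemma up_closure_generated: "up_closure V (u ` {..<r}) = generated V u r"
  by (auto simp: up_closure_def generated_def)

lemma upset_up_closure: "upset V (up_closure V U)"
  unfolding upset_def up_closure_def by (auto simp: keys_add_exp intro: edvd_trans[OF _ edvd_add(1)])

lemma mideal_carrier: "upset V M \<Longrightarrow> p \<in> mideal M \<Longrightarrow> p \<in> carrier (poly_ring V)"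
  unfolding upset_def mideal_def poly_ring_def by auto

lemma mideal_ideal:
  assumes "upset V M"
  shows "ideal (mideal M :: ('x, 'k::field) mpoly set) (poly_ring V)"
proof -
  interpret cring "poly_ring V :: ('x, 'k) mpoly ring" by (rule cring_poly_ring)
  have inv: "inv\<^bsub>add_monoid (poly_ring V)\<^esub> p = - p" if p: "p \<in> mideal M" for p :: "('x, 'k) mpoly"
  proof -
    have "- p \<in> mideal M" using p by (simp add: mideal_def)
    then show ?thesis
      using mideal_carrier[OF assms] p
      by (intro group.inv_equality[OF add.is_group]) (auto simp: poly_ring_def)
  qed
  have mult: "q * p \<in> mideal M" if "p \<in> mideal M" "q \<in> carrier (poly_ring V)" for p q :: "('x, 'k) mpoly"
    by (rule mideal_mult[OF assms that(1)]) (use that(2) in \<open>auto simp: poly_ring_def\<close>)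
  show ?thesis
  proof (rule idealI)
    show "ring (poly_ring V :: ('x, 'k) mpoly ring)" by (rule ring_axioms)
    show "subgroup (mideal M :: ('x, 'k) mpoly set) (add_monoid (poly_ring V))"
    proof (rule group.subgroupI[OF add.is_group])
      show "mideal M \<subseteq> carrier (add_monoid (poly_ring V :: ('x, 'k) mpoly ring))"
        using mideal_carrier[OF assms] by auto
      show "mideal M \<noteq> ({} :: ('x, 'k) mpoly set)" using mideal_zero by blast
      fix a b :: "('x, 'k) mpoly" assume a: "a \<in> mideal M"
      show "inv\<^bsub>add_monoid (poly_ring V)\<^esub> a \<in> mideal M"
        unfolding inv[OF a] using a by (simp add: mideal_def)
      assume "b \<in> mideal M"
      with a show "a \<otimes>\<^bsub>add_monoid (poly_ring V)\<^esub> b \<in> mideal M"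
        by (simp add: poly_ring_def mideal_add)
    qed
    fix a x :: "('x, 'k) mpoly" assume "a \<in> mideal M" "x \<in> carrier (poly_ring V)"
    from mult[OF this] show "x \<otimes>\<^bsub>poly_ring V\<^esub> a \<in> mideal M" "a \<otimes>\<^bsub>poly_ring V\<^esub> x \<in> mideal M"
      by (simp_all add: poly_ring_def mult.commute)
  qed
qed

lemma poly_mapping_sum_single: "p = (\<Sum>m\<in>keys p. single m (lookup p m))"
  by (rule poly_mapping_eqI)
    (simp add: lookup_sum lookup_single when_def in_keys_iff)

lemma ideal_poly_ring_sum:
  fixes I :: "('x, 'k::field) mpoly set"
  assumes "ideal I (poly_ring V)" "\<And>s. s \<in> S \<Longrightarrow> g s \<in> I"
  shows "sum g S \<in> I"
proof -
  interpret ideal I "poly_ring V" by fact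
  have zero: "0 \<in> I"
    using additive_subgroup.zero_closed[OF ideal.axioms(1)[OF assms(1)]] by (simp add: poly_ring_def)
  have add: "a + b \<in> I" if "a \<in> I" "b \<in> I" for a b
    using additive_subgroup.a_closed[OF ideal.axioms(1)[OF assms(1)] that] by (simp add: poly_ring_def)
  show ?thesis using assms(2)
    by (induction S rule: infinite_finite_induct) (simp_all add: zero add)
qed

text \<open>A polynomial with exponents in the closure is a sum of terms, each a multiple of some
  generator.\<close>

lemma genideal_monomials:
  assumes "\<And>u. u \<in> U \<Longrightarrow> keys u \<subseteq> V"
  shows "Idl\<^bsub>poly_ring V\<^esub> (monomial ` U) = (mideal (up_closure V U) :: ('x, 'k::field) mpoly set)"
proof -
  interpret cring "poly_ring V :: ('x, 'k) mpoly ring" by (rule cring_poly_ring)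
  have carr: "monomial ` U \<subseteq> carrier (poly_ring V :: ('x, 'k) mpoly ring)"
    by (rule image_subsetI) (simp add: assms monomial_def poly_ring_def)
  have sub: "monomial ` U \<subseteq> (mideal (up_closure V U) :: ('x, 'k) mpoly set)"
  proof (rule image_subsetI)
    fix u assume u: "u \<in> U"
    then have "u \<in> up_closure V U" using assms edvd_refl unfolding up_closure_def by blast
    then show "monomial u \<in> (mideal (up_closure V U) :: ('x, 'k) mpoly set)"
      by (simp add: monomial_def mideal_def)
  qed
  have id: "ideal (Idl\<^bsub>poly_ring V\<^esub> (monomial ` U)) (poly_ring V :: ('x, 'k) mpoly ring)"
    by (rule genideal_ideal[OF carr])
  show ?thesis
  proof (rule Set.equalityI)
    show "Idl\<^bsub>poly_ring V\<^esub> (monomial ` U) \<subseteq> (mideal (up_closure V U) :: ('x, 'k) mpoly set)"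
      by (rule genideal_minimal[OF mideal_ideal[OF upset_up_closure] sub])
    show "mideal (up_closure V U) \<subseteq> (Idl\<^bsub>poly_ring V\<^esub> (monomial ` U) :: ('x, 'k) mpoly set)"
    proof
      fix p :: "('x, 'k) mpoly" assume p: "p \<in> mideal (up_closure V U)"
      have "single m (lookup p m) \<in> Idl\<^bsub>poly_ring V\<^esub> (monomial ` U)"
        if m: "m \<in> keys p" for m
      proof -
        have "m \<in> up_closure V U" using p m by (auto simp: mideal_def)
        then obtain u where u: "u \<in> U" "edvd u m" "keys m \<subseteq> V"
          by (auto simp: up_closure_def)
        let ?q = "single (m - u) (lookup p m)"
        have "keys (m - u) \<subseteq> V" using u(3) by (auto simp: in_keys_iff lookup_minus)
        then have "?q \<in> carrier (poly_ring V)" by (auto simp: poly_ring_def)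
        moreover have "monomial u \<in> Idl\<^bsub>poly_ring V\<^esub> (monomial ` U :: ('x, 'k) mpoly set)"
          using genideal_self[OF carr] u(1) by auto
        ultimately have "?q \<otimes>\<^bsub>poly_ring V\<^esub> monomial u \<in> Idl\<^bsub>poly_ring V\<^esub> (monomial ` U :: ('x, 'k) mpoly set)"
          by (intro ideal.I_l_closed[OF id])
        also have "?q \<otimes>\<^bsub>poly_ring V\<^esub> monomial u = single m (lookup p m)"
          by (simp add: poly_ring_def monomial_def mult_single edvd_minus_add[OF u(2)])
        finally show ?thesis .
      qed
      then have "(\<Sum>m\<in>keys p. single m (lookup p m)) \<in> Idl\<^bsub>poly_ring V\<^esub> (monomial ` U)"
        by (rule ideal_poly_ring_sum[OF id])
      then show "p \<in> Idl\<^bsub>poly_ring V\<^esub> (monomial ` U)" by (simp flip: poly_mapping_sum_single)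
    qed
  qed
qed

lemma monomial_in_mideal_iff [simp]: "(monomial m :: ('x, 'k::field) mpoly) \<in> mideal M \<longleftrightarrow> m \<in> M"
  by (simp add: monomial_def mideal_def)

lemma mideal_inject: "(mideal M :: ('x, 'k::field) mpoly set) = mideal N \<longleftrightarrow> M = N"
proof
  assume "(mideal M :: ('x, 'k) mpoly set) = mideal N"
  then have "m \<in> M \<longleftrightarrow> m \<in> N" for m
    using monomial_in_mideal_iff[where 'k = 'k, of m M] monomial_in_mideal_iff[where 'k = 'k, of m N] by simp
  then show "M = N" by blast
qed simp

lemma mideal_Int: "mideal M \<inter> mideal N = mideal (M \<inter> N)"
  by (auto simp: mideal_def)

definition degree_ge :: "'x set \<Rightarrow> nat \<Rightarrow> 'x expo set"
  where "degree_ge V k = {m. keys m \<subseteq> V \<and> k \<le> mdeg m}"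

lemma upset_degree_ge: "upset V (degree_ge V k)"
  by (auto simp: upset_def degree_ge_def keys_add_exp)

lemma graded_max_ideal_eq: "graded_max_ideal V = (mideal (degree_ge V 1) :: ('x, 'k::field) mpoly set)"
proof -
  let ?U = "(\<lambda>x. single x 1) ` V"
  have "graded_max_ideal V = (Idl\<^bsub>poly_ring V\<^esub> (monomial ` ?U) :: ('x, 'k) mpoly set)"
    unfolding graded_max_ideal_def by (simp add: var_def image_image)
  also have "\<dots> = mideal (up_closure V ?U)" by (rule genideal_monomials) auto
  also have "up_closure V ?U = degree_ge V 1"
  proof (intro Set.equalityI Set.subsetI)
    fix m assume "m \<in> up_closure V ?U"
    then obtain x where "keys m \<subseteq> V" "edvd (single x 1) m"
      by (auto simp: up_closure_def)
    then show "m \<in> degree_ge V 1" using edvd_mdeg by (fastforce simp: degree_ge_def)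
  next
    fix m assume m: "m \<in> degree_ge V 1"
    then have "m \<noteq> 0" by (auto simp: degree_ge_def)
    then obtain x where x: "x \<in> keys m" by (metis keys_eq_empty all_not_in_conv)
    then have "edvd (single x 1) m"
      by (auto simp: edvd_def lookup_single when_def in_keys_iff Suc_le_eq)
    with m x show "m \<in> up_closure V ?U" by (auto simp: up_closure_def degree_ge_def)
  qed
  finally show ?thesis .
qed

text \<open>A monomial of degree at least k + 1 gives one of its variables to the last factor. The
  case k = 0 is the unit of the monoid of ideals, the whole ring.\<close>

lemma max_ideal_power_eq: "max_ideal_power V k = (mideal (degree_ge V k) :: ('x, 'k::field) mpoly set)"
proof (induction k)
  case 0
  show ?case
    by (auto simp: max_ideal_power_def nat_pow_def ideals_set_def poly_ring_def mideal_def degree_ge_def)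
next
  case (Suc k)
  interpret cring "poly_ring V :: ('x, 'k) mpoly ring" by (rule cring_poly_ring)
  let ?I = "mideal (degree_ge V k) :: ('x, 'k) mpoly set" and ?J = "mideal (degree_ge V 1) :: ('x, 'k) mpoly set"
  have "max_ideal_power V (Suc k) = ideal_prod (poly_ring V) ?I ?J"
    unfolding Suc.IH[symmetric] graded_max_ideal_eq[symmetric]
    by (simp add: max_ideal_power_def nat_pow_def ideals_set_def)
  also have "\<dots> = mideal (degree_ge V (Suc k))"
  proof (intro Set.equalityI Set.subsetI)
    fix p assume "p \<in> ideal_prod (poly_ring V) ?I ?J"
    then show "p \<in> mideal (degree_ge V (Suc k))"
    proof (induction rule: ideal_prod.induct)
      case (prod i j)
      show ?case
        unfolding mideal_def
      proof (intro CollectI subsetI)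
        fix m assume "m \<in> keys (i \<otimes>\<^bsub>poly_ring V\<^esub> j)"
        then obtain a b where ab: "m = a + b" "a \<in> keys i" "b \<in> keys j"
          using keys_mult[of i j] by (auto simp: poly_ring_def)
        then have "a \<in> degree_ge V k" "b \<in> degree_ge V 1"
          using prod by (auto simp: mideal_def)
        then show "m \<in> degree_ge V (Suc k)" by (simp add: ab(1) degree_ge_def keys_add_exp)
      qed
    next
      case (sum s t)
      then show ?case by (simp add: poly_ring_def mideal_add)
    qed
  next
    fix p :: "('x, 'k) mpoly" assume p: "p \<in> mideal (degree_ge V (Suc k))"
    have id: "ideal (ideal_prod (poly_ring V) ?I ?J) (poly_ring V)"
      by (intro ideal_prod_is_ideal mideal_ideal upset_degree_ge)
    have "single m (lookup p m) \<in> ideal_prod (poly_ring V) ?I ?J"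
      if m: "m \<in> keys p" for m
    proof -
      have md: "m \<in> degree_ge V (Suc k)" using p m by (auto simp: mideal_def)
      then have "m \<noteq> 0" by (auto simp: degree_ge_def)
      then obtain x where x: "x \<in> keys m" by (metis keys_eq_empty all_not_in_conv)
      define y where "y = (single x 1 :: 'x expo)"
      have y: "keys y = {x}" "mdeg y = 1" by (simp_all add: y_def)
      have e: "edvd y m"
        using x by (auto simp: y_def edvd_def lookup_single when_def in_keys_iff Suc_le_eq)
      have "keys (m - y) \<subseteq> keys m" by (auto simp: in_keys_iff lookup_minus)
      then have "m - y \<in> degree_ge V k"
        using md mdeg_minus[OF e] y(2) by (auto simp: degree_ge_def)
      then have "single (m - y) (lookup p m) \<in> ?I" by (simp add: mideal_def)
      moreover have "single y 1 \<in> ?J" using x md y by (auto simp: mideal_def degree_ge_def)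
      ultimately have "single (m - y) (lookup p m) \<otimes>\<^bsub>poly_ring V\<^esub> single y 1
          \<in> ideal_prod (poly_ring V) ?I ?J"
        by (rule ideal_prod.prod)
      also have "single (m - y) (lookup p m) \<otimes>\<^bsub>poly_ring V\<^esub> single y 1
          = single m (lookup p m)"
        by (simp add: poly_ring_def mult_single edvd_minus_add[OF e])
      finally show ?thesis .
    qed
    then have "(\<Sum>m\<in>keys p. single m (lookup p m)) \<in> ideal_prod (poly_ring V) ?I ?J"
      by (rule ideal_poly_ring_sum[OF id])
    then show "p \<in> ideal_prod (poly_ring V) ?I ?J" by (simp flip: poly_mapping_sum_single)
  qed
  finally show ?case .
qed

lemma truncation_mideal:
  assumes "upset V M"
  shows "truncation V (mideal M :: ('x, 'k::field) mpoly set) k = mideal {m \<in> M. k \<le> mdeg m}"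
proof -
  have "M \<inter> degree_ge V k = {m \<in> M. k \<le> mdeg m}"
    using assms by (auto simp: degree_ge_def upset_def)
  then show ?thesis by (simp add: truncation_def max_ideal_power_eq mideal_Int)
qed

definition indicator_exp :: "'x set \<Rightarrow> 'x expo"
  where "indicator_exp A = (\<Sum>x\<in>A. single x 1)"

lemma lookup_indicator_exp:
  "finite A \<Longrightarrow> lookup (indicator_exp A) x = (if x \<in> A then 1 else 0)"
  by (simp add: indicator_exp_def lookup_sum lookup_single when_def)

lemma keys_indicator_exp: "finite A \<Longrightarrow> keys (indicator_exp A) = A"
  by (auto simp: in_keys_iff lookup_indicator_exp split: if_splits)

lemma mdeg_squarefree:
  assumes "\<And>x. lookup m x \<le> 1"
  shows "mdeg m = card (keys m)"
proof -
  have "mdeg m = (\<Sum>x\<in>keys m. 1)"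
    unfolding mdeg_def
  proof (rule sum.cong)
    fix x assume "x \<in> keys m"
    then show "lookup m x = 1" using assms[of x] by (simp add: in_keys_iff)
  qed simp
  then show ?thesis by simp
qed

lemma mdeg_indicator_exp: "finite A \<Longrightarrow> mdeg (indicator_exp A) = card A"
  using mdeg_squarefree[of "indicator_exp A"] by (simp add: lookup_indicator_exp keys_indicator_exp)

lemma edvd_indicator_exp_iff: "finite A \<Longrightarrow> edvd (indicator_exp A) m \<longleftrightarrow> A \<subseteq> keys m"
  by (auto simp: edvd_def lookup_indicator_exp in_keys_iff Suc_le_eq)

text \<open>A squarefree divisor of degree at least k exists exactly when at least k variables occur
  in the monomial; their product is the witness.\<close>

lemma squarefree_max_ideal_eq:
  "squarefree_max_ideal V k =
    (mideal {m. keys m \<subseteq> V \<and> k \<le> card (keys m)} :: ('x, 'k::field) mpoly set)"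
proof -
  let ?U = "{m \<in> degree_ge V k. \<forall>x. lookup m x \<le> 1}"
  have "{monomial m | m. (\<forall>x. lookup m x \<le> 1) \<and> monomial m \<in> (max_ideal_power V k :: ('x, 'k) mpoly set)} =
      (monomial ` ?U :: ('x, 'k) mpoly set)"
    unfolding max_ideal_power_eq by auto
  then have "squarefree_max_ideal V k = (Idl\<^bsub>poly_ring V\<^esub> (monomial ` ?U) :: ('x, 'k) mpoly set)"
    by (simp only: squarefree_max_ideal_def)
  also have "\<dots> = mideal (up_closure V ?U)" by (rule genideal_monomials) (auto simp: degree_ge_def)
  also have "up_closure V ?U = {m. keys m \<subseteq> V \<and> k \<le> card (keys m)}"
  proof (intro Set.equalityI Set.subsetI)
    fix m assume "m \<in> up_closure V ?U"
    then obtain u where u: "u \<in> degree_ge V k" "\<forall>x. lookup u x \<le> 1" "edvd u m"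
      and m: "keys m \<subseteq> V"
      by (auto simp: up_closure_def)
    have "k \<le> card (keys u)" using u(1,2) by (simp add: degree_ge_def mdeg_squarefree)
    also have "\<dots> \<le> card (keys m)" by (intro card_mono edvd_keys[OF u(3)]) simp
    finally show "m \<in> {m. keys m \<subseteq> V \<and> k \<le> card (keys m)}" using m by simp
  next
    fix m :: "'x expo" assume m: "m \<in> {m. keys m \<subseteq> V \<and> k \<le> card (keys m)}"
    let ?u = "indicator_exp (keys m)"
    have "?u \<in> ?U" using m by (simp add: degree_ge_def mdeg_indicator_exp keys_indicator_exp lookup_indicator_exp)
    moreover have "edvd ?u m" by (simp add: edvd_indicator_exp_iff)
    ultimately show "m \<in> up_closure V ?U" using m unfolding up_closure_def by blast
  qed
  finally show ?thesis .
qed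

lemma squarefree_truncation_mideal:
  assumes "upset V M"
  shows "squarefree_truncation V (mideal M :: ('x, 'k::field) mpoly set) k =
    mideal {m \<in> M. k \<le> card (keys m)}"
proof -
  have "M \<inter> {m. keys m \<subseteq> V \<and> k \<le> card (keys m)} = {m \<in> M. k \<le> card (keys m)}"
    using assms by (auto simp: upset_def)
  then show ?thesis by (simp add: squarefree_truncation_def squarefree_max_ideal_eq mideal_Int)
qed

section \<open>Minimal generators and polarization\<close>

definition minimal_exps :: "'x expo set \<Rightarrow> 'x expo set"
  where "minimal_exps M = {m \<in> M. \<forall>m'\<in>M. edvd m' m \<longrightarrow> m' = m}"

text \<open>A divisor of m in M of least degree is minimal, because proper divisors have smaller
  degree.\<close>

lemma up_closure_minimal_exps:
  assumes "upset V M"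
  shows "up_closure V (minimal_exps M) = M"
proof (intro Set.equalityI Set.subsetI)
  fix m assume "m \<in> up_closure V (minimal_exps M)"
  then obtain u where u: "u \<in> M" "edvd u m" "keys m \<subseteq> V"
    by (auto simp: up_closure_def minimal_exps_def)
  have "keys (m - u) \<subseteq> V" using u(3) by (auto simp: in_keys_iff lookup_minus)
  then have "u + (m - u) \<in> M" using assms u(1) unfolding upset_def by blast
  then show "m \<in> M" by (simp add: edvd_add_minus[OF u(2)])
next
  fix m assume m: "m \<in> M"
  obtain u where u: "u \<in> M \<and> edvd u m" "\<And>w. w \<in> M \<and> edvd w m \<Longrightarrow> mdeg u \<le> mdeg w"
    using exists_least_iff[of "\<lambda>d. \<exists>u. u \<in> M \<and> edvd u m \<and> mdeg u = d"] m
    by (metis edvd_refl not_le_imp_less)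
  have "w = u" if "w \<in> M" "edvd w u" for w
  proof -
    have "edvd w m" using that(2) u(1) edvd_trans by blast
    then have "mdeg u \<le> mdeg w" using u(2) that(1) by blast
    then show ?thesis using edvd_mdeg[OF that(2)] edvd_mdeg_eq[OF that(2)] by simp
  qed
  then have "u \<in> minimal_exps M" using u(1) by (simp add: minimal_exps_def)
  moreover have "keys m \<subseteq> V" using assms m unfolding upset_def by blast
  ultimately show "m \<in> up_closure V (minimal_exps M)" using u(1) unfolding up_closure_def by blast
qed

lemma finite_minimal_exps:
  assumes "finite V" "upset V M"
  shows "finite (minimal_exps M)"
proof -
  obtain B where B: "B \<subseteq> M" "finite B" "\<forall>a\<in>M. \<exists>b\<in>B. edvd b a"
    using dickson[OF assms(1), of M] assms(2) unfolding upset_def by blast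
  have "minimal_exps M \<subseteq> B"
  proof
    fix m assume m: "m \<in> minimal_exps M"
    then obtain b where "b \<in> B" "edvd b m" using B(3) unfolding minimal_exps_def by blast
    then show "m \<in> B" using m B(1) unfolding minimal_exps_def by blast
  qed
  then show ?thesis using B(2) finite_subset by blast
qed

text \<open>Every divisibility-minimal exponent belongs to each monomial generating set, and
  together these exponents generate. So the irredundant generating set is unique and the definite
  description denotes it.\<close>

lemma minimal_monomial_generators_mideal:
  assumes "upset V M"
  shows "minimal_monomial_generators V (mideal M :: ('x, 'k::field) mpoly set) = minimal_exps M"
  unfolding minimal_monomial_generators_def
proof (rule the_equality)
  have keysM: "keys m \<subseteq> V" if "m \<in> M" for m using assms that unfolding upset_def by blast
  have gen: "Idl\<^bsub>poly_ring V\<^esub> (monomial ` U) = (mideal M :: ('x, 'k) mpoly set) \<longleftrightarrow> up_closure V U = M"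
    if "U \<subseteq> {m. keys m \<subseteq> V}" for U
    using genideal_monomials[of U V, where 'k = 'k] that by (simp add: subset_iff mideal_inject)
  have min_sub: "minimal_exps M \<subseteq> {m. keys m \<subseteq> V}"
    using keysM by (auto simp: minimal_exps_def)
  have min_in: "minimal_exps M \<subseteq> U" if U: "U \<subseteq> {m. keys m \<subseteq> V}" "up_closure V U = M" for U
  proof
    fix m assume m: "m \<in> minimal_exps M"
    then have "m \<in> up_closure V U" using U(2) by (auto simp: minimal_exps_def)
    then obtain w where w: "w \<in> U" "edvd w m" by (auto simp: up_closure_def)
    have "w \<in> up_closure V U" using w(1) U(1) edvd_refl unfolding up_closure_def by blast
    then have "w = m" using m w(2) U(2) by (auto simp: minimal_exps_def)
    then show "m \<in> U" using w(1) by simp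
  qed
  have "Idl\<^bsub>poly_ring V\<^esub> (monomial ` W) \<noteq> (mideal M :: ('x, 'k) mpoly set)" if "W \<subset> minimal_exps M" for W
  proof -
    have "W \<subseteq> {m. keys m \<subseteq> V}" using that min_sub by blast
    then show ?thesis using gen[of W] min_in[of W] that by blast
  qed
  then show "minimal_exps M \<subseteq> {m. keys m \<subseteq> V} \<and>
      Idl\<^bsub>poly_ring V\<^esub> (monomial ` minimal_exps M) = (mideal M :: ('x, 'k) mpoly set) \<and>
      (\<forall>W. W \<subset> minimal_exps M \<longrightarrow> Idl\<^bsub>poly_ring V\<^esub> (monomial ` W) \<noteq> (mideal M :: ('x, 'k) mpoly set))"
    using min_sub gen[OF min_sub] up_closure_minimal_exps[OF assms] by blast
  fix U assume U: "U \<subseteq> {m. keys m \<subseteq> V} \<and>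
      Idl\<^bsub>poly_ring V\<^esub> (monomial ` U) = (mideal M :: ('x, 'k) mpoly set) \<and>
      (\<forall>W. W \<subset> U \<longrightarrow> Idl\<^bsub>poly_ring V\<^esub> (monomial ` W) \<noteq> (mideal M :: ('x, 'k) mpoly set))"
  then have "minimal_exps M \<subseteq> U" using gen[of U] min_in[of U] by blast
  moreover have "\<not> minimal_exps M \<subset> U"
    using U gen[OF min_sub] up_closure_minimal_exps[OF assms] by blast
  ultimately show "U = minimal_exps M" by blast
qed

definition pexp :: "'x set \<Rightarrow> 'x expo \<Rightarrow> ('x \<times> nat \<Rightarrow>\<^sub>0 nat)"
  where "pexp V u = (\<Sum>x\<in>V. \<Sum>l = 1..lookup u x. single (x, l) 1)"

lemma monomial_zero: "monomial 0 = 1"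
  by (simp add: monomial_def)

lemma monomial_add: "monomial (a + b) = monomial a * monomial b"
  by (simp add: monomial_def mult_single)

lemma monomial_sum: "monomial (sum f A) = (\<Prod>a\<in>A. monomial (f a) :: ('x, 'k::field) mpoly)"
  by (induction A rule: infinite_finite_induct) (simp_all add: monomial_zero monomial_add)

lemma polarize_monomial_eq: "polarize_monomial V u = monomial (pexp V u)"
  by (simp add: polarize_monomial_def pexp_def monomial_sum var_def)

lemma lookup_pexp:
  assumes "finite V"
  shows "lookup (pexp V u) (x, l) = (if x \<in> V \<and> 1 \<le> l \<and> l \<le> lookup u x then 1 else 0)"
proof -
  have "lookup (pexp V u) (x, l) =
      (\<Sum>y\<in>V. \<Sum>l' = 1..lookup u y. if y = x then (if l' = l then 1 else 0) else 0)"
    unfolding pexp_def lookup_sum lookup_single by (intro sum.cong) (auto simp: when_def)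
  also have "\<dots> = (\<Sum>y\<in>V. if y = x then (\<Sum>l' = 1..lookup u y. if l' = l then 1 else 0) else 0)"
    by (intro sum.cong) auto
  also have "\<dots> = (if x \<in> V \<and> 1 \<le> l \<and> l \<le> lookup u x then 1 else 0)"
    using assms by simp
  finally show ?thesis .
qed

lemma mdeg_sum: "mdeg (sum f A) = (\<Sum>a\<in>A. mdeg (f a))"
  by (induction A rule: infinite_finite_induct) simp_all

lemma mdeg_pexp:
  assumes "finite V" "keys m \<subseteq> V"
  shows "mdeg (pexp V m) = mdeg m"
  using mdeg_superset[OF assms] by (simp add: pexp_def mdeg_sum)

lemma le_lookup_elcm_iff:
  "l \<le> lookup (elcm u r \<sigma>) x \<longleftrightarrow> l = 0 \<or> (\<exists>s\<in>\<sigma>. s < r \<and> l \<le> lookup (u s) x)"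
  unfolding lookup_elcm by (subst Max_ge_iff) auto

text \<open>For x in V and positive l, the variable (x, l) divides a polarized monomial iff l is at
  most the exponent of x, and l is at most a maximum iff it is at most one of the members.\<close>

lemma elcm_pexp:
  assumes "finite V"
  shows "elcm (\<lambda>s. pexp V (u s)) r \<sigma> = pexp V (elcm u r \<sigma>)"
proof (rule poly_mapping_eqI)
  fix y :: "'a \<times> nat"
  obtain x l where y: "y = (x, l)" by (cases y)
  \<comment> \<open>Two exponents with the same lower bounds are equal; this avoids computing the
    maxima.\<close>
  have "n \<le> lookup (elcm (\<lambda>s. pexp V (u s)) r \<sigma>) (x, l) \<longleftrightarrow>
      n \<le> lookup (pexp V (elcm u r \<sigma>)) (x, l)" for n
    unfolding le_lookup_elcm_iff lookup_pexp[OF assms] by (cases "n = 0") auto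
  then show "lookup (elcm (\<lambda>s. pexp V (u s)) r \<sigma>) y = lookup (pexp V (elcm u r \<sigma>)) y"
    unfolding y by (meson order_antisym order_refl)
qed

text \<open>Koszul acyclicity is translated to the Taylor resolution, compared there by degrees of
  least common multiples, and translated back over the other ring. The criterion says nothing in
  degree 0, hence \<open>j > 0\<close>.\<close>

lemma koszul_acyclic_pexp:
  fixes V :: "'x set"
  assumes "finite V" "\<And>s. s < r \<Longrightarrow> keys (u s) \<subseteq> V" "distinct xs" "set xs = V"
    and "finite W" "\<And>s. s < r \<Longrightarrow> keys (pexp V (u s)) \<subseteq> W" "distinct ys" "set ys = W"
    and "j > 0"
  shows "koszul_acyclic TYPE('k::field) xs (generated V u r) p j \<longleftrightarrow>
    koszul_acyclic TYPE('k) ys (generated W (\<lambda>s. pexp V (u s)) r) p j"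
proof -
  have keys: "keys (elcm u r \<sigma>) \<subseteq> V" for \<sigma>
    using keys_elcm[of u r \<sigma>] assms(2) by blast
  have "tensor_exact (taylor u r :: ('x, 'k) resolution) (Suc p) j \<longleftrightarrow>
    tensor_exact (taylor (\<lambda>s. pexp V (u s)) r :: ('x \<times> nat, 'k) resolution) (Suc p) j"
    by (rule tensor_exact_taylor_cong) (simp add: elcm_pexp[OF assms(1)] mdeg_pexp[OF assms(1) keys])
  moreover have "tensor_exact (taylor u r :: ('x, 'k) resolution) (Suc p) j \<longleftrightarrow>
      j = 0 \<or> koszul_acyclic TYPE('k) xs (generated V u r) p j"
    by (rule tensor_exact_taylor) (fact assms)+
  moreover have "tensor_exact (taylor (\<lambda>s. pexp V (u s)) r :: ('x \<times> nat, 'k) resolution) (Suc p) j \<longleftrightarrow>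
      j = 0 \<or> koszul_acyclic TYPE('k) ys (generated W (\<lambda>s. pexp V (u s)) r) p j"
    by (rule tensor_exact_taylor) (fact assms)+
  ultimately show ?thesis using assms(9) by simp
qed

lemma polarization_mideal:
  fixes V :: "'x set"
  assumes "finite V" "upset V M"
  defines "W \<equiv> polarization_vars V (mideal M :: ('x, 'k::field) mpoly set)"
  shows "finite W" "\<And>m. m \<in> minimal_exps M \<Longrightarrow> keys (pexp V m) \<subseteq> W"
    "polarization V (mideal M :: ('x, 'k) mpoly set) = mideal (up_closure W (pexp V ` minimal_exps M))"
proof -
  note mg = minimal_monomial_generators_mideal[OF assms(2), where 'k = 'k]
  show "finite W" unfolding W_def polarization_vars_def using assms(1) by simp
  show keys: "keys (pexp V m) \<subseteq> W" if m: "m \<in> minimal_exps M" for m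
  proof
    fix y assume y: "y \<in> keys (pexp V m)"
    obtain x l where xl: "y = (x, l)" by (cases y)
    have "x \<in> V" "1 \<le> l" "l \<le> lookup m x"
      using y unfolding xl in_keys_iff lookup_pexp[OF assms(1)] by (auto split: if_splits)
    moreover have "lookup m x \<le> max_exponent V (mideal M :: ('x, 'k) mpoly set) x"
      unfolding max_exponent_def mg using m finite_minimal_exps[OF assms(1,2)] by (intro Max_ge) auto
    ultimately show "y \<in> W" by (simp add: W_def polarization_vars_def xl)
  qed
  have "polarize_monomial V ` minimal_exps M = (monomial ` pexp V ` minimal_exps M :: ('x \<times> nat, 'k) mpoly set)"
    by (simp add: polarize_monomial_eq image_image)
  then have "polarization V (mideal M :: ('x, 'k) mpoly set) = Idl\<^bsub>poly_ring W\<^esub> (monomial ` pexp V ` minimal_exps M)"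
    unfolding polarization_def mg W_def by simp
  also have "\<dots> = mideal (up_closure W (pexp V ` minimal_exps M))"
    by (rule genideal_monomials) (use keys in auto)
  finally show "polarization V (mideal M :: ('x, 'k) mpoly set) = mideal (up_closure W (pexp V ` minimal_exps M))" .
qed

section \<open>Truncation and linear resolutions\<close>

text \<open>With i = p + 1, the excluded degree q + i - 1 is q + p.\<close>

definition koszul_linear :: "'k::field itself \<Rightarrow> 'x list \<Rightarrow> 'x expo set \<Rightarrow> bool"
  where "koszul_linear K xs M \<longleftrightarrow>
    (\<exists>q. \<forall>p j. j \<noteq> q + p \<longrightarrow> j = 0 \<or> koszul_acyclic K xs M p j)"

text \<open>The regularity bound: Tor is concentrated in degrees at most \<open>k + i - 1\<close>.\<close>

definition koszul_regular :: "'k::field itself \<Rightarrow> 'x list \<Rightarrow> 'x expo set \<Rightarrow> nat \<Rightarrow> bool"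
  where "koszul_regular K xs M k \<longleftrightarrow> (\<forall>p j. k + p < j \<longrightarrow> koszul_acyclic K xs M p j)"

lemma has_linear_resolution_iff:
  fixes V :: "'x set"
  assumes "finite V" "upset V M" "distinct xs" "set xs = V"
  shows "has_linear_resolution V (mideal M :: ('x, 'k::field) mpoly set) \<longleftrightarrow>
    koszul_linear TYPE('k) xs M"
proof -
  have "has_q_linear_resolution V (mideal M :: ('x, 'k) mpoly set) q \<longleftrightarrow>
    (\<forall>p j. j \<noteq> q + p \<longrightarrow> j = 0 \<or> koszul_acyclic TYPE('k) xs M p j)" for q
  proof -
    have "has_q_linear_resolution V (mideal M :: ('x, 'k) mpoly set) q \<longleftrightarrow>
      (\<forall>p j. j \<noteq> q + p \<longrightarrow> trivial_group (Tor V (mideal M :: ('x, 'k) mpoly set) (Suc p) j))"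
      unfolding has_q_linear_resolution_def by (metis Suc_pred' add_Suc_right diff_Suc_1 zero_less_Suc)
    then show ?thesis by (simp only: Tor_trivial_iff[OF assms])
  qed
  then show ?thesis by (simp add: has_linear_resolution_def koszul_linear_def)
qed

lemma acyclic_at_empty:
  assumes "\<And>\<sigma>. \<sigma> \<in> \<Delta> \<Longrightarrow> card \<sigma> \<noteq> p"
  shows "acyclic_at K r \<Delta> p"
  unfolding acyclic_at_def
proof (intro allI impI)
  fix g :: "nat set \<Rightarrow> 'a" assume "\<forall>\<sigma>. g \<sigma> \<noteq> 0 \<longrightarrow> \<sigma> \<in> \<Delta> \<and> card \<sigma> = p"
  then have "g = 0" using assms by (auto simp: fun_eq_iff)
  then show "\<exists>h. (\<forall>\<sigma>. h \<sigma> \<noteq> 0 \<longrightarrow> \<sigma> \<in> \<Delta> \<and> card \<sigma> = Suc p) \<and> bd r h = g"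
    by (intro exI[of _ 0]) simp
qed

lemma acyclic_at_cong:
  assumes "\<And>\<sigma>. card \<sigma> = p \<or> card \<sigma> = Suc p \<Longrightarrow> \<sigma> \<in> \<Delta> \<longleftrightarrow> \<sigma> \<in> \<Delta>'"
  shows "acyclic_at K r \<Delta> p \<longleftrightarrow> acyclic_at K r \<Delta>' p"
proof -
  have "(\<sigma> \<in> \<Delta> \<and> card \<sigma> = p) = (\<sigma> \<in> \<Delta>' \<and> card \<sigma> = p)"
    "(\<sigma> \<in> \<Delta> \<and> card \<sigma> = Suc p) = (\<sigma> \<in> \<Delta>' \<and> card \<sigma> = Suc p)" for \<sigma>
    using assms by blast+
  then show ?thesis unfolding acyclic_at_def by simp
qed

text \<open>Without vertices the empty face is a cycle that nothing bounds. This detects a generator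
  of a truncation in degree k.\<close>

lemma not_acyclic_at_point:
  assumes "{} \<in> \<Delta>" "\<And>\<sigma>. \<sigma> \<in> \<Delta> \<Longrightarrow> card \<sigma> \<noteq> 1"
  shows "\<not> acyclic_at (K :: 'k::field itself) r \<Delta> 0"
proof
  assume ac: "acyclic_at K r \<Delta> 0"
  define g :: "nat set \<Rightarrow> 'k" where "g = (\<lambda>\<sigma>. if \<sigma> = {} then 1 else 0)"
  have "\<forall>\<sigma>. g \<sigma> \<noteq> 0 \<longrightarrow> \<sigma> \<in> \<Delta> \<and> card \<sigma> = 0" using assms(1) by (simp add: g_def)
  moreover have "bd r g = 0" by (simp add: bd_def g_def fun_eq_iff)
  ultimately obtain h where h: "\<forall>\<sigma>. h \<sigma> \<noteq> 0 \<longrightarrow> \<sigma> \<in> \<Delta> \<and> card \<sigma> = Suc 0" "bd r h = g"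
    using ac unfolding acyclic_at_def by blast
  have "h = 0" using h(1) assms(2) by (auto simp: fun_eq_iff)
  then have "g {} = 0" using h(2) by auto
  then show False by (simp add: g_def)
qed

lemma mdeg_minus_klcm:
  assumes "distinct xs" "\<sigma> \<subseteq> {..<length xs}" "edvd (klcm xs \<sigma>) a"
  shows "mdeg (a - klcm xs \<sigma>) + card \<sigma> = mdeg a"
  using edvd_mdeg[OF assms(3)] mdeg_klcm[OF assms(1,2)] by (simp add: mdeg_minus[OF assms(3)])

text \<open>Truncation replaces a Koszul simplicial complex by its skeleton.\<close>

lemma koszul_complex_truncation:
  assumes "distinct xs"
  shows "koszul_complex xs {m \<in> M. k \<le> mdeg m} a = {\<sigma> \<in> koszul_complex xs M a. card \<sigma> + k \<le> mdeg a}"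
proof -
  have "k \<le> mdeg (a - klcm xs \<sigma>) \<longleftrightarrow> card \<sigma> + k \<le> mdeg a"
    if "\<sigma> \<subseteq> {..<length xs}" "edvd (klcm xs \<sigma>) a" for \<sigma>
    using mdeg_minus_klcm[OF assms that] by linarith
  then show ?thesis unfolding koszul_complex_def by blast
qed

lemma koszul_complex_squarefree_truncation:
  assumes "distinct xs" "\<And>x. lookup a x \<le> 1"
  shows "koszul_complex xs {m \<in> M. k \<le> card (keys m)} a =
    {\<sigma> \<in> koszul_complex xs M a. card \<sigma> + k \<le> mdeg a}"
proof -
  have "k \<le> card (keys (a - klcm xs \<sigma>)) \<longleftrightarrow> card \<sigma> + k \<le> mdeg a"
    if "\<sigma> \<subseteq> {..<length xs}" "edvd (klcm xs \<sigma>) a" for \<sigma>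
  proof -
    have "lookup (a - klcm xs \<sigma>) x \<le> 1" for x
      using assms(2)[of x] by (simp add: lookup_minus)
    then show ?thesis
      using mdeg_minus_klcm[OF assms(1) that] mdeg_squarefree[of "a - klcm xs \<sigma>"]
      by (simp del: One_nat_def) linarith
  qed
  then show ?thesis unfolding koszul_complex_def by blast
qed

definition support_closed :: "'x expo set \<Rightarrow> bool"
  where "support_closed M \<longleftrightarrow> (\<forall>m\<in>M. \<forall>m'. keys m' = keys m \<longrightarrow> m' \<in> M)"

text \<open>In a degree with an exponent at least 2 the Koszul simplicial complex of a squarefree
  ideal is a cone.\<close>

lemma acyclic_at_not_squarefree:
  assumes "distinct xs" "support_closed M" "keys a \<subseteq> set xs" "1 < lookup a x"
  shows "acyclic_at (K :: 'k::field itself) (length xs) (koszul_complex xs M a) p"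
  unfolding acyclic_at_def
proof (intro allI impI)
  have "x \<in> keys a" using assms(4) by (simp add: in_keys_iff)
  then obtain s where s: "s < length xs" "xs ! s = x" using assms(3) by (metis in_set_conv_nth subsetD)
  have insert: "insert s \<sigma> \<in> koszul_complex xs M a" if \<sigma>: "\<sigma> \<in> koszul_complex xs M a" "s \<notin> \<sigma>" for \<sigma>
  proof -
    have ins: "klcm xs (insert s \<sigma>) = klcm xs \<sigma> + single x 1"
      using klcm_insert[OF assms(1) s(1) \<sigma>(2)] s(2) by simp
    have e: "edvd (klcm xs (insert s \<sigma>)) a"
      using \<sigma>(1) s \<open>x \<in> keys a\<close> unfolding koszul_complex_def edvd_elcm_iff
      by (auto simp: edvd_ku_iff)
    have l1: "lookup (klcm xs \<sigma>) y \<le> 1" for y by (simp add: lookup_klcm)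
    have l0: "lookup (klcm xs \<sigma>) x = 0"
      using \<sigma>(2) s assms(1) by (auto simp: lookup_klcm nth_eq_iff_index_eq)
    have "y \<in> keys (a - klcm xs (insert s \<sigma>)) \<longleftrightarrow> y \<in> keys (a - klcm xs \<sigma>)" for y
      using assms(4) l0 by (cases "y = x") (simp_all add: ins in_keys_iff lookup_minus lookup_add lookup_single)
    then have "a - klcm xs (insert s \<sigma>) \<in> M"
      using \<sigma>(1) assms(2) unfolding support_closed_def koszul_complex_def by blast
    then show ?thesis using \<sigma>(1) s(1) e unfolding koszul_complex_def by simp
  qed
  fix g :: "nat set \<Rightarrow> 'k"
  assume g: "\<forall>\<sigma>. g \<sigma> \<noteq> 0 \<longrightarrow> \<sigma> \<in> koszul_complex xs M a \<and> card \<sigma> = p" and bdg: "bd (length xs) g = 0"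
  show "\<exists>h. (\<forall>\<sigma>. h \<sigma> \<noteq> 0 \<longrightarrow> \<sigma> \<in> koszul_complex xs M a \<and> card \<sigma> = Suc p) \<and> bd (length xs) h = g"
  proof (intro exI[of _ "cone s g"] conjI allI impI)
    show "bd (length xs) (cone s g) = g" using bd_cone[OF s(1), of g] bdg by simp
    fix \<sigma> assume "cone s g \<sigma> \<noteq> 0"
    then have \<sigma>: "s \<in> \<sigma>" "g (\<sigma> - {s}) \<noteq> 0" by (auto simp: cone_def split: if_splits)
    then have k: "\<sigma> - {s} \<in> koszul_complex xs M a" "card (\<sigma> - {s}) = p" using g by blast+
    from insert[OF k(1)] show "\<sigma> \<in> koszul_complex xs M a" using \<sigma>(1) by (simp add: insert_absorb)
    have "\<sigma> - {s} \<subseteq> {..<length xs}" using k(1) unfolding koszul_complex_def by simp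
    then have "finite \<sigma>" using finite_subset[of "\<sigma> - {s}" "{..<length xs}"] by simp
    then show "card \<sigma> = Suc p" using k(2) \<sigma>(1) by (metis card_Suc_Diff1)
  qed
qed

text \<open>What both truncations N of M have in common. Nothing is claimed on the line j = k + p,
  where a k-linear resolution has its Tor.\<close>

definition koszul_skeleton :: "'k::field itself \<Rightarrow> 'x list \<Rightarrow> 'x expo set \<Rightarrow> nat \<Rightarrow> 'x expo set \<Rightarrow> bool"
  where "koszul_skeleton K xs M k N \<longleftrightarrow>
    (\<forall>p j. (j < k + p \<longrightarrow> koszul_acyclic K xs N p j) \<and>
      (k + p < j \<longrightarrow> (koszul_acyclic K xs N p j \<longleftrightarrow> koszul_acyclic K xs M p j)))"

text \<open>The surviving faces have at most |a| - k vertices: either none of cardinality p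
  survives, or all those of cardinality p and p + 1 do.\<close>

lemma acyclic_at_skeleton:
  shows "mdeg a < k + p \<Longrightarrow> acyclic_at K r {\<sigma> \<in> \<Delta>. card \<sigma> + k \<le> mdeg a} p"
    and "k + p < mdeg a \<Longrightarrow>
      acyclic_at K r {\<sigma> \<in> \<Delta>. card \<sigma> + k \<le> mdeg a} p \<longleftrightarrow> acyclic_at K r \<Delta> p"
proof -
  show "mdeg a < k + p \<Longrightarrow> acyclic_at K r {\<sigma> \<in> \<Delta>. card \<sigma> + k \<le> mdeg a} p"
    by (rule acyclic_at_empty) auto
  show "k + p < mdeg a \<Longrightarrow>
      acyclic_at K r {\<sigma> \<in> \<Delta>. card \<sigma> + k \<le> mdeg a} p \<longleftrightarrow> acyclic_at K r \<Delta> p"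
    by (rule acyclic_at_cong) auto
qed

lemma koszul_skeleton_truncation:
  fixes xs :: "'x list"
  assumes "distinct xs"
  shows "koszul_skeleton K xs M k {m \<in> M. k \<le> mdeg m}"
  unfolding koszul_skeleton_def koszul_acyclic_def koszul_complex_truncation[OF assms]
proof (intro allI conjI impI)
  fix p j and a :: "'x expo" assume "j < k + p" "mdeg a = j"
  then show "acyclic_at K (length xs) {\<sigma> \<in> koszul_complex xs M a. card \<sigma> + k \<le> mdeg a} p"
    by (intro acyclic_at_skeleton) simp
next
  fix p j assume "k + p < j"
  then have "acyclic_at K (length xs) {\<sigma> \<in> koszul_complex xs M a. card \<sigma> + k \<le> mdeg a} p \<longleftrightarrow>
    acyclic_at K (length xs) (koszul_complex xs M a) p" if "mdeg a = j" for a
    by (intro acyclic_at_skeleton) (simp add: that)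
  then show "(\<forall>a. keys a \<subseteq> set xs \<longrightarrow> mdeg a = j \<longrightarrow>
      acyclic_at K (length xs) {\<sigma> \<in> koszul_complex xs M a. card \<sigma> + k \<le> mdeg a} p) \<longleftrightarrow>
    (\<forall>a. keys a \<subseteq> set xs \<longrightarrow> mdeg a = j \<longrightarrow>
      acyclic_at K (length xs) (koszul_complex xs M a) p)"
    by blast
qed

text \<open>The truncation is a skeleton in squarefree degrees. In the others both complexes are
  cones, because the truncated set is again closed under changing exponents within a
  support.\<close>

lemma koszul_skeleton_squarefree_truncation:
  assumes "distinct xs" "support_closed M"
  shows "koszul_skeleton K xs M k {m \<in> M. k \<le> card (keys m)}"
proof -
  let ?N = "{m \<in> M. k \<le> card (keys m)}"
  have N: "support_closed ?N" using assms(2) unfolding support_closed_def by auto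
  have nonsq: "acyclic_at K (length xs) (koszul_complex xs M a) p" "acyclic_at K (length xs) (koszul_complex xs ?N a) p"
    if a: "keys a \<subseteq> set xs" "\<not> (\<forall>x. lookup a x \<le> 1)" for a p
  proof -
    obtain x where "1 < lookup a x" using a(2) by (auto simp: not_le)
    then show "acyclic_at K (length xs) (koszul_complex xs M a) p"
      "acyclic_at K (length xs) (koszul_complex xs ?N a) p"
      using acyclic_at_not_squarefree[OF assms a(1)] acyclic_at_not_squarefree[OF assms(1) N a(1)] by blast+
  qed
  show ?thesis
    unfolding koszul_skeleton_def koszul_acyclic_def
  proof (intro allI conjI impI)
    fix p j a assume a: "j < k + p" "keys a \<subseteq> set xs" "mdeg a = j"
    show "acyclic_at K (length xs) (koszul_complex xs ?N a) p"
    proof (cases "\<forall>x. lookup a x \<le> 1")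
      case True
      then have "koszul_complex xs ?N a = {\<sigma> \<in> koszul_complex xs M a. card \<sigma> + k \<le> mdeg a}"
        by (intro koszul_complex_squarefree_truncation assms) simp
      then show ?thesis using acyclic_at_skeleton(1)[of a k p] a by simp
    qed (use nonsq a in blast)
  next
    fix p j assume kp: "k + p < j"
    have "acyclic_at K (length xs) (koszul_complex xs ?N a) p \<longleftrightarrow>
      acyclic_at K (length xs) (koszul_complex xs M a) p" if a: "keys a \<subseteq> set xs" "mdeg a = j" for a
    proof (cases "\<forall>x. lookup a x \<le> 1")
      case True
      then have "koszul_complex xs ?N a = {\<sigma> \<in> koszul_complex xs M a. card \<sigma> + k \<le> mdeg a}"
        by (intro koszul_complex_squarefree_truncation assms) simp
      then show ?thesis using acyclic_at_skeleton(2)[of k p a] a kp by simp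
    qed (use nonsq a in blast)
    then show "(\<forall>a. keys a \<subseteq> set xs \<longrightarrow> mdeg a = j \<longrightarrow>
        acyclic_at K (length xs) (koszul_complex xs ?N a) p) \<longleftrightarrow>
      (\<forall>a. keys a \<subseteq> set xs \<longrightarrow> mdeg a = j \<longrightarrow>
        acyclic_at K (length xs) (koszul_complex xs M a) p)"
      by blast
  qed
qed

text \<open>Nonvanishing at p = 0, j = k forces q = k. Below the line j = k + p the truncation has
  no homology anyway, so the degrees above it decide.\<close>

lemma koszul_linear_skeleton:
  assumes "koszul_skeleton K xs M k N" "k > 0" "\<not> koszul_acyclic K xs N 0 k"
  shows "koszul_linear K xs N \<longleftrightarrow> koszul_regular K xs M k"
proof
  assume "koszul_linear K xs N"
  then obtain q where q: "\<And>p j. j \<noteq> q + p \<Longrightarrow> j = 0 \<or> koszul_acyclic K xs N p j"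
    unfolding koszul_linear_def by blast
  have "q = k" using q[of k 0] assms(2,3) by auto
  then have "koszul_acyclic K xs N p j" if "k + p < j" for p j using q[of j p] that by simp
  then show "koszul_regular K xs M k"
    using assms(1) unfolding koszul_regular_def koszul_skeleton_def by blast
next
  assume "koszul_regular K xs M k"
  then have "koszul_acyclic K xs N p j" if "j \<noteq> k + p" for p j
    using that assms(1) unfolding koszul_regular_def koszul_skeleton_def by (meson linorder_neqE_nat)
  then show "koszul_linear K xs N" unfolding koszul_linear_def by blast
qed

text \<open>A monomial of degree exactly k in M is a minimal generator of the truncation: in its own
  degree only the empty face survives.\<close>

lemma koszul_linear_truncation:
  assumes "distinct xs" "k > 0" "m \<in> M" "mdeg m = k" "keys m \<subseteq> set xs"
  shows "koszul_linear K xs {m \<in> M. k \<le> mdeg m} \<longleftrightarrow> koszul_regular K xs M k"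
proof (rule koszul_linear_skeleton[OF koszul_skeleton_truncation[OF assms(1)] assms(2)])
  have "\<not> acyclic_at K (length xs) (koszul_complex xs {m \<in> M. k \<le> mdeg m} m) 0"
    unfolding koszul_complex_truncation[OF assms(1)]
    by (rule not_acyclic_at_point) (use assms in \<open>auto simp: koszul_complex_def\<close>)
  then show "\<not> koszul_acyclic K xs {m \<in> M. k \<le> mdeg m} 0 k"
    unfolding koszul_acyclic_def using assms(4,5) by blast
qed

lemma koszul_linear_squarefree_truncation:
  assumes "distinct xs" "support_closed M" "k > 0" "m \<in> M" "mdeg m = k" "keys m \<subseteq> set xs"
    and "\<And>x. lookup m x \<le> 1"
  shows "koszul_linear K xs {m \<in> M. k \<le> card (keys m)} \<longleftrightarrow> koszul_regular K xs M k"
proof (rule koszul_linear_skeleton[OF koszul_skeleton_squarefree_truncation[OF assms(1,2)] assms(3)])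
  have "\<not> acyclic_at K (length xs) (koszul_complex xs {m \<in> M. k \<le> card (keys m)} m) 0"
    unfolding koszul_complex_squarefree_truncation[OF assms(1,7)]
    by (rule not_acyclic_at_point) (use assms in \<open>auto simp: koszul_complex_def\<close>)
  then show "\<not> koszul_acyclic K xs {m \<in> M. k \<le> card (keys m)} 0 k"
    unfolding koszul_acyclic_def using assms(5,6) by blast
qed

lemma koszul_linear_empty: "koszul_linear K xs {}"
  unfolding koszul_linear_def koszul_acyclic_def
  by (intro exI allI impI disjI2 acyclic_at_empty) (simp add: koszul_complex_def)

text \<open>In degrees above the number of variables no monomial is squarefree, so all complexes
  there are cones.\<close>

lemma koszul_regular_large:
  assumes "distinct xs" "support_closed M" "length xs \<le> k"
  shows "koszul_regular K xs M k"
  unfolding koszul_regular_def koszul_acyclic_def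
proof (intro allI impI)
  fix p j a assume a: "k + p < j" "keys a \<subseteq> set xs" "mdeg a = j"
  have "\<exists>x. 1 < lookup a x"
  proof (rule ccontr)
    assume "\<nexists>x. 1 < lookup a x"
    then have "mdeg a = card (keys a)" by (intro mdeg_squarefree) (simp add: not_less)
    also have "\<dots> \<le> length xs" using card_mono[OF _ a(2)] distinct_card[OF assms(1)] by simp
    finally show False using a assms(3) by simp
  qed
  then obtain x where "1 < lookup a x" ..
  then show "acyclic_at K (length xs) (koszul_complex xs M a) p"
    by (rule acyclic_at_not_squarefree[OF assms(1,2) a(2)])
qed

text \<open>A monomial of degree below k is multiplied by a power of one variable to reach degree k;
  this requires a variable to exist.\<close>

lemma koszul_linear_truncation_iff:
  assumes "distinct xs" "upset (set xs) M" "k > 0" "m \<in> M" "mdeg m < k" "xs \<noteq> []"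
  shows "koszul_linear K xs {m \<in> M. k \<le> mdeg m} \<longleftrightarrow> koszul_regular K xs M k"
proof -
  let ?c = "single (hd xs) (k - mdeg m)"
  have "keys ?c \<subseteq> set xs" using assms(6) by simp
  then have "m + ?c \<in> M" using assms(2,4) unfolding upset_def by blast
  moreover from this have "keys (m + ?c) \<subseteq> set xs" using assms(2) unfolding upset_def by blast
  moreover have "mdeg (m + ?c) = k" using assms(5) by simp
  ultimately show ?thesis using koszul_linear_truncation[OF assms(1,3)] by blast
qed

text \<open>With at least k variables, the support of m can be enlarged to exactly k of them. With
  fewer, the squarefree truncation is zero, hence linear, and the regularity bound holds because no
  squarefree degree is left.\<close>

lemma koszul_linear_squarefree_truncation_iff:
  assumes xs: "distinct xs" and M: "upset (set xs) M" "support_closed M"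
    and "k > 0" "m \<in> M" "mdeg m < k"
  shows "koszul_linear K xs {m \<in> M. k \<le> card (keys m)} \<longleftrightarrow> koszul_regular K xs M k"
proof -
  have keys: "keys m \<subseteq> set xs" using M(1) assms(5) unfolding upset_def by blast
  show ?thesis
  proof (cases "k \<le> length xs")
    case False
    have "card (keys m) \<le> length xs" if "m \<in> M" for m
    proof -
      have "keys m \<subseteq> set xs" using M(1) that unfolding upset_def by blast
      then show ?thesis using card_mono[of "set xs"] distinct_card[OF xs] by simp
    qed
    then have empty: "{m \<in> M. k \<le> card (keys m)} = {}" using False by (force simp: not_le)
    show ?thesis unfolding empty using koszul_linear_empty[of K xs] koszul_regular_large[OF xs M(2), of k K] False by simp
  next
    case True
    \<comment> \<open>Since m itself need not be squarefree, it is first replaced by the product of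
      its variables, which still lies in M.\<close>
    let ?r = "indicator_exp (keys m)"
    have r: "?r \<in> M" using M(2) assms(5) unfolding support_closed_def by (simp add: keys_indicator_exp)
    have "card (keys m) \<le> mdeg m"
      using edvd_mdeg[of ?r m] by (simp add: edvd_indicator_exp_iff mdeg_indicator_exp)
    then have "card (keys m) \<le> k" using assms(6) by simp
    moreover have "k \<le> card (set xs)" using True distinct_card[OF xs] by simp
    ultimately obtain A where A: "keys m \<subseteq> A" "A \<subseteq> set xs" "card A = k"
      using exists_subset_between[of "keys m" k "set xs"] keys by auto
    have fA: "finite A" using A(2) finite_subset by blast
    have e: "edvd ?r (indicator_exp A)" by (simp add: edvd_indicator_exp_iff keys_indicator_exp fA A(1))
    have "keys (indicator_exp A - ?r) \<subseteq> set xs"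
      using A(2) keys_indicator_exp[OF fA] by (auto simp: in_keys_iff lookup_minus)
    then have "?r + (indicator_exp A - ?r) \<in> M" using M(1) r unfolding upset_def by blast
    then have "indicator_exp A \<in> M" by (simp add: edvd_add_minus[OF e])
    then show ?thesis
      by (intro koszul_linear_squarefree_truncation[OF xs M(2) assms(4), of "indicator_exp A"])
        (use A fA in \<open>auto simp: mdeg_indicator_exp keys_indicator_exp lookup_indicator_exp\<close>)
  qed
qed

theorem corollary3p4:
  fixes n k :: nat and I :: "(nat, 'k::field) mpoly set"
  defines "V \<equiv> {1..n}"
  defines "W \<equiv> polarization_vars V I"
  assumes "monomial_ideal V I" and "k > 0"
  shows "(has_linear_resolution V (truncation V I k) \<longleftrightarrow>
            has_linear_resolution W (truncation W (polarization V I) k)) \<and>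
         (has_linear_resolution W (truncation W (polarization V I) k) \<longleftrightarrow>
            has_linear_resolution W (squarefree_truncation W (polarization V I) k))"
proof -
  have finV: "finite V" by (simp add: V_def)
  obtain U where U: "U \<subseteq> {m. keys m \<subseteq> V}" "I = Idl\<^bsub>poly_ring V\<^esub> (monomial ` U)"
    using assms(3) unfolding monomial_ideal_def by blast
  define M where "M = up_closure V U"
  have upM: "upset V M" unfolding M_def by (rule upset_up_closure)
  have I: "I = mideal M" unfolding U(2) M_def by (rule genideal_monomials) (use U(1) in auto)
  define N where "N = up_closure W (pexp V ` minimal_exps M)"
  have upN: "upset W N" unfolding N_def by (rule upset_up_closure)
  note pol = polarization_mideal[OF finV upM, where 'k = 'k, folded I, folded W_def]
  have finW: "finite W" by (rule pol(1))
  have P: "polarization V I = mideal N" unfolding N_def by (rule pol(3))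
  obtain xs where xs: "set xs = V" "distinct xs" using finite_distinct_list[OF finV] by blast
  obtain ys where ys: "set ys = W" "distinct ys" using finite_distinct_list[OF finW] by blast
  obtain u and r :: nat where u: "u ` {..<r} = minimal_exps M"
    using finite_imp_generated[OF finite_minimal_exps[OF finV upM]] .
  have keys_u: "keys (u s) \<subseteq> V" if "s < r" for s
  proof -
    have "u s \<in> minimal_exps M" using u that by blast
    then show ?thesis using upM unfolding minimal_exps_def upset_def by blast
  qed
  have keys_pu: "keys (pexp V (u s)) \<subseteq> W" if "s < r" for s
    by (rule pol(2)) (use u that in blast)
  have genM: "M = generated V u r"
    using up_closure_minimal_exps[OF upM] unfolding u[symmetric] up_closure_generated by simp
  have genN: "N = generated W (\<lambda>s. pexp V (u s)) r"
    unfolding N_def u[symmetric] image_image by (rule up_closure_generated)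
  have lookup_pu: "lookup (pexp V (u s)) y \<le> 1" for s y
    by (cases y) (simp add: lookup_pexp[OF finV])
  have mdeg_pu: "mdeg (pexp V (u s)) = mdeg (u s)" if "s < r" for s
    by (rule mdeg_pexp[OF finV keys_u[OF that]])
  have card_pu: "card (keys (pexp V (u s))) = mdeg (u s)" if "s < r" for s
    using mdeg_pu[OF that] mdeg_squarefree[OF lookup_pu, of s] by simp
  have acyclic: "koszul_acyclic TYPE('k) xs M p j \<longleftrightarrow> koszul_acyclic TYPE('k) ys N p j" if "j > 0" for p j
    unfolding genM genN
    by (rule koszul_acyclic_pexp[OF finV _ xs(2,1) finW _ ys(2,1) that]) (use keys_u keys_pu in blast)+
  \<comment> \<open>Divisibility by a squarefree monomial depends on the support only, which makes N
    closed under changing exponents within a support.\<close>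
  have squarefree: "edvd (pexp V (u s)) m \<longleftrightarrow> keys (pexp V (u s)) \<subseteq> keys m" for s m
  proof -
    have "pexp V (u s) = indicator_exp (keys (pexp V (u s)))"
    proof (rule poly_mapping_eqI)
      fix y
      show "lookup (pexp V (u s)) y =
          lookup (indicator_exp (keys (pexp V (u s)))) y"
        using lookup_pu[of s y] by (auto simp: lookup_indicator_exp in_keys_iff)
    qed
    then show ?thesis using edvd_indicator_exp_iff[of "keys (pexp V (u s))" m] by simp
  qed
  have scN: "support_closed N"
    unfolding support_closed_def genN generated_def squarefree by simp
  let ?Mk = "{m \<in> M. k \<le> mdeg m}" and ?Nk = "{m \<in> N. k \<le> mdeg m}"
    and ?Ns = "{m \<in> N. k \<le> card (keys m)}"
  have up: "upset V ?Mk" "upset W ?Nk" "upset W ?Ns"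
  proof -
    show "upset V ?Mk" "upset W ?Nk" using upM upN by (auto simp: upset_def)
    have "card (keys m) \<le> card (keys (m + c))" for m c :: "nat \<times> nat \<Rightarrow>\<^sub>0 nat"
      by (intro card_mono edvd_keys) auto
    then show "upset W ?Ns" using upN le_trans unfolding upset_def by blast
  qed
  have lin: "has_linear_resolution V (truncation V I k) \<longleftrightarrow> koszul_linear TYPE('k) xs ?Mk"
    "has_linear_resolution W (truncation W (polarization V I) k) \<longleftrightarrow> koszul_linear TYPE('k) ys ?Nk"
    "has_linear_resolution W (squarefree_truncation W (polarization V I) k) \<longleftrightarrow> koszul_linear TYPE('k) ys ?Ns"
    unfolding P unfolding I truncation_mideal[OF upM] truncation_mideal[OF upN] squarefree_truncation_mideal[OF upN]
    by (intro has_linear_resolution_iff finV finW up xs ys)+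
  have "(koszul_linear TYPE('k) xs ?Mk \<longleftrightarrow> koszul_linear TYPE('k) ys ?Nk) \<and>
    (koszul_linear TYPE('k) ys ?Nk \<longleftrightarrow> koszul_linear TYPE('k) ys ?Ns)"
  \<comment> \<open>If no generator has degree below k, neither has a generator of the polarization;
    then no truncation changes anything, and linearity of I and of its polarization is compared
    directly.\<close>
  proof (cases "\<forall>s<r. k \<le> mdeg (u s)")
    case True
    have "k \<le> mdeg m" if m: "m \<in> M" for m
    proof -
      obtain s where "s < r" "edvd (u s) m" using m unfolding genM generated_def by blast
      then show ?thesis using True edvd_mdeg le_trans by blast
    qed
    then have Mk: "?Mk = M" by blast
    have N: "k \<le> mdeg m \<and> k \<le> card (keys m)" if m: "m \<in> N" for m
    proof -
      obtain s where s: "s < r" "edvd (pexp V (u s)) m" using m unfolding genN generated_def by blast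
      have "card (keys (pexp V (u s))) \<le> card (keys m)"
        by (intro card_mono edvd_keys s(2)) simp
      moreover have "mdeg (pexp V (u s)) \<le> mdeg m" by (rule edvd_mdeg[OF s(2)])
      moreover have "k \<le> mdeg (u s)" using True s(1) by blast
      ultimately show ?thesis using card_pu[OF s(1)] mdeg_pu[OF s(1)] by linarith
    qed
    then have Nk: "?Nk = N" "?Ns = N" by blast+
    \<comment> \<open>\<open>acyclic\<close> is available for j > 0, and linearity exempts j =
      0.\<close>
    have "koszul_linear TYPE('k) xs M \<longleftrightarrow> koszul_linear TYPE('k) ys N"
      unfolding koszul_linear_def using acyclic by (metis neq0_conv)
    then show ?thesis unfolding Mk Nk by blast
  next
    case False
    then obtain s where s: "s < r" "mdeg (u s) < k" by (auto simp: not_le)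
    have usM: "u s \<in> M" using s(1) keys_u edvd_refl unfolding genM generated_def by blast
    have psN: "pexp V (u s) \<in> N" using s(1) keys_pu edvd_refl unfolding genN generated_def by blast
    have ps: "mdeg (pexp V (u s)) < k" using s mdeg_pu by simp
    have reg: "koszul_regular TYPE('k) xs M k \<longleftrightarrow> koszul_regular TYPE('k) ys N k"
      unfolding koszul_regular_def using acyclic by (metis gr_implies_not0 neq0_conv)
    have M: "koszul_linear TYPE('k) xs ?Mk \<longleftrightarrow> koszul_regular TYPE('k) xs M k" if "V \<noteq> {}"
      by (rule koszul_linear_truncation_iff[OF xs(2) _ assms(4) usM s(2)]) (use upM xs(1) that in auto)
    have Ns: "koszul_linear TYPE('k) ys ?Ns \<longleftrightarrow> koszul_regular TYPE('k) ys N k"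
      by (rule koszul_linear_squarefree_truncation_iff[OF ys(2) _ scN assms(4) psN ps]) (use upN ys(1) in simp)
    show ?thesis
    \<comment> \<open>\<open>koszul_linear_truncation_iff\<close> needs a variable. As a generator
      exists in this branch, W is empty only for the unit ideal, whose polarization lives in a ring
      without variables even when V is nonempty.\<close>
    proof (cases "W = {}")
      case False
      then have "V \<noteq> {}" by (auto simp: W_def polarization_vars_def)
      moreover have "koszul_linear TYPE('k) ys ?Nk \<longleftrightarrow> koszul_regular TYPE('k) ys N k"
        by (rule koszul_linear_truncation_iff[OF ys(2) _ assms(4) psN ps]) (use upN ys(1) False in auto)
      ultimately show ?thesis using M Ns reg by blast
    next
      case True
      then have "ys = []" using ys(1) by simp
      then have regN: "koszul_regular TYPE('k) ys N k"
        using koszul_regular_large[OF ys(2) scN] by simp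
      \<comment> \<open>Without variables the only exponent is 0, whose degree is below k.\<close>
      have zero: "X = {}" if "upset Y X" "\<forall>m\<in>X. k \<le> mdeg m" "Y = {}" for X Y
      proof (rule ccontr)
        assume "X \<noteq> {}"
        then obtain m where "m \<in> X" by blast
        then have "m = 0" "k \<le> mdeg m" using that unfolding upset_def by auto
        then show False using assms(4) by simp
      qed
      have "?Nk = {}" by (rule zero[OF up(2)]) (use True in auto)
      then have "koszul_linear TYPE('k) ys ?Nk" by (simp only: koszul_linear_empty)
      moreover have "koszul_linear TYPE('k) xs ?Mk"
      proof (cases "V = {}")
        case True
        have "m = 0" if "m \<in> ?Mk" for m using up(1) that True unfolding upset_def by auto
        then have "?Mk = {}" using assms(4) by fastforce
        then show ?thesis by (simp only: koszul_linear_empty)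
      next
        case False
        \<comment> \<open>The regularity bound holds over W for lack of variables and is carried
          back to V.\<close>
        then show ?thesis using M reg regN by blast
      qed
      ultimately show ?thesis using Ns regN by blast
    qed
  qed
  then show ?thesis unfolding lin .
qed

end
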